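(* Consider a quadruple-point event $\mathrm{Q}$ of generic immersions of a closed oriented surface into $\mathbb{R}^3$, in which one of the four sheets (the moving sheet) passes the triple point formed by the other three. Let $\underline{\mathbb{R}^2}$ be the slice plane, carried by the moving sheet, taken immediately before and after the event, and fix it with its coorientation given by the positive direction of the height function $z$. Define $$\mathrm{sgn}(\underline{\mathbb{R}^2})=\begin{cases}-1 & \text{if the local transition is upward (the moving sheet passes the triple point in the direction of increasing } z),\\ +1 & \text{if the local transition is downward.}\end{cases}$$ Let $dSt_{(1)}$ be the change of $St_{(1)}$ under the Reidemeister move $\Omega_3$ induced by the event on the slice plane, and $dSt_{(2)}$ the change of $St_{(2)}$ under the event. Then $$dSt_{(2)}=dSt_{(1)}+\mathrm{sgn}(\underline{\mathbb{R}^2}).$$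
   Context: Surfaces. Let $\Sigma$ be a closed oriented surface. An immersion $S:\Sigma\looparrowright\mathbb{R}^3$ is generic if its image has only transverse intersections of two or three smooth sheets. The orientations of $\Sigma$ and of $\mathbb{R}^3$ induce a coorientation (a choice of normal direction) of the immersed surface. The Alexander numbering assigns to each region (component of the complement of the image) a half-integer, with value $-\tfrac32$ on the region containing infinity, increasing by $1$ when a sheet is crossed in the direction of its coorientation. The index $\mathrm{ind}(t)$ of a triple point $t$ is the average of the Alexander numbers of the eight regions locally adjacent to $t$. With $T(S)$ the set of triple points, $St_{(2)}(S)=\sum_{t\in T(S)}\mathrm{ind}(t)$. Quadruple-point event. An event $\mathrm{Q}$ is a local modification in a small ball, within a regular homotopy, in which four sheets, any three of them in general position, pass through a common point: one sheet crosses over the triple point formed by the other three. Immediately before and immediately after the event the four sheets bound a small tetrahedron with four triple points as vertices; it shrinks to the quadruple point and reappears inverted. The immersion is unchanged outside the ball. Define $dSt_{(2)}=St_{(2)}(\text{after})-St_{(2)}(\text{before})$. Curves. For a generic plane curve $C$ (image of finitely many circles with only transverse double points) with a coorientation, the Alexander numbering of the complementary regions increases by $1$ when the curve is crossed in the direction of its coorientation, with a fixed value on the unbounded region. The index $\mathrm{ind}(d)$ of a double point $d$ is the average of the numbers of the four adjacent regions, and $St_{(1)}(C)=\sum_{d}\mathrm{ind}(d)$, the sum over all double points of $C$. For a Reidemeister move $\Omega_3$ (one strand crossing the double point of two others inside a small disk, the curve being unchanged elsewhere), $dSt_{(1)}=St_{(1)}(\text{after})-St_{(1)}(\text{before})$.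 An orientation of the curve is not needed; only its coorientation is used. Slice plane. The surface is positioned so that the height coordinate $z$ behaves like a Morse function, and slices are taken by horizontal planes. One of the sheets involved in the event is chosen as the moving sheet and is locally viewed as the horizontal slice plane $\underline{\mathbb{R}^2}$; the coorientation fixed on the slice plane is the coorientation of this sheet and points in the direction of increasing $z$. The intersections of the other three sheets with it are curves on the slice plane, cooriented by the coorientations of those sheets. The three curves bound a vanishing triangle (the face of the tetrahedron lying on the moving sheet), and the quadruple-point event induces on the slice plane a Reidemeister move $\Omega_3$ collapsing and inverting this triangle. Indices used in $dSt_{(1)}$ are computed on the slice plane. Sign convention of the paper: the positive direction of a $\mathrm{Q}$-event is the one in which the number of faces of the tetrahedron with coorientation pointing outward increases; if this number is $2$ (type $\mathrm{Q}^2$) it does not change across the event. *)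

theory Defs
  imports "HOL-Analysis.Analysis"
begin

section \<open>Smooth maps and closed oriented surfaces\<close>

text \<open>\<open>C_k_on k S f\<close>: the map is \<open>k\<close> times continuously differentiable on \<open>S\<close>; meant for open \<open>S\<close>.\<close>

primrec C_k_on :: "nat \<Rightarrow> 'a::euclidean_space set \<Rightarrow> ('a \<Rightarrow> 'b::euclidean_space) \<Rightarrow> bool" where
  "C_k_on 0 S f \<longleftrightarrow> continuous_on S f"
| "C_k_on (Suc k) S f \<longleftrightarrow>
     (\<forall>x\<in>S. f differentiable (at x)) \<and> (\<forall>v. C_k_on k S (\<lambda>x. frechet_derivative f (at x) v))"

definition smooth_on :: "'a::euclidean_space set \<Rightarrow> ('a \<Rightarrow> 'b::euclidean_space) \<Rightarrow> bool" where
  "smooth_on S f \<longleftrightarrow> (\<forall>k. C_k_on k S f)"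

type_synonym 'a atlas = "('a set \<times> ('a \<Rightarrow> real^2)) set"

text \<open>The orientation is carried by the atlas: all transition maps have positive Jacobian.
  The boundary is empty because charts map onto open subsets of the plane.\<close>

definition closed_oriented_surface :: "'a topology \<Rightarrow> 'a atlas \<Rightarrow> bool" where
  "closed_oriented_surface X A \<longleftrightarrow>
     Hausdorff_space X \<and> compact_space X \<and> (\<Union>(V, \<phi>)\<in>A. V) = topspace X \<and>
     (\<forall>(V, \<phi>)\<in>A. openin X V \<and> open (\<phi> ` V) \<and>
        homeomorphic_map (subtopology X V) (top_of_set (\<phi> ` V)) \<phi>) \<and>
     (\<forall>(V, \<phi>)\<in>A. \<forall>(W, \<psi>)\<in>A.
        smooth_on (\<phi> ` (V \<inter> W)) (\<psi> \<circ> inv_into V \<phi>) \<and>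
        (\<forall>u\<in>\<phi> ` (V \<inter> W). det (matrix (frechet_derivative (\<psi> \<circ> inv_into V \<phi>) (at u))) > 0))"

definition surface_immersion :: "'a atlas \<Rightarrow> ('a \<Rightarrow> real^3) \<Rightarrow> bool" where
  "surface_immersion A f \<longleftrightarrow>
     (\<forall>(V, \<phi>)\<in>A. smooth_on (\<phi> ` V) (f \<circ> inv_into V \<phi>) \<and>
        (\<forall>u\<in>\<phi> ` V. inj (frechet_derivative (f \<circ> inv_into V \<phi>) (at u))))"

text \<open>The coorientation induced by the orientations: the unit normal \<open>n\<close> such that
  \<open>(e\<^sub>1, e\<^sub>2, n)\<close>, equivalently \<open>(n, e\<^sub>1, e\<^sub>2)\<close>, is a positive frame of space whenever
  \<open>(e\<^sub>1, e\<^sub>2)\<close> is the image of a positive frame of the surface.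
  It does not depend on the chart selected at \<open>p\<close>.\<close>

definition surface_normal :: "'a atlas \<Rightarrow> ('a \<Rightarrow> real^3) \<Rightarrow> 'a \<Rightarrow> real^3" where
  "surface_normal A f p =
     (let (V, \<phi>) = (SOME c. c \<in> A \<and> p \<in> fst c);
          D = frechet_derivative (f \<circ> inv_into V \<phi>) (at (\<phi> p))
      in sgn (cross3 (D (axis 1 1)) (D (axis 2 1))))"


section \<open>Cooriented immersed hypersurfaces: general position, Alexander numbering, index\<close>

text \<open>
  The notions of this section are shared by surfaces in space and curves in the plane.
  A cooriented immersed hypersurface is given by its source \<open>M\<close>, the map \<open>f\<close> and the unit
  normal field \<open>\<nu>\<close> that coorients it.  A sheet through \<open>x\<close> corresponds to a point of the
  preimage of \<open>x\<close>.\<close>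

definition preimages :: "'m set \<Rightarrow> ('m \<Rightarrow> 'e) \<Rightarrow> 'e \<Rightarrow> 'm set" where
  "preimages M f x = {p \<in> M. f p = x}"

text \<open>The hyperplanes tangent to the sheets at the points of \<open>Q\<close> are in general position,
  i.e. their normals are linearly independent.\<close>

definition general_position :: "('m \<Rightarrow> 'e::euclidean_space) \<Rightarrow> 'm set \<Rightarrow> bool" where
  "general_position \<nu> Q \<longleftrightarrow> finite Q \<and> inj_on \<nu> Q \<and> independent (\<nu> ` Q)"

definition generic_at ::
  "'m set \<Rightarrow> ('m \<Rightarrow> 'e::euclidean_space) \<Rightarrow> ('m \<Rightarrow> 'e) \<Rightarrow> nat \<Rightarrow> 'e \<Rightarrow> bool" where
  "generic_at M f \<nu> k x \<longleftrightarrow>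
     card (preimages M f x) \<le> k \<and> general_position \<nu> (preimages M f x)"

definition multiple_points :: "'m set \<Rightarrow> ('m \<Rightarrow> 'e) \<Rightarrow> nat \<Rightarrow> 'e set" where
  "multiple_points M f k = {x. finite (preimages M f x) \<and> card (preimages M f x) = k}"

text \<open>A numbering of the regions is a function on points that is constant on each component
  of the complement of the image; its values on the image are irrelevant.  \<open>c\<close> is the value
  at infinity.\<close>

definition alexander_numbering ::
  "'m set \<Rightarrow> ('m \<Rightarrow> 'e::euclidean_space) \<Rightarrow> ('m \<Rightarrow> 'e) \<Rightarrow> real \<Rightarrow> ('e \<Rightarrow> real) \<Rightarrow> bool" where
  "alexander_numbering M f \<nu> c \<alpha> \<longleftrightarrow>
     (\<forall>x y. connected_component (- f ` M) x y \<longrightarrow> \<alpha> x = \<alpha> y) \<and>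
     (\<forall>x. x \<notin> f ` M \<and> \<not> bounded (connected_component_set (- f ` M) x) \<longrightarrow> \<alpha> x = c) \<and>
     (\<forall>p\<in>M. preimages M f (f p) = {p} \<longrightarrow>
        (\<forall>\<^sub>F e in at_right 0. \<alpha> (f p + e *\<^sub>R \<nu> p) = \<alpha> (f p - e *\<^sub>R \<nu> p) + 1))"

text \<open>
  The \<open>k\<close> sheets through a \<open>k\<close>-fold point \<open>x\<close> cut a neighbourhood of \<open>x\<close> into \<open>2 ^ k\<close>
  regions, one for each set \<open>S\<close> of sheets on whose positive side the region lies.  Its
  number is the number found when leaving \<open>x\<close> along any straight ray into that region.\<close>

definition local_region_number ::
  "'m set \<Rightarrow> ('m \<Rightarrow> 'e::euclidean_space) \<Rightarrow> ('m \<Rightarrow> 'e) \<Rightarrow> ('e \<Rightarrow> real) \<Rightarrow> 'e \<Rightarrow> 'm set \<Rightarrow> real" where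
  "local_region_number M f \<nu> \<alpha> x S =
     (THE a. \<forall>w. (\<forall>p\<in>S. w \<bullet> \<nu> p > 0) \<and> (\<forall>p\<in>preimages M f x - S. w \<bullet> \<nu> p < 0) \<longrightarrow>
        (\<forall>\<^sub>F e in at_right 0. \<alpha> (x + e *\<^sub>R w) = a))"

definition index ::
  "'m set \<Rightarrow> ('m \<Rightarrow> 'e::euclidean_space) \<Rightarrow> ('m \<Rightarrow> 'e) \<Rightarrow> ('e \<Rightarrow> real) \<Rightarrow> 'e \<Rightarrow> real" where
  "index M f \<nu> \<alpha> x =
     (\<Sum>S\<in>Pow (preimages M f x). local_region_number M f \<nu> \<alpha> x S) / 2 ^ card (preimages M f x)"

definition St ::
  "nat \<Rightarrow> 'm set \<Rightarrow> ('m \<Rightarrow> 'e::euclidean_space) \<Rightarrow> ('m \<Rightarrow> 'e) \<Rightarrow> ('e \<Rightarrow> real) \<Rightarrow> real" where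
  "St k M f \<nu> \<alpha> = (\<Sum>x\<in>multiple_points M f k. index M f \<nu> \<alpha> x)"


section \<open>Generic surfaces and generic plane curves\<close>

definition generic_surface :: "'a topology \<Rightarrow> 'a atlas \<Rightarrow> ('a \<Rightarrow> real^3) \<Rightarrow> bool" where
  "generic_surface X A f \<longleftrightarrow>
     surface_immersion A f \<and> (\<forall>x. generic_at (topspace X) f (surface_normal A f) 3 x)"

definition surface_alexander ::
  "'a topology \<Rightarrow> 'a atlas \<Rightarrow> ('a \<Rightarrow> real^3) \<Rightarrow> (real^3 \<Rightarrow> real) \<Rightarrow> bool" where
  "surface_alexander X A f \<alpha> \<longleftrightarrow>
     alexander_numbering (topspace X) f (surface_normal A f) (- (3/2)) \<alpha>"

definition St_surface :: "'a topology \<Rightarrow> 'a atlas \<Rightarrow> ('a \<Rightarrow> real^3) \<Rightarrow> (real^3 \<Rightarrow> real) \<Rightarrow> real" where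
  "St_surface X A f \<alpha> = St 3 (topspace X) f (surface_normal A f) \<alpha>"

text \<open>A cooriented curve with \<open>circles C\<close> components, each parametrized with period 1.
  The direction of the parametrization has no meaning; the coorientation is the field
  \<open>conormal\<close>.\<close>

record plane_curve =
  circles :: nat
  param :: "nat \<Rightarrow> real \<Rightarrow> real^2"
  conormal :: "nat \<Rightarrow> real \<Rightarrow> real^2"

definition curve_dom :: "plane_curve \<Rightarrow> (nat \<times> real) set" where
  "curve_dom C = {..<circles C} \<times> {0..<1}"

definition curve_map :: "plane_curve \<Rightarrow> nat \<times> real \<Rightarrow> real^2" where
  "curve_map C = (\<lambda>(i, u). param C i u)"

definition curve_normal :: "plane_curve \<Rightarrow> nat \<times> real \<Rightarrow> real^2" where
  "curve_normal C = (\<lambda>(i, u). conormal C i u)"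

definition generic_curve :: "plane_curve \<Rightarrow> bool" where
  "generic_curve C \<longleftrightarrow>
     (\<forall>i<circles C. smooth_on UNIV (param C i) \<and> continuous_on UNIV (conormal C i) \<and>
        (\<forall>u. param C i (u + 1) = param C i u \<and> conormal C i (u + 1) = conormal C i u \<and>
             vector_derivative (param C i) (at u) \<noteq> 0 \<and> norm (conormal C i u) = 1 \<and>
             orthogonal (conormal C i u) (vector_derivative (param C i) (at u)))) \<and>
     (\<forall>x. generic_at (curve_dom C) (curve_map C) (curve_normal C) 2 x)"

definition curve_alexander :: "plane_curve \<Rightarrow> real \<Rightarrow> (real^2 \<Rightarrow> real) \<Rightarrow> bool" where
  "curve_alexander C c \<alpha> \<longleftrightarrow>
     alexander_numbering (curve_dom C) (curve_map C) (curve_normal C) c \<alpha>"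

definition St_curve :: "plane_curve \<Rightarrow> (real^2 \<Rightarrow> real) \<Rightarrow> real" where
  "St_curve C \<alpha> = St 2 (curve_dom C) (curve_map C) (curve_normal C) \<alpha>"


section \<open>Arrangements of sheets in a ball\<close>

text \<open>
  The part of the hypersurface in the open ball \<open>B\<close> consists of the sheets \<open>f ` U j\<close>,
  \<open>j \<in> J\<close>.  Each is an embedded open disc of codimension 1 that divides \<open>B\<close> into the side
  \<open>P j\<close>, to which its coorientation points, and the opposite side \<open>B - f ` U j - P j\<close>.\<close>

definition sheets_in_ball ::
  "'m set \<Rightarrow> ('m \<Rightarrow> 'e::euclidean_space) \<Rightarrow> ('m \<Rightarrow> 'e) \<Rightarrow> 'e set \<Rightarrow>
   'j set \<Rightarrow> ('j \<Rightarrow> 'm set) \<Rightarrow> ('j \<Rightarrow> 'e set) \<Rightarrow> bool" where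
  "sheets_in_ball M f \<nu> B J U P \<longleftrightarrow>
     {p \<in> M. f p \<in> B} = (\<Union>j\<in>J. U j) \<and> disjoint_family_on U J \<and>
     (\<forall>j\<in>J. inj_on f (U j) \<and>
        (\<exists>b\<in>Basis. f ` U j homeomorphic {x \<in> ball (0::'e) 1. x \<bullet> b = 0}) \<and>
        P j \<subseteq> B - f ` U j \<and> open (P j) \<and> open (B - f ` U j - P j) \<and>
        (\<forall>p\<in>U j. \<forall>\<^sub>F e in at_right 0.
           f p + e *\<^sub>R \<nu> p \<in> P j \<and> f p - e *\<^sub>R \<nu> p \<in> B - f ` U j - P j))"

text \<open>The sheets bound a simplex: all sheets but \<open>l\<close> meet in the single point \<open>v l\<close>, the
  vertex opposite to the face on the sheet \<open>l\<close>.  (A triangle for three strands in the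
  plane, a tetrahedron for four sheets in space.)\<close>

definition sheets_bound_simplex ::
  "('m \<Rightarrow> 'e) \<Rightarrow> 'j set \<Rightarrow> ('j \<Rightarrow> 'm set) \<Rightarrow> ('j \<Rightarrow> 'e) \<Rightarrow> bool" where
  "sheets_bound_simplex f J U v \<longleftrightarrow>
     (\<forall>l\<in>J. (\<Inter>j\<in>J - {l}. f ` U j) = {v l} \<and> v l \<notin> f ` U l)"

text \<open>Two such simplices, with vertices \<open>v\<close> and \<open>v'\<close>, are inverted with respect to each
  other: every vertex has passed to the other side of the opposite sheet.\<close>

definition inverted_simplices ::
  "'j set \<Rightarrow> ('j \<Rightarrow> 'e set) \<Rightarrow> ('j \<Rightarrow> 'e) \<Rightarrow> ('j \<Rightarrow> 'e set) \<Rightarrow> ('j \<Rightarrow> 'e) \<Rightarrow> bool" where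
  "inverted_simplices J P v P' v' \<longleftrightarrow> (\<forall>l\<in>J. v l \<in> P l \<longleftrightarrow> v' l \<notin> P' l)"


section \<open>The quadruple-point event\<close>

definition regular_homotopy :: "'a atlas \<Rightarrow> (real \<Rightarrow> 'a \<Rightarrow> real^3) \<Rightarrow> bool" where
  "regular_homotopy A F \<longleftrightarrow>
     (\<forall>(V, \<phi>)\<in>A. smooth_on ({-1<..<1} \<times> \<phi> ` V) (\<lambda>(t, u). F t (inv_into V \<phi> u))) \<and>
     (\<forall>t\<in>{-1<..<1}. surface_immersion A (F t))"

text \<open>
  The event takes place in the ball of radius \<open>r\<close> about \<open>q\<close>, during the times
  \<open>-1 < t < 1\<close>, with the quadruple point \<open>q\<close> at \<open>t = 0\<close>.  The sets \<open>U j\<close> are the parts of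
  the surface that are mapped to the four sheets; they do not depend on time because the
  homotopy is supported inside the ball.  \<open>P t j\<close> is the positive side of the sheet \<open>j\<close> in
  the ball and \<open>v t l\<close> the triple point formed by the sheets other than \<open>l\<close>.\<close>

definition quadruple_event ::
  "'a topology \<Rightarrow> 'a atlas \<Rightarrow> (real \<Rightarrow> 'a \<Rightarrow> real^3) \<Rightarrow> real^3 \<Rightarrow> real \<Rightarrow>
   (4 \<Rightarrow> 'a set) \<Rightarrow> (real \<Rightarrow> 4 \<Rightarrow> (real^3) set) \<Rightarrow> (real \<Rightarrow> 4 \<Rightarrow> real^3) \<Rightarrow> bool" where
  "quadruple_event X A F q r U P v \<longleftrightarrow>
     regular_homotopy A F \<and>
     \<comment> \<open>unchanged outside the ball\<close>
     (\<exists>r'<r. \<forall>s\<in>{-1<..<1}. \<forall>t\<in>{-1<..<1}. \<forall>p\<in>topspace X.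
        F s p \<noteq> F t p \<longrightarrow> F s p \<in> cball q r') \<and>
     \<comment> \<open>four sheets in the ball, meeting pairwise along an arc\<close>
     (\<forall>t\<in>{-1<..<1}.
        sheets_in_ball (topspace X) (F t) (surface_normal A (F t)) (ball q r) UNIV U (P t) \<and>
        (\<forall>i j. i \<noteq> j \<longrightarrow> F t ` U i \<inter> F t ` U j homeomorphic {0<..<1::real})) \<and>
     \<comment> \<open>before and after: a generic surface with a tetrahedron\<close>
     (\<forall>t\<in>{-1<..<1} - {0}. generic_surface X A (F t) \<and> sheets_bound_simplex (F t) UNIV U (v t)) \<and>
     \<comment> \<open>at time 0: a quadruple point, and no other degeneration\<close>
     (\<forall>x. x \<noteq> q \<longrightarrow> generic_at (topspace X) (F 0) (surface_normal A (F 0)) 3 x) \<and>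
     (\<forall>l. (\<Inter>j\<in>- {l}. F 0 ` U j) = {q} \<and> q \<in> F 0 ` U l \<and>
        general_position (surface_normal A (F 0)) (preimages (topspace X) (F 0) q - U l)) \<and>
     \<comment> \<open>the tetrahedron shrinks to the quadruple point and reappears inverted\<close>
     (\<forall>l. ((\<lambda>t. v t l) \<longlongrightarrow> q) (at 0)) \<and>
     (\<forall>s\<in>{-1<..<0}. \<forall>t\<in>{0<..<1}. inverted_simplices UNIV (P s) (v s) (P t) (v t))"


section \<open>The slice plane and the induced third Reidemeister move\<close>

definition plane_proj :: "real^3 \<Rightarrow> real^2" where
  "plane_proj x = vector [x $ 1, x $ 2]"

definition lift_to_height :: "real \<Rightarrow> real^2 \<Rightarrow> real^3" where
  "lift_to_height z y = vector [y $ 1, y $ 2, z]"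

text \<open>
  In an open vertical cylinder over the disc of radius \<open>\<rho>\<close> about the projection of \<open>q\<close>,
  the moving sheet \<open>m\<close> is at each time \<open>t\<close> the horizontal plane of height \<open>h t\<close>, cooriented
  upwards.  The cylinder contains the vertices of the tetrahedron.\<close>

definition slice_plane ::
  "'a atlas \<Rightarrow> (real \<Rightarrow> 'a \<Rightarrow> real^3) \<Rightarrow> real^3 \<Rightarrow> real \<Rightarrow> (4 \<Rightarrow> 'a set) \<Rightarrow>
   (real \<Rightarrow> 4 \<Rightarrow> real^3) \<Rightarrow> 4 \<Rightarrow> real \<Rightarrow> (real \<Rightarrow> real) \<Rightarrow> bool" where
  "slice_plane A F q r U v m \<rho> h \<longleftrightarrow>
     (\<exists>\<eta>. let W = {x. plane_proj x \<in> ball (plane_proj q) \<rho> \<and> \<bar>x $ 3 - q $ 3\<bar> < \<eta>} in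
        W \<subseteq> ball q r \<and>
        (\<forall>t\<in>{-1<..<1}. \<bar>h t - q $ 3\<bar> < \<eta> \<and> F t ` U m \<inter> W = {x \<in> W. x $ 3 = h t} \<and>
           (\<forall>p\<in>U m. F t p \<in> W \<longrightarrow> surface_normal A (F t) p = axis 3 1)) \<and>
        (\<forall>t\<in>{-1<..<1} - {0}. \<forall>l. v t l \<in> W))"

text \<open>Whether the moving sheet passes the triple point \<open>v t m\<close> of the other three sheets in
  the direction of increasing or of decreasing height.  For a quadruple-point event with
  slice plane exactly one of the two holds, so the value 0 of \<open>slice_sgn\<close> does not occur.\<close>

definition upward_transition :: "(real \<Rightarrow> 4 \<Rightarrow> real^3) \<Rightarrow> 4 \<Rightarrow> (real \<Rightarrow> real) \<Rightarrow> bool" where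
  "upward_transition v m h \<longleftrightarrow>
     (\<forall>s\<in>{-1<..<0}. h s < v s m $ 3) \<and> (\<forall>t\<in>{0<..<1}. h t > v t m $ 3)"

definition downward_transition :: "(real \<Rightarrow> 4 \<Rightarrow> real^3) \<Rightarrow> 4 \<Rightarrow> (real \<Rightarrow> real) \<Rightarrow> bool" where
  "downward_transition v m h \<longleftrightarrow>
     (\<forall>s\<in>{-1<..<0}. h s > v s m $ 3) \<and> (\<forall>t\<in>{0<..<1}. h t < v t m $ 3)"

definition slice_sgn :: "(real \<Rightarrow> 4 \<Rightarrow> real^3) \<Rightarrow> 4 \<Rightarrow> (real \<Rightarrow> real) \<Rightarrow> real" where
  "slice_sgn v m h =
     (if upward_transition v m h then -1 else if downward_transition v m h then 1 else 0)"

text \<open>A third Reidemeister move from \<open>C\<close> to \<open>C'\<close> in the disc of radius \<open>R\<close> about \<open>c\<close>: the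
  curves coincide outside; inside, both consist of three strands, indexed by \<open>J\<close> and with
  sources \<open>V j\<close>, that bound a triangle, and the two triangles are inverted.\<close>

definition reidemeister3 ::
  "plane_curve \<Rightarrow> plane_curve \<Rightarrow> real^2 \<Rightarrow> real \<Rightarrow> 'j set \<Rightarrow> ('j \<Rightarrow> (nat \<times> real) set) \<Rightarrow> bool" where
  "reidemeister3 C C' c R J V \<longleftrightarrow>
     generic_curve C \<and> generic_curve C' \<and> card J = 3 \<and> circles C = circles C' \<and>
     (\<exists>R'<R. \<forall>a\<in>curve_dom C.
        curve_map C a \<in> cball c R' \<and> curve_map C' a \<in> cball c R' \<or>
        curve_map C a = curve_map C' a \<and> curve_normal C a = curve_normal C' a) \<and>
     (\<exists>P P' w w'.
        sheets_in_ball (curve_dom C) (curve_map C) (curve_normal C) (ball c R) J V P \<and>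
        sheets_in_ball (curve_dom C') (curve_map C') (curve_normal C') (ball c R) J V P' \<and>
        sheets_bound_simplex (curve_map C) J V w \<and>
        sheets_bound_simplex (curve_map C') J V w' \<and>
        inverted_simplices J P w P' w')"

text \<open>Over the disc \<open>D\<close> the strand \<open>V j\<close> of \<open>C\<close> is the intersection of the sheet \<open>U j\<close> of
  the surface \<open>f\<close> with the horizontal plane of height \<open>z\<close>, with the coorientation of the
  sheet; the normal of the slice is the horizontal part of the normal of the sheet.\<close>

definition strand_is_slice ::
  "'a atlas \<Rightarrow> ('a \<Rightarrow> real^3) \<Rightarrow> 'a set \<Rightarrow> real \<Rightarrow> (real^2) set \<Rightarrow>
   plane_curve \<Rightarrow> (nat \<times> real) set \<Rightarrow> bool" where
  "strand_is_slice A f Uj z D C Vj \<longleftrightarrow>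
     curve_map C ` Vj \<inter> D = {y \<in> D. lift_to_height z y \<in> f ` Uj} \<and>
     (\<forall>a\<in>Vj. \<forall>p\<in>Uj. curve_map C a \<in> D \<and> f p = lift_to_height z (curve_map C a) \<longrightarrow>
        curve_normal C a = sgn (plane_proj (surface_normal A f p)))"

text \<open>
  \<open>C\<close> and \<open>C'\<close> are related by the move induced on the slice plane between the times
  \<open>s < 0\<close> and \<open>t > 0\<close>, the slice planes at both times being identified with the plane by
  vertical projection.  The event only determines the curves over the disc \<open>D\<close>, where they
  are the slices of the three other sheets.  The disc \<open>ball c R\<close> of the move contains
  \<open>D\<close>, because the slices at heights \<open>h s\<close> and \<open>h t\<close> need not agree on the boundary of \<open>D\<close>.\<close>

definition induced_reidemeister3 ::
  "'a atlas \<Rightarrow> (real \<Rightarrow> 'a \<Rightarrow> real^3) \<Rightarrow> real^3 \<Rightarrow> (4 \<Rightarrow> 'a set) \<Rightarrow> 4 \<Rightarrow> real \<Rightarrow> (real \<Rightarrow> real) \<Rightarrow>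
   real \<Rightarrow> real \<Rightarrow> plane_curve \<Rightarrow> plane_curve \<Rightarrow> bool" where
  "induced_reidemeister3 A F q U m \<rho> h s t C C' \<longleftrightarrow>
     (let D = ball (plane_proj q) \<rho> in
      \<exists>c R V. D \<subseteq> ball c R \<and> reidemeister3 C C' c R (- {m}) V \<and>
        (\<forall>j\<in>- {m}. strand_is_slice A (F s) (U j) (h s) D C (V j) \<and>
                     strand_is_slice A (F t) (U j) (h t) D C' (V j)))"

end

theory Submission
  imports Defs
begin

text \<open>
  The reason for the identity is that both changes count vertices.  In a ball where a cooriented
  hypersurface of \<open>n\<close>-space consists of sheets, each separating the ball, crossing a sheet in the direction
  of its coorientation adds 1 to the Alexander numbering, and it also adds 1 to the number of
  sheets on whose positive side one stands.  Hence the numbering equals a constant \<open>a\<close> plus that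
  number (\<open>alexander_in_ball\<close>).  Near a vertex \<open>v l\<close> of a simplex, the \<open>n\<close> sheets through the
  vertex contribute \<open>n / 2\<close> on average and the opposite sheet \<open>l\<close> contributes 1 or 0, so the index of
  \<open>v l\<close> is \<open>a + n / 2\<close>, plus 1 if \<open>v l\<close> lies on the positive side of \<open>l\<close> (\<open>index_in_ball\<close>).  The
  inversion of the simplex moves every vertex to the other side of its opposite sheet, and it changes neither
  \<open>a\<close> nor the multiple points outside the ball.  If \<open>k\<close> of the \<open>n + 1\<close> vertices lie on the
  positive side before the inversion, then the sum of the indices changes by \<open>(n + 1) - 2 k\<close>
  (\<open>St_simplex_inversion\<close>).

  For the event this is \<open>4 - 2 k\<close>, and for the move on the slice plane it is \<open>3 - 2 k'\<close>.  The
  vertices of the triangle are those of the tetrahedron on the moving sheet, and such a vertex lies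
  on the positive side of the opposite strand exactly if it lies on the positive side of the opposite
  sheet (\<open>slice_side\<close>).  So \<open>k - k'\<close> is 1 or 0 according to whether the remaining vertex \<open>v m\<close>
  lies above or below the slice plane before the event, that is, whether the transition is
  upward or downward.  This gives \<open>(4 - 2 k) - (3 - 2 k') = \<mp>1\<close>.

  All comparisons of numberings and sides follow from one principle: a function that is locally
  constant off the hypersurface and takes the same value on both sides of every simple point is
  constant on connected open sets, because the multiple points have codimension 2
  (\<open>steady_if_no_jump\<close>, \<open>const_if_no_jump\<close>).  It is applied to the difference of two numberings outside
  the ball, to the numbering minus the number of positive sides, to the sides of one sheet before and
  after the event near the boundary of the ball, and to the sides of a strand and of a sheet on the slice plane.
  It rests on a local normal form: near a generic point the sheets are zero sets of functions that
  are coordinates of a homeomorphism (\<open>chart_straighten\<close>).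

  One point needs care.  An arrangement names its sheets as sets, and two of them may exchange their halves
  along a double curve if their normals there enclose an acute angle; then the positive side of a
  sheet near a double point is a quadrant or the complement of one.  Therefore the arguments at multiple points
  use only the number of positive sides, which is insensitive to such an exchange (\<open>local_sides\<close>).\<close>

section \<open>Strict derivatives and defining functions of a sheet\<close>

text \<open>
  Strict differentiability, that is, arbitrarily good Lipschitz closeness to the linear map, is the form of
  continuous differentiability that passes to inverse maps and to linear combinations without
  any derivative at neighbouring points.\<close>

definition strict_derivative_at ::
  "('a::real_normed_vector \<Rightarrow> 'b::real_normed_vector) \<Rightarrow> ('a \<Rightarrow> 'b) \<Rightarrow> 'a \<Rightarrow> bool" where
  "strict_derivative_at F D a \<longleftrightarrow> bounded_linear D \<and>
     (\<forall>\<kappa>>0. \<exists>\<delta>>0. \<forall>y\<in>ball a \<delta>. \<forall>z\<in>ball a \<delta>. norm (F y - F z - D (y - z)) \<le> \<kappa> * norm (y - z))"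

lemma strict_derivative_atI:
  assumes "bounded_linear D"
    and "\<And>\<kappa>. 0 < \<kappa> \<Longrightarrow>
      \<exists>\<delta>>0. \<forall>y\<in>ball a \<delta>. \<forall>z\<in>ball a \<delta>. norm (F y - F z - D (y - z)) \<le> \<kappa> * norm (y - z)"
  shows "strict_derivative_at F D a"
  using assms by (auto simp: strict_derivative_at_def)

lemma strict_derivative_atE:
  assumes "strict_derivative_at F D a" "0 < \<kappa>" "0 < \<delta>0"
  obtains \<delta> where "0 < \<delta>" "\<delta> \<le> \<delta>0"
    and "\<And>y z. y \<in> ball a \<delta> \<Longrightarrow> z \<in> ball a \<delta> \<Longrightarrow> norm (F y - F z - D (y - z)) \<le> \<kappa> * norm (y - z)"
proof -
  obtain \<delta> where "0 < \<delta>" "\<forall>y\<in>ball a \<delta>. \<forall>z\<in>ball a \<delta>. norm (F y - F z - D (y - z)) \<le> \<kappa> * norm (y - z)"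
    using assms by (auto simp: strict_derivative_at_def)
  then show ?thesis
    using that[of "min \<delta> \<delta>0"] \<open>0 < \<delta>0\<close> by auto
qed

lemma strict_derivative_at_bounded_linear:
  assumes "bounded_linear D" shows "strict_derivative_at D D a"
proof (rule strict_derivative_atI[OF assms])
  interpret bounded_linear D by fact
  fix \<kappa> :: real assume "0 < \<kappa>"
  then show "\<exists>\<delta>>0. \<forall>y\<in>ball a \<delta>. \<forall>z\<in>ball a \<delta>. norm (D y - D z - D (y - z)) \<le> \<kappa> * norm (y - z)"
    by (intro exI[of _ 1]) (simp add: diff)
qed

lemma strict_derivative_at_const: "strict_derivative_at (\<lambda>_. c) (\<lambda>_. 0) a"
proof (rule strict_derivative_atI)
  fix \<kappa> :: real assume "0 < \<kappa>"
  then show "\<exists>\<delta>>0. \<forall>y\<in>ball a \<delta>. \<forall>z\<in>ball a \<delta>. norm (c - c - 0) \<le> \<kappa> * norm (y - z)"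
    by (intro exI[of _ 1]) auto
qed simp

lemma strict_derivative_at_add:
  assumes F: "strict_derivative_at F D a" and G: "strict_derivative_at G E a"
  shows "strict_derivative_at (\<lambda>x. F x + G x) (\<lambda>x. D x + E x) a"
proof (rule strict_derivative_atI)
  show "bounded_linear (\<lambda>x. D x + E x)"
    using F G by (auto simp: strict_derivative_at_def intro: bounded_linear_add)
  fix \<kappa> :: real assume k: "0 < \<kappa>"
  then have k2: "0 < \<kappa> / 2" by simp
  obtain \<delta> where d: "0 < \<delta>"
    "\<And>y z. y \<in> ball a \<delta> \<Longrightarrow> z \<in> ball a \<delta> \<Longrightarrow> norm (F y - F z - D (y - z)) \<le> \<kappa> / 2 * norm (y - z)"
    by (rule strict_derivative_atE[OF F k2 zero_less_one]) blast
  obtain \<delta>' where d': "0 < \<delta>'" "\<delta>' \<le> \<delta>"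
    "\<And>y z. y \<in> ball a \<delta>' \<Longrightarrow> z \<in> ball a \<delta>' \<Longrightarrow> norm (G y - G z - E (y - z)) \<le> \<kappa> / 2 * norm (y - z)"
    by (rule strict_derivative_atE[OF G k2 d(1)]) blast
  have "norm (F y + G y - (F z + G z) - (D (y - z) + E (y - z))) \<le> \<kappa> * norm (y - z)"
    if "y \<in> ball a \<delta>'" "z \<in> ball a \<delta>'" for y z
  proof -
    have "norm (F y + G y - (F z + G z) - (D (y - z) + E (y - z)))
      = norm ((F y - F z - D (y - z)) + (G y - G z - E (y - z)))" by (simp add: algebra_simps)
    also have "\<dots> \<le> \<kappa> / 2 * norm (y - z) + \<kappa> / 2 * norm (y - z)"
      using d(2)[of y z] d'(3)[of y z] that d'(2) by (intro norm_triangle_le add_mono) auto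
    finally show ?thesis by simp
  qed
  with d'(1) show "\<exists>\<delta>>0. \<forall>y\<in>ball a \<delta>. \<forall>z\<in>ball a \<delta>.
      norm (F y + G y - (F z + G z) - (D (y - z) + E (y - z))) \<le> \<kappa> * norm (y - z)" by blast
qed

lemma strict_derivative_at_sum:
  assumes "finite Q" "\<And>p. p \<in> Q \<Longrightarrow> strict_derivative_at (F p) (D p) a"
  shows "strict_derivative_at (\<lambda>x. \<Sum>p\<in>Q. F p x) (\<lambda>x. \<Sum>p\<in>Q. D p x) a"
  using assms
  by (induction Q rule: finite_induct) (auto intro: strict_derivative_at_add strict_derivative_at_const)

lemma strict_derivative_at_compose_linear:
  assumes L: "bounded_linear L" and F: "strict_derivative_at F D a"
  shows "strict_derivative_at (\<lambda>x. L (F x)) (\<lambda>x. L (D x)) a"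
proof (rule strict_derivative_atI)
  interpret L: bounded_linear L by fact
  show "bounded_linear (\<lambda>x. L (D x))"
    using F L by (auto simp: strict_derivative_at_def intro: bounded_linear_compose)
  obtain K where K: "0 < K" "\<And>x. norm (L x) \<le> norm x * K" using L.pos_bounded by blast
  fix \<kappa> :: real assume "0 < \<kappa>"
  then have k: "0 < \<kappa> / K" using K by simp
  obtain \<delta> where d: "0 < \<delta>"
    "\<And>y z. y \<in> ball a \<delta> \<Longrightarrow> z \<in> ball a \<delta> \<Longrightarrow> norm (F y - F z - D (y - z)) \<le> \<kappa> / K * norm (y - z)"
    by (rule strict_derivative_atE[OF F k zero_less_one]) blast
  have "norm (L (F y) - L (F z) - L (D (y - z))) \<le> \<kappa> * norm (y - z)"
    if "y \<in> ball a \<delta>" "z \<in> ball a \<delta>" for y z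
  proof -
    have "norm (L (F y) - L (F z) - L (D (y - z))) \<le> norm (F y - F z - D (y - z)) * K"
      using K(2)[of "F y - F z - D (y - z)"] by (simp add: L.diff)
    also have "\<dots> \<le> \<kappa> / K * norm (y - z) * K"
      using d(2) that K(1) by (intro mult_right_mono) auto
    finally show ?thesis using K(1) by simp
  qed
  with d(1) show "\<exists>\<delta>>0. \<forall>y\<in>ball a \<delta>. \<forall>z\<in>ball a \<delta>.
      norm (L (F y) - L (F z) - L (D (y - z))) \<le> \<kappa> * norm (y - z)" by blast
qed

lemma strict_derivative_at_precompose_affine:
  assumes L: "bounded_linear L" and F: "strict_derivative_at F D b"
  shows "strict_derivative_at (\<lambda>x. F (b + L (x - a))) (\<lambda>x. D (L x)) a"
proof (rule strict_derivative_atI)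
  interpret L: bounded_linear L by fact
  show "bounded_linear (\<lambda>x. D (L x))"
    using F L by (auto simp: strict_derivative_at_def intro: bounded_linear_compose)
  obtain K where K: "0 < K" "\<And>x. norm (L x) \<le> norm x * K" using L.pos_bounded by blast
  fix \<kappa> :: real assume "0 < \<kappa>"
  then have k: "0 < \<kappa> / K" using K by simp
  obtain \<delta> where d: "0 < \<delta>"
    "\<And>y z. y \<in> ball b \<delta> \<Longrightarrow> z \<in> ball b \<delta> \<Longrightarrow> norm (F y - F z - D (y - z)) \<le> \<kappa> / K * norm (y - z)"
    by (rule strict_derivative_atE[OF F k zero_less_one]) blast
  have inb: "b + L (y - a) \<in> ball b \<delta>" if "y \<in> ball a (\<delta> / K)" for y
  proof -
    have "norm (L (y - a)) \<le> norm (y - a) * K" by (rule K)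
    also have "\<dots> < \<delta> / K * K" using that K(1)
      by (intro mult_strict_right_mono) (auto simp: dist_norm norm_minus_commute)
    finally show ?thesis using K(1) by (simp add: dist_norm)
  qed
  have "norm (F (b + L (y - a)) - F (b + L (z - a)) - D (L (y - z))) \<le> \<kappa> * norm (y - z)"
    if "y \<in> ball a (\<delta> / K)" "z \<in> ball a (\<delta> / K)" for y z
  proof -
    have eq: "b + L (y - a) - (b + L (z - a)) = L (y - z)" by (simp add: L.diff)
    have "norm (F (b + L (y - a)) - F (b + L (z - a)) - D (L (y - z))) \<le> \<kappa> / K * norm (L (y - z))"
      using d(2)[OF inb[OF that(1)] inb[OF that(2)]] unfolding eq .
    also have "\<dots> \<le> \<kappa> / K * (norm (y - z) * K)"
      using K k by (intro mult_left_mono) auto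
    finally show ?thesis using K(1) by simp
  qed
  moreover have "0 < \<delta> / K" using d K by simp
  ultimately show "\<exists>\<delta>>0. \<forall>y\<in>ball a \<delta>. \<forall>z\<in>ball a \<delta>.
      norm (F (b + L (y - a)) - F (b + L (z - a)) - D (L (y - z))) \<le> \<kappa> * norm (y - z)" by blast
qed

lemma strict_derivative_at_continuous_on:
  assumes "strict_derivative_at F D a" "0 < \<delta>0"
  obtains \<delta> where "0 < \<delta>" "\<delta> \<le> \<delta>0" "continuous_on (ball a \<delta>) F"
proof -
  obtain \<delta> where d: "0 < \<delta>" "\<delta> \<le> \<delta>0"
    "\<And>y z. y \<in> ball a \<delta> \<Longrightarrow> z \<in> ball a \<delta> \<Longrightarrow> norm (F y - F z - D (y - z)) \<le> 1 * norm (y - z)"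
    by (rule strict_derivative_atE[OF assms(1) zero_less_one assms(2)]) blast
  interpret bounded_linear D using assms(1) by (simp add: strict_derivative_at_def)
  have "continuous_on (ball a \<delta>) (\<lambda>y. F y - D y)"
  proof (rule continuous_onI)
    fix z e assume z: "z \<in> ball a \<delta>" and e: "0 < (e::real)"
    have "dist (F y - D y) (F z - D z) \<le> e" if "y \<in> ball a \<delta>" "dist y z < e" for y
    proof -
      have "dist (F y - D y) (F z - D z) = norm (F y - F z - D (y - z))"
        by (simp add: dist_norm diff algebra_simps)
      also have "\<dots> \<le> norm (y - z)" using d(3)[of y z] that z by simp
      finally show ?thesis using that by (simp add: dist_norm)
    qed
    with e show "\<exists>d>0. \<forall>y\<in>ball a \<delta>. dist y z < d \<longrightarrow> dist (F y - D y) (F z - D z) \<le> e" by blast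
  qed
  then have "continuous_on (ball a \<delta>) (\<lambda>y. (F y - D y) + D y)"
    by (rule continuous_on_add[OF _ linear_continuous_on[OF bounded_linear_axioms]])
  then have "continuous_on (ball a \<delta>) F" by simp
  then show ?thesis by (rule that[OF d(1,2)])
qed

text \<open>
  The mean value inequality applied to \<open>F - D\<close>, whose derivative is small near \<open>a\<close>.\<close>

lemma C1_imp_strict_derivative_at:
  fixes F :: "'a::euclidean_space \<Rightarrow> 'b::euclidean_space"
  assumes "open S" "a \<in> S" "C_k_on 1 S F"
  shows "strict_derivative_at F (frechet_derivative F (at a)) a"
proof -
  define D where "D = (\<lambda>x. frechet_derivative F (at x))"
  have der: "(F has_derivative D x) (at x)" if "x \<in> S" for x
    using assms that by (auto simp: D_def frechet_derivative_works)
  have cont: "continuous_on S (\<lambda>x. D x v)" for v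
    using assms(3) by (simp add: D_def)
  have bl: "bounded_linear (D x)" if "x \<in> S" for x
    using der[OF that] by (rule has_derivative_bounded_linear)
  have "strict_derivative_at F (D a) a"
  proof (rule strict_derivative_atI)
    show "bounded_linear (D a)" using bl assms by blast
    fix \<kappa> :: real assume k: "0 < \<kappa>"
    define \<eta> where "\<eta> = \<kappa> / real DIM('a)"
    have eta: "0 < \<eta>" using k by (simp add: \<eta>_def)
    have "\<forall>\<^sub>F x in at a. \<forall>b\<in>Basis. dist (D x b) (D a b) < \<eta>"
    proof (rule eventually_ball_finite)
      show "\<forall>b\<in>Basis. \<forall>\<^sub>F x in at a. dist (D x b) (D a b) < \<eta>"
        using cont assms(1,2) eta
        by (metis at_within_open continuous_on_def tendstoD)
    qed simp
    then obtain d where d: "0 < d" "\<And>x. dist x a < d \<Longrightarrow> x \<noteq> a \<Longrightarrow> \<forall>b\<in>Basis. dist (D x b) (D a b) < \<eta>"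
      by (auto simp: eventually_at)
    obtain d' where d': "0 < d'" "ball a d' \<subseteq> S" using assms(1,2) open_contains_ball by blast
    define \<delta> where "\<delta> = min d d'"
    have "norm (F y - F z - D a (y - z)) \<le> \<kappa> * norm (y - z)"
      if yz: "y \<in> ball a \<delta>" "z \<in> ball a \<delta>" for y z
    proof -
      interpret Da: bounded_linear "D a" using bl assms by blast
      have "norm ((F y - D a y) - (F z - D a z)) \<le> \<kappa> * norm (y - z)"
      proof (rule differentiable_bound[of "ball a \<delta>" "\<lambda>x. F x - D a x" "\<lambda>x v. D x v - D a v"])
        fix x assume x: "x \<in> ball a \<delta>"
        then have xS: "x \<in> S" using d' by (auto simp: \<delta>_def)
        interpret Dx: bounded_linear "D x" using bl xS by blast
        show "((\<lambda>x. F x - D a x) has_derivative (\<lambda>v. D x v - D a v)) (at x within ball a \<delta>)"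
          by (intro has_derivative_diff has_derivative_at_withinI[OF der[OF xS]]
              bounded_linear_imp_has_derivative Da.bounded_linear_axioms)
        have B: "norm (D x b - D a b) \<le> \<eta>" if "b \<in> Basis" for b
          using d(2)[of x] x eta that by (cases "x = a") (auto simp: \<delta>_def dist_norm norm_minus_commute less_imp_le)
        show "onorm (\<lambda>v. D x v - D a v) \<le> \<kappa>"
        proof (rule onorm_bound)
          fix v :: 'a
          have "D x v - D a v = (\<Sum>b\<in>Basis. (v \<bullet> b) *\<^sub>R (D x b - D a b))"
            by (subst (1 2) euclidean_representation[of v, symmetric])
              (simp add: Dx.sum Da.sum Dx.scaleR Da.scaleR sum_subtractf scaleR_diff_right)
          also have "norm \<dots> \<le> (\<Sum>b\<in>(Basis::'a set). norm v * \<eta>)"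
            by (rule sum_norm_le) (auto intro!: mult_mono B Basis_le_norm)
          finally show "norm (D x v - D a v) \<le> \<kappa> * norm v" by (simp add: \<eta>_def mult.commute)
        qed (use k in simp)
      qed (use yz in auto)
      then show ?thesis by (simp add: Da.diff algebra_simps)
    qed
    moreover have "0 < \<delta>" using d d' by (simp add: \<delta>_def)
    ultimately show "\<exists>\<delta>>0. \<forall>y\<in>ball a \<delta>. \<forall>z\<in>ball a \<delta>.
        norm (F y - F z - D a (y - z)) \<le> \<kappa> * norm (y - z)" by blast
  qed
  then show ?thesis by (simp add: D_def)
qed

text \<open>
  A map that is Lipschitz close to the identity is injective, so by invariance of domain it is open.
  The inverse is strictly differentiable because \<open>G\<close> shrinks distances by at most one half.\<close>

lemma strict_identity_local_homeomorphism:
  fixes G :: "'e::euclidean_space \<Rightarrow> 'e"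
  assumes G: "strict_derivative_at G (\<lambda>w. w) x" and "0 < \<delta>0"
  obtains \<delta> H where "0 < \<delta>" "\<delta> \<le> \<delta>0" "open (G ` ball x \<delta>)"
    "homeomorphism (ball x \<delta>) (G ` ball x \<delta>) G H" "strict_derivative_at H (\<lambda>w. w) (G x)"
proof -
  have half: "0 < (1/2::real)" by simp
  obtain \<delta>1 where d1: "0 < \<delta>1" "\<delta>1 \<le> \<delta>0" "continuous_on (ball x \<delta>1) G"
    by (rule strict_derivative_at_continuous_on[OF assms])
  obtain \<delta> where d: "0 < \<delta>" "\<delta> \<le> \<delta>1" 
    "\<And>y z. y \<in> ball x \<delta> \<Longrightarrow> z \<in> ball x \<delta> \<Longrightarrow> norm (G y - G z - (y - z)) \<le> 1 / 2 * norm (y - z)"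
    by (rule strict_derivative_atE[OF G half d1(1)]) blast
  have low: "norm (y - z) \<le> 2 * norm (G y - G z)" if "y \<in> ball x \<delta>" "z \<in> ball x \<delta>" for y z
  proof -
    have "norm (y - z) \<le> norm (G y - G z) + norm (G y - G z - (y - z))"
      by (metis norm_minus_commute norm_triangle_sub diff_add_cancel add.commute norm_triangle_ineq4 add_diff_cancel_left')
    then show ?thesis using d(3)[OF that] by simp
  qed
  have inj: "inj_on G (ball x \<delta>)"
  proof (rule inj_onI)
    fix y z assume "y \<in> ball x \<delta>" "z \<in> ball x \<delta>" "G y = G z"
    then show "y = z" using low[of y z] by simp
  qed
  have cont: "continuous_on (ball x \<delta>) G" using d1(3) d(2) by (meson continuous_on_subset subset_ball)
  have op: "open (G ` ball x \<delta>)" by (rule invariance_of_domain[OF cont open_ball inj])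
  obtain H where H: "homeomorphism (ball x \<delta>) (G ` ball x \<delta>) G H"
    by (rule invariance_of_domain_homeomorphism[OF open_ball cont _ inj]) auto
  have "strict_derivative_at H (\<lambda>w. w) (G x)"
  proof (rule strict_derivative_atI)
    show "bounded_linear (\<lambda>w::'e. w)" by (rule bounded_linear_ident)
    fix \<kappa> :: real assume "0 < \<kappa>"
    then have k: "0 < \<kappa> / 2" by simp
    obtain \<epsilon> where e: "0 < \<epsilon>" "\<epsilon> \<le> \<delta>"
      "\<And>y z. y \<in> ball x \<epsilon> \<Longrightarrow> z \<in> ball x \<epsilon> \<Longrightarrow> norm (G y - G z - (y - z)) \<le> \<kappa> / 2 * norm (y - z)"
      by (rule strict_derivative_atE[OF G k d(1)]) blast
    have "open (G ` ball x \<epsilon>)"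
      by (rule invariance_of_domain[OF continuous_on_subset[OF cont] open_ball inj_on_subset[OF inj]])
        (use e(2) in auto)
    moreover have "G x \<in> G ` ball x \<epsilon>" using e(1) by simp
    ultimately obtain \<zeta> where z: "0 < \<zeta>" "ball (G x) \<zeta> \<subseteq> G ` ball x \<epsilon>"
      using open_contains_ball by blast
    have "norm (H a - H b - (a - b)) \<le> \<kappa> * norm (a - b)"
      if "a \<in> ball (G x) \<zeta>" "b \<in> ball (G x) \<zeta>" for a b
    proof -
      have "a \<in> G ` ball x \<epsilon>" "b \<in> G ` ball x \<epsilon>" using that z(2) by blast+
      then obtain y y' where y: "y \<in> ball x \<epsilon>" "a = G y" and y': "y' \<in> ball x \<epsilon>" "b = G y'"
        by blast
      have HH: "H a = y" "H b = y'"
        using H y y' e(2) by (auto simp: homeomorphism_def)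
      have "norm (H a - H b - (a - b)) = norm (G y - G y' - (y - y'))"
        unfolding HH unfolding y y' by (rule norm_minus_commute)
      also have "\<dots> \<le> \<kappa> / 2 * norm (y - y')" using e(3) y(1) y'(1) by blast
      also have "\<dots> \<le> \<kappa> / 2 * (2 * norm (G y - G y'))"
        using low[of y y'] y(1) y'(1) e(2) k by (intro mult_left_mono) auto
      finally show ?thesis by (simp add: y y')
    qed
    with z(1) show "\<exists>\<delta>>0. \<forall>y\<in>ball (G x) \<delta>. \<forall>z\<in>ball (G x) \<delta>. norm (H y - H z - (y - z)) \<le> \<kappa> * norm (y - z)"
      by blast
  qed
  then show ?thesis using that[OF d(1) _ op H] d(2) d1(2) by simp
qed

lemma range_eq_hyperplane:
  fixes D :: "'u::euclidean_space \<Rightarrow> 'e::euclidean_space"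
  assumes "linear D" "inj D" "\<And>u. D u \<bullet> n = 0" "n \<noteq> 0" "DIM('e) = DIM('u) + 1"
  shows "range D = {w. w \<bullet> n = 0}"
proof (rule subspace_dim_equal)
  show "subspace (range D)" using assms(1) by (simp add: linear_subspace_image)
  show "subspace {w. w \<bullet> n = 0}" by (simp add: subspace_hyperplane2)
  show "range D \<subseteq> {w. w \<bullet> n = 0}" using assms(3) by auto
  have "dim (range D) = DIM('u)"
    using assms(1,2) by (metis dim_UNIV dim_image_eq inj_on_subset subset_UNIV)
  moreover have "dim {w. w \<bullet> n = 0} = DIM('e) - 1"
    using dim_hyperplane[OF assms(4)] by (simp add: inner_commute)
  ultimately show "dim {w. w \<bullet> n = 0} \<le> dim (range D)" using assms(5) by simp
qed

text \<open>
  A regular sheet is the zero set of a function whose gradient is the unit normal.  The map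
  \<open>\<Psi> y = F (u0 + L (y - x)) + ((y - x) \<bullet> n) n\<close>, with \<open>L\<close> the inverse of \<open>D\<close> after projection to the
  tangent plane, has strict derivative the identity and carries the tangent plane to the sheet; the function is the
  normal coordinate of its inverse.\<close>

lemma sheet_defining_function:
  fixes F :: "'u::euclidean_space \<Rightarrow> 'e::euclidean_space"
  assumes F: "strict_derivative_at F D u0" and inj: "inj D"
    and orth: "\<And>u. D u \<bullet> n = 0" and n: "norm n = 1" and dim: "DIM('e) = DIM('u) + 1"
    and N: "open N" "u0 \<in> N"
  obtains N' \<epsilon> g where "open N'" "u0 \<in> N'" "N' \<subseteq> N" "inj_on F N'" "0 < \<epsilon>"
    "strict_derivative_at g (\<lambda>w. w \<bullet> n) (F u0)" "g (F u0) = 0"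
    "\<And>y. y \<in> ball (F u0) \<epsilon> \<Longrightarrow> g y = 0 \<longleftrightarrow> y \<in> F ` N'"
proof -
  have bD: "bounded_linear D" using F by (simp add: strict_derivative_at_def)
  interpret D: bounded_linear D by fact
  have nn: "n \<bullet> n = 1" using n by (simp add: norm_eq_1)
  have n0: "n \<noteq> 0" using n by auto
  define x where "x = F u0"
  obtain K where K: "linear K" "K \<circ> D = id"
    using linear_injective_left_inverse[OF D.linear inj] by blast
  have KD: "K (D u) = u" for u using K(2) by (metis comp_apply id_apply)
  define L where "L w = K (w - (w \<bullet> n) *\<^sub>R n)" for w
  have bL: "bounded_linear L"
    unfolding L_def using K(1)
    by (intro bounded_linear_compose[OF linear_conv_bounded_linear[THEN iffD1, OF K(1)]]
        bounded_linear_sub bounded_linear_ident bounded_linear_scaleR_const bounded_linear_inner_left)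
  interpret L: bounded_linear L by fact
  have DL: "D (L w) = w - (w \<bullet> n) *\<^sub>R n" for w
  proof -
    have "w - (w \<bullet> n) *\<^sub>R n \<in> range D"
      unfolding range_eq_hyperplane[OF D.linear inj orth n0 dim] by (simp add: inner_diff_left nn)
    then show ?thesis by (auto simp: L_def KD)
  qed
  have LD: "L (D u) = u" for u by (simp add: L_def orth KD)
  have Ln: "L n = 0" using K(1) by (simp add: L_def nn linear_0)
  define \<Psi> where "\<Psi> y = F (u0 + L (y - x)) + ((y - x) \<bullet> n) *\<^sub>R n" for y
  have "strict_derivative_at (\<lambda>y. F (u0 + L (y - x)) + (((y \<bullet> n) *\<^sub>R n) + - ((x \<bullet> n) *\<^sub>R n)))
      (\<lambda>w. D (L w) + (((w \<bullet> n) *\<^sub>R n) + 0)) x"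
    by (intro strict_derivative_at_add strict_derivative_at_precompose_affine[OF bL F]
       strict_derivative_at_bounded_linear strict_derivative_at_const bounded_linear_scaleR_const
       bounded_linear_inner_left bounded_linear_ident)
  also have "(\<lambda>w. D (L w) + (((w \<bullet> n) *\<^sub>R n) + 0)) = (\<lambda>w. w)" by (simp add: DL)
  also have "(\<lambda>y. F (u0 + L (y - x)) + (((y \<bullet> n) *\<^sub>R n) + - ((x \<bullet> n) *\<^sub>R n))) = \<Psi>"
    by (auto simp: \<Psi>_def inner_diff_left scaleR_diff_left)
  finally have Psi: "strict_derivative_at \<Psi> (\<lambda>w. w) x" .
  have "open ((\<lambda>y. u0 + L (y - x)) -` N)"
    by (rule open_vimage[OF N(1)]) (auto intro!: continuous_intros L.continuous_on)
  moreover have "x \<in> (\<lambda>y. u0 + L (y - x)) -` N" using N(2) by (simp add: L.zero)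
  ultimately obtain \<delta>0 where d0: "0 < \<delta>0" "ball x \<delta>0 \<subseteq> (\<lambda>y. u0 + L (y - x)) -` N"
    using open_contains_ball by blast
  obtain \<delta> H where d: "0 < \<delta>" "\<delta> \<le> \<delta>0" "open (\<Psi> ` ball x \<delta>)"
    "homeomorphism (ball x \<delta>) (\<Psi> ` ball x \<delta>) \<Psi> H" "strict_derivative_at H (\<lambda>w. w) (\<Psi> x)"
    by (rule strict_identity_local_homeomorphism[OF Psi d0(1)])
  have Px: "\<Psi> x = x" by (simp add: \<Psi>_def L.zero x_def)
  define N' where "N' = {u. x + D (u - u0) \<in> ball x \<delta>}"
  define g where "g y = (H y - x) \<bullet> n" for y
  have PD: "\<Psi> (x + D (u - u0)) = F u" for u by (simp add: \<Psi>_def LD orth)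
  have "x \<in> \<Psi> ` ball x \<delta>" using d(1) Px by (intro image_eqI[of _ _ x]) simp_all
  then obtain \<epsilon> where e: "0 < \<epsilon>" "ball x \<epsilon> \<subseteq> \<Psi> ` ball x \<delta>"
    using d(3) open_contains_ball by metis
  have Pinj: "inj_on \<Psi> (ball x \<delta>)" using homeomorphism_apply1[OF d(4)] by (rule inj_on_inverseI)
  show ?thesis
  proof
    have "N' = (\<lambda>u. x + D (u - u0)) -` ball x \<delta>" by (auto simp: N'_def)
    then show "open N'" 
      by (simp only:) (rule open_vimage[OF open_ball], auto intro!: continuous_intros D.continuous_on)
    show "u0 \<in> N'" using d(1) by (simp add: N'_def D.zero)
    show "N' \<subseteq> N"
    proof
      fix u assume "u \<in> N'"
      then have "x + D (u - u0) \<in> ball x \<delta>0" using d(2) by (auto simp: N'_def)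
      then have "u0 + L (x + D (u - u0) - x) \<in> N" using d0(2) by blast
      then show "u \<in> N" by (simp add: LD)
    qed
    show "inj_on F N'"
    proof (rule inj_onI)
      fix u u' assume u: "u \<in> N'" "u' \<in> N'" and "F u = F u'"
      then have "x + D (u - u0) = x + D (u' - u0)"
        using Pinj PD by (metis (mono_tags, lifting) N'_def inj_onD mem_Collect_eq)
      then have "u - u0 = u' - u0" using inj by (auto dest: injD)
      then show "u = u'" by simp
    qed
    show "0 < \<epsilon>" by fact
    have "strict_derivative_at (\<lambda>y. H y + - x) (\<lambda>w. w + 0) (F u0)"
      using d(5) unfolding Px by (intro strict_derivative_at_add strict_derivative_at_const) (simp add: x_def)
    from strict_derivative_at_compose_linear[OF bounded_linear_inner_left this]
    show "strict_derivative_at g (\<lambda>w. w \<bullet> n) (F u0)" by (simp add: g_def[abs_def])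
    have Hx: "H x = x" using d(1,4) Px by (metis centre_in_ball homeomorphism_apply1)
    then show "g (F u0) = 0" by (simp add: g_def x_def[symmetric])
    fix y assume "y \<in> ball (F u0) \<epsilon>"
    then obtain z where z: "z \<in> ball x \<delta>" "y = \<Psi> z" using e(2) by (auto simp: x_def)
    then have Hy: "H y = z" using d(4) by (simp add: homeomorphism_apply1)
    show "g y = 0 \<longleftrightarrow> y \<in> F ` N'"
    proof
      assume "g y = 0"
      then have "(z - x) \<bullet> n = 0" by (simp add: g_def Hy)
      then have zz: "z = x + D (u0 + L (z - x) - u0)" by (simp add: DL)
      then have "u0 + L (z - x) \<in> N'" using z(1) by (simp add: N'_def)
      then show "y \<in> F ` N'" using PD[of "u0 + L (z - x)"] zz z(2) by auto
    next
      assume "y \<in> F ` N'"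
      then obtain u where u: "u \<in> N'" "y = F u" by blast
      then have "x + D (u - u0) = z"
        using Pinj PD[of u] z by (metis (mono_tags, lifting) N'_def inj_onD mem_Collect_eq)
      then show "g y = 0" unfolding g_def Hy using orth by auto
    qed
  qed
qed

section \<open>Immersed hypersurfaces near a generic point\<close>

text \<open>
  The dual vector of \<open>\<nu> p\<close> is its component orthogonal to the span of the other normals,
  suitably scaled.\<close>

lemma dual_family_exists:
  fixes \<nu> :: "'m \<Rightarrow> 'e::euclidean_space"
  assumes "general_position \<nu> Q"
  obtains d where "\<And>p q. p \<in> Q \<Longrightarrow> q \<in> Q \<Longrightarrow> d p \<bullet> \<nu> q = (if p = q then 1 else 0)"
proof -
  have inj: "inj_on \<nu> Q" and ind: "independent (\<nu> ` Q)"
    using assms by (auto simp: general_position_def)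
  have "\<exists>e. \<forall>q\<in>Q. e \<bullet> \<nu> q = (if p = q then 1 else 0)" if p: "p \<in> Q" for p
  proof -
    let ?B = "\<nu> ` Q - {\<nu> p}"
    have nsp: "\<nu> p \<notin> span ?B" using ind p by (auto simp: dependent_def)
    obtain y z where yz: "y \<in> span ?B" "\<And>w. w \<in> span ?B \<Longrightarrow> orthogonal z w" "\<nu> p = y + z"
      by (rule orthogonal_subspace_decomp_exists[of ?B "\<nu> p"]) blast
    have z0: "z \<noteq> 0" using nsp yz by auto
    have zp: "z \<bullet> \<nu> p = z \<bullet> z" using yz(2)[OF yz(1)] yz(3) by (simp add: orthogonal_def inner_add_right)
    have "z \<bullet> \<nu> q = 0" if "q \<in> Q" "q \<noteq> p" for q
    proof -
      have "\<nu> q \<in> ?B" using that p inj by (auto dest: inj_onD)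
      then show ?thesis using yz(2)[OF span_base] by (simp add: orthogonal_def)
    qed
    then show ?thesis using z0 zp by (intro exI[of _ "(1 / (z \<bullet> z)) *\<^sub>R z"]) auto
  qed
  then obtain d where "\<forall>p\<in>Q. \<forall>q\<in>Q. d p \<bullet> \<nu> q = (if p = q then 1 else 0)"
    by metis
  then show ?thesis using that by blast
qed

lemma eventually_ray_in_open:
  fixes x w :: "'e::real_normed_vector"
  assumes "open S" "x \<in> S"
  shows "\<forall>\<^sub>F e in at_right 0. x + e *\<^sub>R w \<in> S"
proof -
  have "((\<lambda>e::real. x + e *\<^sub>R w) \<longlongrightarrow> x + 0 *\<^sub>R w) (at_right 0)"
    by (intro tendsto_intros)
  then show ?thesis using assms by (auto dest: topological_tendstoD)
qed

lemma eventually_ray_in_open':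
  fixes x w :: "'e::real_normed_vector"
  assumes "open S" "x \<in> S"
  shows "\<forall>\<^sub>F e in at_right 0. x - e *\<^sub>R w \<in> S"
  using eventually_ray_in_open[OF assms, of "- w"] by simp

lemma strict_derivative_ray_sign:
  fixes h :: "'e::real_inner \<Rightarrow> real"
  assumes "strict_derivative_at h (\<lambda>w. w \<bullet> n) x" "h x = 0"
  shows "w \<bullet> n > 0 \<Longrightarrow> \<forall>\<^sub>F e in at_right 0. h (x + e *\<^sub>R w) > 0"
    and "w \<bullet> n < 0 \<Longrightarrow> \<forall>\<^sub>F e in at_right 0. h (x + e *\<^sub>R w) < 0"
proof -
  have *: "\<forall>\<^sub>F e in at_right 0. \<bar>h (x + e *\<^sub>R w) - e * (w \<bullet> n)\<bar> < e * \<bar>w \<bullet> n\<bar>" if wn: "w \<bullet> n \<noteq> 0"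
  proof -
    have w0: "w \<noteq> 0" using wn by auto
    define \<kappa> where "\<kappa> = \<bar>w \<bullet> n\<bar> / (2 * norm w)"
    have k: "0 < \<kappa>" using wn w0 by (simp add: \<kappa>_def)
    obtain \<delta> where d: "0 < \<delta>"
      "\<And>y z. y \<in> ball x \<delta> \<Longrightarrow> z \<in> ball x \<delta> \<Longrightarrow> norm (h y - h z - (y - z) \<bullet> n) \<le> \<kappa> * norm (y - z)"
      by (rule strict_derivative_atE[OF assms(1) k zero_less_one]) blast
    have "\<forall>\<^sub>F e in at_right 0. x + e *\<^sub>R w \<in> ball x \<delta>"
      by (rule eventually_ray_in_open) (use d in auto)
    moreover have "\<forall>\<^sub>F e::real in at_right 0. e > 0" by (simp add: eventually_at_right_less)
    ultimately show ?thesis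
    proof eventually_elim
      case (elim e)
      have "\<bar>h (x + e *\<^sub>R w) - e * (w \<bullet> n)\<bar> \<le> \<kappa> * (e * norm w)"
        using d(2)[OF elim(1), of x] d(1) elim(2) assms(2) by simp
      also have "\<dots> = e * \<bar>w \<bullet> n\<bar> / 2" using w0 by (simp add: \<kappa>_def)
      also have "\<dots> < e * \<bar>w \<bullet> n\<bar>" using elim(2) wn by simp
      finally show ?case .
    qed
  qed
  show "\<forall>\<^sub>F e in at_right 0. h (x + e *\<^sub>R w) > 0" if "w \<bullet> n > 0"
  proof -
    have "w \<bullet> n \<noteq> 0" using that by simp
    from *[OF this] show ?thesis by eventually_elim (use that in auto)
  qed
  show "\<forall>\<^sub>F e in at_right 0. h (x + e *\<^sub>R w) < 0" if "w \<bullet> n < 0"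
  proof -
    have "w \<bullet> n \<noteq> 0" using that by simp
    from *[OF this] show ?thesis by eventually_elim (use that in auto)
  qed
qed

text \<open>
  Near \<open>x\<close> the hypersurface is the union of the zero sets of the functions \<open>g p\<close>, one for each
  preimage \<open>p\<close>; \<open>N p\<close> is a neighbourhood of \<open>p\<close> in the source.  The last condition on \<open>g p\<close>
  says that the coorientation points to the side where \<open>g p\<close> is positive, not only at \<open>p\<close> but at all nearby points.\<close>

definition sheet_chart ::
  "'m set \<Rightarrow> ('m \<Rightarrow> 'e::euclidean_space) \<Rightarrow> ('m \<Rightarrow> 'e) \<Rightarrow> 'e \<Rightarrow> real \<Rightarrow>
   ('m \<Rightarrow> 'm set) \<Rightarrow> ('m \<Rightarrow> 'e \<Rightarrow> real) \<Rightarrow> bool" where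
  "sheet_chart M f \<nu> x \<epsilon> N g \<longleftrightarrow>
     0 < \<epsilon> \<and> disjoint_family_on N (preimages M f x) \<and>
     (\<forall>p\<in>preimages M f x.
        strict_derivative_at (g p) (\<lambda>w. w \<bullet> \<nu> p) x \<and> g p x = 0 \<and> continuous_on (ball x \<epsilon>) (g p) \<and>
        N p \<subseteq> M \<and> inj_on f (N p) \<and>
        (\<forall>y\<in>ball x \<epsilon>. g p y = 0 \<longleftrightarrow> y \<in> f ` N p) \<and>
        (\<forall>p'\<in>N p. f p' \<in> ball x \<epsilon> \<longrightarrow> (\<forall>\<^sub>F e in at_right 0.
           g p (f p' + e *\<^sub>R \<nu> p') > 0 \<and> g p (f p' - e *\<^sub>R \<nu> p') < 0))) \<and>
     (\<forall>p'\<in>M. f p' \<in> ball x \<epsilon> \<longrightarrow> (\<exists>p\<in>preimages M f x. p' \<in> N p))"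

lemma sheet_chart_mono:
  assumes "sheet_chart M f \<nu> x \<epsilon> N g" "0 < \<epsilon>'" "\<epsilon>' \<le> \<epsilon>"
  shows "sheet_chart M f \<nu> x \<epsilon>' N g"
proof -
  have b: "y \<in> ball x \<epsilon>' \<Longrightarrow> y \<in> ball x \<epsilon>" for y using assms(3) by auto
  have "ball x \<epsilon>' \<subseteq> ball x \<epsilon>" using b by blast
  then show ?thesis using assms(1,2) b unfolding sheet_chart_def
    by (auto intro: continuous_on_subset)
qed

text \<open>
  The common setting for surfaces in space and curves in the plane.  The multiplicity of points
  is bounded by the dimension, so that the points of maximal multiplicity are isolated.\<close>

locale generic_hypersurface =
  fixes M :: "'m set" and f \<nu> :: "'m \<Rightarrow> 'e::euclidean_space"
  assumes dim_ge_2: "2 \<le> DIM('e)"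
    and bounded_image: "bounded (f ` M)"
    and generic: "\<And>x. generic_at M f \<nu> DIM('e) x"
    and charts: "\<And>x. \<exists>\<epsilon> N g. sheet_chart M f \<nu> x \<epsilon> N g"
begin

abbreviation pre :: "'e \<Rightarrow> 'm set" where "pre \<equiv> preimages M f"

lemma finite_pre [simp]: "finite (pre x)"
  and general_pre: "general_position \<nu> (pre x)"
  and card_pre_le: "card (pre x) \<le> DIM('e)"
  using generic[of x] by (auto simp: generic_at_def general_position_def)

lemma pre_empty_iff: "pre x = {} \<longleftrightarrow> x \<notin> f ` M"
  by (auto simp: preimages_def)

lemma chart_within:
  assumes "open S" "x \<in> S"
  obtains \<epsilon> N g where "sheet_chart M f \<nu> x \<epsilon> N g" "ball x \<epsilon> \<subseteq> S"
proof -
  obtain \<epsilon> N g where c: "sheet_chart M f \<nu> x \<epsilon> N g" using charts by blast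
  obtain \<delta> where d: "0 < \<delta>" "ball x \<delta> \<subseteq> S" using assms open_contains_ball by blast
  have "0 < \<epsilon>" using c by (simp add: sheet_chart_def)
  with d have "sheet_chart M f \<nu> x (min \<epsilon> \<delta>) N g" by (intro sheet_chart_mono[OF c]) auto
  moreover have "ball x (min \<epsilon> \<delta>) \<subseteq> S" using d by auto
  ultimately show ?thesis using that by blast
qed

lemma closed_image: "closed (f ` M)"
  unfolding closed_def
proof (rule openI)
  fix x assume "x \<in> - f ` M"
  then have "pre x = {}" by (simp add: pre_empty_iff)
  moreover obtain \<epsilon> N g where "sheet_chart M f \<nu> x \<epsilon> N g" using charts by blast
  ultimately show "\<exists>e>0. ball x e \<subseteq> - f ` M" unfolding sheet_chart_def by auto
qed

context
  fixes x \<epsilon> N g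
  assumes chart: "sheet_chart M f \<nu> x \<epsilon> N g"
begin

text \<open>
  The preimages of a nearby point correspond to the functions that vanish there, so multiplicities
  can be read off from the values of the \<open>g p\<close>.\<close>

lemma chart_bij:
  assumes y: "y \<in> ball x \<epsilon>"
  obtains b where "bij_betw b (pre y) {p \<in> pre x. g p y = 0}" "\<And>p'. p' \<in> pre y \<Longrightarrow> p' \<in> N (b p')"
proof -
  have "\<forall>p'\<in>pre y. \<exists>p\<in>pre x. p' \<in> N p"
    using chart y by (auto simp: sheet_chart_def preimages_def)
  then obtain b where b: "\<And>p'. p' \<in> pre y \<Longrightarrow> b p' \<in> pre x \<and> p' \<in> N (b p')" by metis
  have fy: "f p' = y" if "p' \<in> pre y" for p' using that by (simp add: preimages_def)
  have inj: "inj_on b (pre y)"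
  proof (rule inj_onI)
    fix p' q' assume pq: "p' \<in> pre y" "q' \<in> pre y" "b p' = b q'"
    then have "inj_on f (N (b p'))" using chart b by (auto simp: sheet_chart_def)
    then show "p' = q'" using pq b fy by (metis inj_onD)
  qed
  have zero: "g p y = 0 \<longleftrightarrow> y \<in> f ` N p" if "p \<in> pre x" for p
    using chart y that by (auto simp: sheet_chart_def)
  have "b ` pre y = {p \<in> pre x. g p y = 0}"
  proof (intro equalityI subsetI)
    fix p assume "p \<in> b ` pre y"
    then obtain p' where "p' \<in> pre y" "p = b p'" by blast
    then show "p \<in> {p \<in> pre x. g p y = 0}" using b[of p'] zero fy by force
  next
    fix p assume p: "p \<in> {p \<in> pre x. g p y = 0}"
    then obtain p' where p': "p' \<in> N p" "f p' = y" using zero by auto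
    have "p' \<in> pre y" using p' p chart by (auto simp: sheet_chart_def preimages_def)
    moreover have "b p' = p"
    proof (rule ccontr)
      assume "b p' \<noteq> p"
      then have "N (b p') \<inter> N p = {}"
        using chart p b[OF \<open>p' \<in> pre y\<close>] by (auto simp: sheet_chart_def disjoint_family_on_def)
      then show False using b[OF \<open>p' \<in> pre y\<close>] p' by blast
    qed
    ultimately show "p \<in> b ` pre y" by blast
  qed
  with inj b show ?thesis by (intro that[of b]) (auto simp: bij_betw_def)
qed

lemma chart_card_pre:
  assumes "y \<in> ball x \<epsilon>" shows "card (pre y) = card {p \<in> pre x. g p y = 0}"
  by (rule chart_bij[OF assms]) (rule bij_betw_same_card)

lemma chart_image_iff:
  assumes "y \<in> ball x \<epsilon>" shows "y \<in> f ` M \<longleftrightarrow> (\<exists>p\<in>pre x. g p y = 0)"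
proof -
  have "y \<in> f ` M \<longleftrightarrow> card (pre y) \<noteq> 0" using pre_empty_iff[of y] by simp
  also have "\<dots> \<longleftrightarrow> {p \<in> pre x. g p y = 0} \<noteq> {}" using chart_card_pre[OF assms] by simp
  finally show ?thesis by blast
qed

text \<open>
  The functions \<open>g p\<close> are made linear at once: with dual vectors \<open>d p\<close> the map
  \<open>G y = (y - x) + \<Sum>\<^sub>p (g p y - (y - x) \<bullet> \<nu> p) d p\<close> has strict derivative the identity, because \<open>g p\<close> has gradient
  \<open>\<nu> p\<close>, and it satisfies \<open>G y \<bullet> \<nu> p = g p y\<close>.\<close>

lemma chart_straighten:
  obtains W G H r where "0 < r" "open W" "x \<in> W" "W \<subseteq> ball x \<epsilon>"
    "homeomorphism W (ball 0 r) G H" "G x = 0" "\<And>y p. p \<in> pre x \<Longrightarrow> G y \<bullet> \<nu> p = g p y"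
proof -
  obtain d where d: "\<And>p q. p \<in> pre x \<Longrightarrow> q \<in> pre x \<Longrightarrow> d p \<bullet> \<nu> q = (if p = q then 1 else 0)"
    by (rule dual_family_exists[OF general_pre[of x]]) blast
  have strict: "strict_derivative_at (g p) (\<lambda>w. w \<bullet> \<nu> p) x" "g p x = 0" if "p \<in> pre x" for p
    using chart that by (auto simp: sheet_chart_def)
  define G where "G y = (y - x) + (\<Sum>p\<in>pre x. (g p y - (y - x) \<bullet> \<nu> p) *\<^sub>R d p)" for y
  have "strict_derivative_at (\<lambda>y. (y + - x) + (\<Sum>p\<in>pre x. (g p y + (- (y \<bullet> \<nu> p) + x \<bullet> \<nu> p)) *\<^sub>R d p))
     (\<lambda>w. (w + 0) + (\<Sum>p\<in>pre x. (w \<bullet> \<nu> p + (- (w \<bullet> \<nu> p) + 0)) *\<^sub>R d p)) x"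
    by (intro strict_derivative_at_add strict_derivative_at_sum strict_derivative_at_const
        strict_derivative_at_compose_linear[OF bounded_linear_scaleR_left] strict finite_pre
        strict_derivative_at_bounded_linear bounded_linear_minus bounded_linear_ident bounded_linear_inner_left)
  also have "(\<lambda>w. (w + 0) + (\<Sum>p\<in>pre x. (w \<bullet> \<nu> p + (- (w \<bullet> \<nu> p) + 0)) *\<^sub>R d p)) = (\<lambda>w. w)" by simp
  also have "(\<lambda>y. (y + - x) + (\<Sum>p\<in>pre x. (g p y + (- (y \<bullet> \<nu> p) + x \<bullet> \<nu> p)) *\<^sub>R d p)) = G"
    by (auto simp: G_def inner_diff_left algebra_simps fun_eq_iff intro!: sum.cong)
  finally have G: "strict_derivative_at G (\<lambda>w. w) x" .
  have Gx: "G x = 0" by (simp add: G_def strict)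
  have e: "0 < \<epsilon>" using chart by (simp add: sheet_chart_def)
  obtain \<delta> H where dl: "0 < \<delta>" "\<delta> \<le> \<epsilon>" "open (G ` ball x \<delta>)" "homeomorphism (ball x \<delta>) (G ` ball x \<delta>) G H"
    by (rule strict_identity_local_homeomorphism[OF G e])
  have "0 \<in> G ` ball x \<delta>" using dl(1) Gx by (intro image_eqI[of _ _ x]) auto
  then obtain r where r: "0 < r" "ball 0 r \<subseteq> G ` ball x \<delta>" using dl(3) open_contains_ball by metis
  define W where "W = ball x \<delta> \<inter> G -` ball 0 r"
  have cG: "continuous_on (ball x \<delta>) G" using dl(4) by (simp add: homeomorphism_def)
  show ?thesis
  proof
    show "open W" unfolding W_def by (rule continuous_open_preimage[OF cG open_ball open_ball])
    show "x \<in> W" using Gx r dl by (simp add: W_def)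
    show "W \<subseteq> ball x \<epsilon>" using dl(2) by (auto simp: W_def)
    have "G ` W = ball 0 r" using r(2) by (auto simp: W_def)
    then show "homeomorphism W (ball 0 r) G H"
      using r(2) by (intro homeomorphism_of_subsets[OF dl(4) _ r(2)]) (auto simp: W_def)
    fix y p assume p: "p \<in> pre x"
    have "G y \<bullet> \<nu> p = (y - x) \<bullet> \<nu> p + (\<Sum>q\<in>pre x. (g q y - (y - x) \<bullet> \<nu> q) * (d q \<bullet> \<nu> p))"
      by (simp add: G_def inner_add_left inner_sum_left)
    also have "(\<Sum>q\<in>pre x. (g q y - (y - x) \<bullet> \<nu> q) * (d q \<bullet> \<nu> p))
        = (\<Sum>q\<in>pre x. if p = q then g q y - (y - x) \<bullet> \<nu> q else 0)"
      using p by (intro sum.cong) (auto simp: d)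
    also have "\<dots> = g p y - (y - x) \<bullet> \<nu> p" using p by simp
    finally show "G y \<bullet> \<nu> p = g p y" by simp
  qed (use r Gx in auto)
qed

text \<open>
  What is needed of the normal form, in terms of connected sets only.  The orthants are indexed by the sets \<open>T\<close>
  of sheets on whose positive side they lie, and \<open>z T\<close> is a base point of the orthant \<open>T\<close>.  Every
  point off the hypersurface is joined to the base point inside its orthant; base points of
  adjacent orthants are joined across a single sheet, away from all others.  The sets are images of
  segments under the inverse of the straightening map.  If the normals span the whole space, then
  \<open>x\<close> is the only point on all sheets.\<close>

lemma chart_orthants:
  obtains W z where "open W" "x \<in> W" "W \<subseteq> ball x \<epsilon>"
    "\<And>T p. T \<subseteq> pre x \<Longrightarrow> p \<in> T \<Longrightarrow> g p (z T) > 0"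
    "\<And>T p. T \<subseteq> pre x \<Longrightarrow> p \<in> pre x - T \<Longrightarrow> g p (z T) < 0"
    "\<And>y. y \<in> W - f ` M \<Longrightarrow> \<exists>C. connected C \<and> C \<subseteq> W - f ` M \<and> y \<in> C \<and> z {p \<in> pre x. g p y > 0} \<in> C"
    "\<And>T p. T \<subseteq> pre x \<Longrightarrow> p \<in> pre x - T \<Longrightarrow>
       \<exists>C. connected C \<and> C \<subseteq> W \<and> z T \<in> C \<and> z (insert p T) \<in> C \<and> (\<forall>y\<in>C. {q \<in> pre x. g q y = 0} \<subseteq> {p})"
    "\<And>T. T \<subseteq> pre x \<Longrightarrow> z T \<in> W"
    "\<And>y. y \<in> W \<Longrightarrow> span (\<nu> ` pre x) = UNIV \<Longrightarrow> \<forall>p\<in>pre x. g p y = 0 \<Longrightarrow> y = x"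
proof -
  obtain W G H r where W: "0 < r" "open W" "x \<in> W" "W \<subseteq> ball x \<epsilon>"
    "homeomorphism W (ball 0 r) G H" "G x = 0" and Gg: "\<And>y p. p \<in> pre x \<Longrightarrow> G y \<bullet> \<nu> p = g p y"
    by (rule chart_straighten) blast
  obtain d where d: "\<And>p q. p \<in> pre x \<Longrightarrow> q \<in> pre x \<Longrightarrow> d p \<bullet> \<nu> q = (if p = q then 1 else 0)"
    by (rule dual_family_exists[OF general_pre[of x]]) blast
  \<comment> \<open>the base points are \<open>H (\<plusminus>\<tau> d\<^sub>1 \<plusminus> \<tau> d\<^sub>2 \<dots>)\<close>, with \<open>\<tau>\<close> so small that all lie in the ball\<close>
  define \<tau> where "\<tau> = r / (1 + (\<Sum>p\<in>pre x. norm (d p)))"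
  have S0: "0 \<le> (\<Sum>p\<in>pre x. norm (d p))" by (simp add: sum_nonneg)
  have t: "0 < \<tau>" using W(1) S0 by (simp add: \<tau>_def)
  define c where "c T = (\<Sum>p\<in>pre x. (if p \<in> T then \<tau> else - \<tau>) *\<^sub>R d p)" for T
  have c_in: "c T \<in> ball 0 r" for T
  proof -
    have "norm (c T) \<le> (\<Sum>p\<in>pre x. \<tau> * norm (d p))"
      unfolding c_def using t by (intro sum_norm_le) auto
    also have "\<dots> = \<tau> * (\<Sum>p\<in>pre x. norm (d p))" by (simp add: sum_distrib_left)
    also have "\<dots> < \<tau> * (1 + (\<Sum>p\<in>pre x. norm (d p)))" using t by simp
    also have "\<dots> = r" using S0 by (simp add: \<tau>_def)
    finally show ?thesis by simp
  qed
  have c_nu: "c T \<bullet> \<nu> q = (if q \<in> T then \<tau> else - \<tau>)" if "q \<in> pre x" for T q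
  proof -
    have "c T \<bullet> \<nu> q = (\<Sum>p\<in>pre x. (if p \<in> T then \<tau> else - \<tau>) * (d p \<bullet> \<nu> q))"
      by (simp add: c_def inner_sum_left)
    also have "\<dots> = (\<Sum>p\<in>pre x. if q = p then (if p \<in> T then \<tau> else - \<tau>) else 0)"
      using that by (intro sum.cong) (auto simp: d)
    finally show ?thesis using that by simp
  qed
  define z where "z T = H (c T)" for T
  have HW: "H ` ball 0 r = W" and GH: "\<And>\<zeta>. \<zeta> \<in> ball 0 r \<Longrightarrow> G (H \<zeta>) = \<zeta>"
    and HG: "\<And>y. y \<in> W \<Longrightarrow> H (G y) = y" and GW: "\<And>y. y \<in> W \<Longrightarrow> G y \<in> ball 0 r"
    and cH: "continuous_on (ball 0 r) H"
    using W(5) unfolding homeomorphism_def by blast+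
  have gH: "g p (H \<zeta>) = \<zeta> \<bullet> \<nu> p" if "\<zeta> \<in> ball 0 r" "p \<in> pre x" for p \<zeta>
    using Gg[OF that(2), of "H \<zeta>"] GH[OF that(1)] by simp
  have seg: "closed_segment a b \<subseteq> ball 0 r" if "a \<in> ball 0 r" "b \<in> ball 0 r" for a b :: 'e
    using that by (intro closed_segment_subset) auto
  have conn: "connected (H ` closed_segment a b)" if "a \<in> ball 0 r" "b \<in> ball 0 r" for a b
    using seg[OF that] cH by (intro connected_continuous_image) (auto intro: continuous_on_subset)
  show ?thesis
  proof
    show "open W" "x \<in> W" "W \<subseteq> ball x \<epsilon>" by fact+
    show "g p (z T) > 0" if "T \<subseteq> pre x" "p \<in> T" for T p
      using that t by (auto simp: z_def gH[OF c_in] c_nu)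
    show "g p (z T) < 0" if "T \<subseteq> pre x" "p \<in> pre x - T" for T p
      using that t by (auto simp: z_def gH[OF c_in] c_nu)
    show "z T \<in> W" if "T \<subseteq> pre x" for T using HW c_in by (auto simp: z_def)
    show "y = x" if "y \<in> W" "span (\<nu> ` pre x) = UNIV" "\<forall>p\<in>pre x. g p y = 0" for y
    proof -
      have "orthogonal (G y) a" if "a \<in> span (\<nu> ` pre x)" for a
        using that by (rule orthogonal_to_span) (use Gg \<open>\<forall>p\<in>pre x. g p y = 0\<close> in \<open>auto simp: orthogonal_def\<close>)
      then have "G y = 0" using that(2) by (metis UNIV_I orthogonal_self)
      then show ?thesis using HG[OF \<open>y \<in> W\<close>] HG[OF W(3)] W(6) by simp
    qed
    fix y assume y: "y \<in> W - f ` M"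
    let ?T = "{p \<in> pre x. g p y > 0}"
    have ne: "g p y \<noteq> 0" if "p \<in> pre x" for p
      using y W(4) chart_image_iff[of y] that by auto
    have "H ` closed_segment (G y) (c ?T) \<subseteq> W - f ` M"
    proof
      fix u assume "u \<in> H ` closed_segment (G y) (c ?T)"
      then obtain \<zeta> where \<zeta>: "\<zeta> \<in> closed_segment (G y) (c ?T)" "u = H \<zeta>" by blast
      have \<zeta>r: "\<zeta> \<in> ball 0 r" using seg[OF GW c_in] y \<zeta>(1) by blast
      then have uW: "u \<in> W" using HW \<zeta>(2) by blast
      have "g p u \<noteq> 0" if p: "p \<in> pre x" for p
      proof (cases "g p y > 0")
        case True
        have "closed_segment (G y) (c ?T) \<subseteq> {\<zeta>. \<nu> p \<bullet> \<zeta> > 0}"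
          using p True t Gg[OF p, of y] c_nu[OF p, of ?T]
          by (intro closed_segment_subset convex_halfspace_gt) (auto simp: inner_commute)
        then show ?thesis using \<zeta> gH[OF \<zeta>r p] by (auto simp: inner_commute)
      next
        case False
        then have "g p y < 0" using ne[OF p] by simp
        then have "closed_segment (G y) (c ?T) \<subseteq> {\<zeta>. \<nu> p \<bullet> \<zeta> < 0}"
          using p False t Gg[OF p, of y] c_nu[OF p, of ?T]
          by (intro closed_segment_subset convex_halfspace_lt) (auto simp: inner_commute)
        then show ?thesis using \<zeta> gH[OF \<zeta>r p] by (auto simp: inner_commute)
      qed
      then show "u \<in> W - f ` M" using uW W(4) chart_image_iff[of u] by auto
    qed
    moreover have "y \<in> H ` closed_segment (G y) (c ?T)" using HG y by (intro image_eqI[of _ _ "G y"]) auto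
    moreover have "z ?T \<in> H ` closed_segment (G y) (c ?T)" by (auto simp: z_def)
    ultimately show "\<exists>C. connected C \<and> C \<subseteq> W - f ` M \<and> y \<in> C \<and> z ?T \<in> C"
      using conn[OF GW c_in] y by blast
  next
    fix T p assume Tp: "T \<subseteq> pre x" "p \<in> pre x - T"
    let ?C = "H ` closed_segment (c T) (c (insert p T))"
    have "{q \<in> pre x. g q u = 0} \<subseteq> {p}" if u: "u \<in> ?C" for u
    proof (rule ccontr)
      assume "\<not> {q \<in> pre x. g q u = 0} \<subseteq> {p}"
      then obtain q where q: "q \<in> pre x" "g q u = 0" "q \<noteq> p" by blast
      obtain \<zeta> where \<zeta>: "\<zeta> \<in> closed_segment (c T) (c (insert p T))" "u = H \<zeta>" using u by blast
      have \<zeta>r: "\<zeta> \<in> ball 0 r" using seg[OF c_in c_in] \<zeta>(1) by blast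
      have "closed_segment (c T) (c (insert p T)) \<subseteq> {\<zeta>. \<nu> q \<bullet> \<zeta> = (if q \<in> T then \<tau> else - \<tau>)}"
        using c_nu[OF q(1), of T] c_nu[OF q(1), of "insert p T"] q(3)
        by (intro closed_segment_subset convex_hyperplane) (auto simp: inner_commute)
      then show False using \<zeta> gH[OF \<zeta>r q(1)] q(2) t by (auto simp: inner_commute split: if_splits)
    qed
    moreover have "?C \<subseteq> W" using seg[OF c_in c_in] HW by blast
    moreover have "z T \<in> ?C" "z (insert p T) \<in> ?C" by (auto simp: z_def)
    ultimately show "\<exists>C. connected C \<and> C \<subseteq> W \<and> z T \<in> C \<and> z (insert p T) \<in> C
        \<and> (\<forall>y\<in>C. {q \<in> pre x. g q y = 0} \<subseteq> {p})"
      using conn[OF c_in c_in] by blast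
  qed
qed

end

lemma eventually_ray_off_image:
  assumes "\<And>p. p \<in> pre x \<Longrightarrow> w \<bullet> \<nu> p \<noteq> 0"
  shows "\<forall>\<^sub>F e in at_right 0. x + e *\<^sub>R w \<notin> f ` M"
proof -
  obtain \<epsilon> N g where c: "sheet_chart M f \<nu> x \<epsilon> N g" using charts by blast
  have "\<forall>p\<in>pre x. \<forall>\<^sub>F e in at_right 0. g p (x + e *\<^sub>R w) \<noteq> 0"
  proof
    fix p assume p: "p \<in> pre x"
    then have s: "strict_derivative_at (g p) (\<lambda>w. w \<bullet> \<nu> p) x" "g p x = 0"
      using c by (auto simp: sheet_chart_def)
    consider "w \<bullet> \<nu> p > 0" | "w \<bullet> \<nu> p < 0" using assms[OF p] by linarith
    then show "\<forall>\<^sub>F e in at_right 0. g p (x + e *\<^sub>R w) \<noteq> 0"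
    proof cases
      case 1 from strict_derivative_ray_sign(1)[OF s 1] show ?thesis by eventually_elim simp
    next
      case 2 from strict_derivative_ray_sign(2)[OF s 2] show ?thesis by eventually_elim simp
    qed
  qed
  then have "\<forall>\<^sub>F e in at_right 0. \<forall>p\<in>pre x. g p (x + e *\<^sub>R w) \<noteq> 0"
    by (rule eventually_ball_finite[OF finite_pre])
  moreover have "\<forall>\<^sub>F e in at_right 0. x + e *\<^sub>R w \<in> ball x \<epsilon>"
    by (rule eventually_ray_in_open) (use c in \<open>auto simp: sheet_chart_def\<close>)
  ultimately show ?thesis
    by eventually_elim (use chart_image_iff[OF c] in blast)
qed


lemma direction_exists:
  obtains w where "\<And>p. p \<in> pre x \<Longrightarrow> w \<bullet> \<nu> p = s p"
proof -
  obtain d where d: "\<And>p q. p \<in> pre x \<Longrightarrow> q \<in> pre x \<Longrightarrow> d p \<bullet> \<nu> q = (if p = q then 1 else 0)"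
    by (rule dual_family_exists[OF general_pre[of x]]) blast
  have "(\<Sum>p\<in>pre x. s p *\<^sub>R d p) \<bullet> \<nu> q = s q" if "q \<in> pre x" for q
  proof -
    have "(\<Sum>p\<in>pre x. s p *\<^sub>R d p) \<bullet> \<nu> q = (\<Sum>p\<in>pre x. if q = p then s p else 0)"
      unfolding inner_sum_left using that by (intro sum.cong) (auto simp: d)
    then show ?thesis using that by simp
  qed
  then show ?thesis using that by blast
qed

text \<open>
  A ray in a direction transverse to all sheets leaves the hypersurface at once.\<close>

lemma image_nowhere_dense:
  assumes "open S" "x \<in> S"
  obtains y where "y \<in> S" "y \<notin> f ` M"
proof -
  obtain w where w: "\<And>p. p \<in> pre x \<Longrightarrow> w \<bullet> \<nu> p = 1" by (rule direction_exists[of x "\<lambda>_. 1"]) blast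
  have "\<forall>\<^sub>F e in at_right 0. x + e *\<^sub>R w \<in> S \<and> x + e *\<^sub>R w \<notin> f ` M"
    by (intro eventually_conj eventually_ray_in_open assms eventually_ray_off_image) (simp add: w)
  then have "\<exists>e. x + e *\<^sub>R w \<in> S \<and> x + e *\<^sub>R w \<notin> f ` M"
    by (rule eventually_happens'[OF trivial_limit_at_right_real])
  then show ?thesis using that by blast
qed

end

section \<open>Functions that do not jump across simple points\<close>

text \<open>
  Values on \<open>I\<close> are ignored, as for Alexander numberings.\<close>

definition steady :: "'e::metric_space set \<Rightarrow> ('e \<Rightarrow> real) \<Rightarrow> 'e \<Rightarrow> bool" where
  "steady I \<phi> x \<longleftrightarrow> (\<exists>\<epsilon>>0. \<exists>c. \<forall>y\<in>ball x \<epsilon> - I. \<phi> y = c)"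

lemma steady_diff:
  assumes "steady I \<phi> x" "steady I \<psi> x" shows "steady I (\<lambda>y. \<phi> y - \<psi> y) x"
proof -
  obtain a c b d where "0 < a" "\<forall>y\<in>ball x a - I. \<phi> y = c" "0 < b" "\<forall>y\<in>ball x b - I. \<psi> y = d"
    using assms by (auto simp: steady_def)
  then show ?thesis unfolding steady_def
    by (intro exI[of _ "min a b"]) auto
qed

lemma steady_of_open:
  assumes "open S" "x \<in> S" "\<And>y. y \<in> S \<Longrightarrow> y \<notin> I \<Longrightarrow> \<phi> y = c"
  shows "steady I \<phi> x"
proof -
  obtain \<epsilon> where "0 < \<epsilon>" "ball x \<epsilon> \<subseteq> S" using assms(1,2) open_contains_ball by blast
  then show ?thesis using assms(3) unfolding steady_def by blast
qed

lemma steady_of_bool: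
  assumes "open A" "open B" "x \<in> A \<union> B" "\<And>y. y \<in> A \<Longrightarrow> P y" "\<And>y. y \<in> B \<Longrightarrow> \<not> P y"
  shows "steady I (\<lambda>y. of_bool (P y)) x"
proof (cases "x \<in> A")
  case True
  then show ?thesis using assms(4) by (intro steady_of_open[OF assms(1), of _ _ _ 1]) auto
next
  case False
  then show ?thesis using assms(3,5) by (intro steady_of_open[OF assms(2), of _ _ _ 0]) auto
qed

lemma steady_no_jump:
  fixes x n :: "'e::real_normed_vector"
  assumes "steady {} \<phi> x"
  shows "\<forall>\<^sub>F e in at_right 0. \<phi> (x + e *\<^sub>R n) = \<phi> (x - e *\<^sub>R n)"
proof -
  obtain \<epsilon> c where e: "0 < \<epsilon>" "\<And>y. y \<in> ball x \<epsilon> \<Longrightarrow> \<phi> y = c"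
    using assms by (auto simp: steady_def)
  have "x \<in> ball x \<epsilon>" using e(1) by simp
  then have "\<forall>\<^sub>F d in at_right 0. x + d *\<^sub>R n \<in> ball x \<epsilon>" "\<forall>\<^sub>F d in at_right 0. x - d *\<^sub>R n \<in> ball x \<epsilon>"
    by (auto intro!: eventually_ray_in_open eventually_ray_in_open' simp del: mem_ball)
  then show ?thesis by eventually_elim (simp add: e(2) del: mem_ball)
qed

lemma steady_sum:
  assumes "finite J" "\<And>j. j \<in> J \<Longrightarrow> steady I (\<phi> j) x"
  shows "steady I (\<lambda>y. \<Sum>j\<in>J. \<phi> j y) x"
  using assms
proof (induction J rule: finite_induct)
  case empty
  then show ?case by (auto simp: steady_def intro: exI[of _ 1])
next
  case (insert j J)
  have "steady I (\<lambda>y. 0 - \<phi> j y) x"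
    by (rule steady_diff) (use insert.prems in \<open>auto simp: steady_def intro: exI[of _ 1]\<close>)
  from steady_diff[OF _ this, of "\<lambda>y. \<Sum>j\<in>J. \<phi> j y"] insert show ?case by (simp add: add.commute)
qed

context generic_hypersurface
begin

text \<open>
  Since \<open>f ` M\<close> is nowhere dense, the value that \<open>\<phi>\<close> takes near a point is unique, and so it is a
  locally constant function on \<open>S\<close>, also at points of the hypersurface.\<close>

lemma steady_connected_const:
  assumes S: "connected S" and st: "\<And>x. x \<in> S \<Longrightarrow> steady (f ` M) \<phi> x"
  obtains c where "\<And>x. x \<in> S \<Longrightarrow> \<exists>\<epsilon>>0. \<forall>y\<in>ball x \<epsilon> - f ` M. \<phi> y = c"
proof -
  define germ where "germ x c \<longleftrightarrow> (\<exists>\<epsilon>>0. \<forall>y\<in>ball x \<epsilon> - f ` M. \<phi> y = c)" for x c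
  have uniq: "c = c'" if c: "germ x c" "germ x c'" for x c c'
  proof -
    obtain a b where ab: "0 < a" "0 < b" "\<forall>y\<in>ball x a - f ` M. \<phi> y = c" "\<forall>y\<in>ball x b - f ` M. \<phi> y = c'"
      using c by (auto simp: germ_def)
    obtain y where "y \<in> ball x (min a b)" "y \<notin> f ` M"
      by (rule image_nowhere_dense[of "ball x (min a b)" x]) (use ab in auto)
    then have "y \<in> ball x a - f ` M" "y \<in> ball x b - f ` M" by auto
    then show ?thesis using ab(3,4) by metis
  qed
  define v where "v x = (THE c. germ x c)" for x
  have v: "v x = c" if "germ x c" for x c
    using that uniq by (auto simp: v_def intro!: the_equality)
  have gv: "germ x (v x)" if "x \<in> S" for x
    using st[OF that] v by (metis germ_def steady_def)
  have loc: "\<forall>\<^sub>F y in at x within S. v x = v y" if x: "x \<in> S" for x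
  proof -
    obtain \<epsilon> where e: "0 < \<epsilon>" "\<forall>y\<in>ball x \<epsilon> - f ` M. \<phi> y = v x"
      using gv[OF x] by (auto simp: germ_def)
    have "v y = v x" if "dist y x < \<epsilon>" for y
    proof (rule v)
      have "ball y (\<epsilon> - dist y x) \<subseteq> ball x \<epsilon>" using that by (simp add: ball_subset_ball_iff dist_commute)
      then have "\<forall>y'\<in>ball y (\<epsilon> - dist y x) - f ` M. \<phi> y' = v x" using e(2) by blast
      moreover have "0 < \<epsilon> - dist y x" using that by simp
      ultimately show "germ y (v x)" unfolding germ_def by blast
    qed
    then have "\<forall>y\<in>S. y \<noteq> x \<and> dist y x < \<epsilon> \<longrightarrow> v x = v y" by metis
    then show ?thesis using e(1) unfolding eventually_at by blast
  qed
  show ?thesis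
  proof (cases "S = {}")
    case False
    then obtain a where a: "a \<in> S" by blast
    have "germ x (v a)" if "x \<in> S" for x
    proof -
      have "v a = v x" by (rule connected_local_const[OF S a that]) (use loc in blast)
      then show ?thesis using gv[OF that] by simp
    qed
    then show ?thesis using that by (auto simp: germ_def)
  qed (use that in auto)
qed

lemma steady_connected_eq:
  assumes "connected C" "\<And>x. x \<in> C \<Longrightarrow> steady (f ` M) \<phi> x" "a \<in> C" "b \<in> C" "a \<notin> f ` M" "b \<notin> f ` M"
  shows "\<phi> a = \<phi> b"
proof -
  obtain c where c: "\<And>x. x \<in> C \<Longrightarrow> \<exists>\<epsilon>>0. \<forall>y\<in>ball x \<epsilon> - f ` M. \<phi> y = c"
    by (rule steady_connected_const[OF assms(1,2)]) blast+
  have "\<phi> x = c" if "x \<in> C" "x \<notin> f ` M" for x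
    using c[OF that(1)] that(2) by (metis DiffI centre_in_ball)
  then show ?thesis using assms by simp
qed

text \<open>
  Induction on the multiplicity of \<open>x\<close>.  At a simple point both half-balls carry one value, and the two
  values agree by assumption.  At a multiple point any two orthants are linked by a chain of
  adjacent ones, and two adjacent orthants are joined by a path that meets one sheet only; along
  this path all points are at most simple, hence steady.\<close>

lemma steady_if_no_jump:
  assumes S: "open S"
    and off: "\<And>y. y \<in> S \<Longrightarrow> y \<notin> f ` M \<Longrightarrow> steady (f ` M) \<phi> y"
    and jump: "\<And>p. p \<in> M \<Longrightarrow> f p \<in> S \<Longrightarrow> pre (f p) = {p} \<Longrightarrow>
      \<forall>\<^sub>F e in at_right 0. \<phi> (f p + e *\<^sub>R \<nu> p) = \<phi> (f p - e *\<^sub>R \<nu> p)"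
    and x: "x \<in> S"
  shows "steady (f ` M) \<phi> x"
  using x
proof (induction "card (pre x)" arbitrary: x rule: less_induct)
  case less
  note x = less.prems
  have st: "steady (f ` M) \<phi> y" if "y \<in> S" "card (pre y) < card (pre x)" for y
    using less.hyps that by blast
  have jump': "\<forall>\<^sub>F e in at_right 0. \<phi> (x + e *\<^sub>R \<nu> p) = \<phi> (x - e *\<^sub>R \<nu> p)"
    if "pre x = {p}" for p
  proof -
    have "p \<in> M" "f p = x" using that by (auto simp: preimages_def)
    then show ?thesis using jump[of p] that x by simp
  qed
  show ?case
  proof (cases "x \<in> f ` M")
    case xI: True
    obtain \<epsilon> N g where ch: "sheet_chart M f \<nu> x \<epsilon> N g" and S': "ball x \<epsilon> \<subseteq> S"
      by (rule chart_within[OF S x])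
    obtain W z where W: "open W" "x \<in> W" "W \<subseteq> ball x \<epsilon>"
      and zpos: "\<And>T p. T \<subseteq> pre x \<Longrightarrow> p \<in> T \<Longrightarrow> g p (z T) > 0"
      and zneg: "\<And>T p. T \<subseteq> pre x \<Longrightarrow> p \<in> pre x - T \<Longrightarrow> g p (z T) < 0"
      and reach: "\<And>y. y \<in> W - f ` M \<Longrightarrow>
         \<exists>C. connected C \<and> C \<subseteq> W - f ` M \<and> y \<in> C \<and> z {p \<in> pre x. g p y > 0} \<in> C"
      and flip: "\<And>T p. T \<subseteq> pre x \<Longrightarrow> p \<in> pre x - T \<Longrightarrow>
         \<exists>C. connected C \<and> C \<subseteq> W \<and> z T \<in> C \<and> z (insert p T) \<in> C \<and> (\<forall>y\<in>C. {q \<in> pre x. g q y = 0} \<subseteq> {p})"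
      and zW: "\<And>T. T \<subseteq> pre x \<Longrightarrow> z T \<in> W"
      by (rule chart_orthants[OF ch]) blast
    have zI: "z T \<notin> f ` M" if "T \<subseteq> pre x" for T
      using chart_image_iff[OF ch, of "z T"] zW[OF that] W(3) zpos[OF that] zneg[OF that] by force
    have off': "steady (f ` M) \<phi> y" if "y \<in> W - f ` M" for y
      using that off[of y] S' W(3) by auto
    have orth: "\<phi> y = \<phi> (z {p \<in> pre x. g p y > 0})" if y: "y \<in> W - f ` M" for y
    proof -
      obtain C where C: "connected C" "C \<subseteq> W - f ` M" "y \<in> C" "z {p \<in> pre x. g p y > 0} \<in> C"
        using reach[OF y] by blast
      show ?thesis by (rule steady_connected_eq[OF C(1) off' C(3,4)]) (use C in blast)+
    qed
    have step: "\<phi> (z T) = \<phi> (z (insert p T))" if T: "T \<subseteq> pre x" "p \<in> pre x - T" for T p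
    proof (cases "pre x = {p}")
      case True
      have T0: "T = {}" using T True by auto
      have s: "strict_derivative_at (g p) (\<lambda>w. w \<bullet> \<nu> p) x" "g p x = 0"
        using ch T by (auto simp: sheet_chart_def)
      have n0: "\<nu> p \<bullet> \<nu> p > 0"
        using general_pre[of x] dependent_zero[of "\<nu> ` pre x"] T by (auto simp: general_position_def)
      have "\<forall>\<^sub>F e in at_right 0. x + e *\<^sub>R \<nu> p \<in> W" "\<forall>\<^sub>F e in at_right 0. x + e *\<^sub>R (- \<nu> p) \<in> W"
        by (rule eventually_ray_in_open[OF W(1,2)])+
      moreover have "\<forall>\<^sub>F e in at_right 0. g p (x + e *\<^sub>R \<nu> p) > 0" "\<forall>\<^sub>F e in at_right 0. g p (x + e *\<^sub>R (- \<nu> p)) < 0"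
        using strict_derivative_ray_sign(1)[OF s n0] strict_derivative_ray_sign(2)[OF s, of "- \<nu> p"] n0
        by simp_all
      moreover note jump'[OF True]
      ultimately have "\<forall>\<^sub>F e in at_right (0::real). \<phi> (z T) = \<phi> (z (insert p T))"
      proof eventually_elim
        case (elim e)
        have 1: "{q \<in> pre x. g q (x + e *\<^sub>R \<nu> p) > 0} = {p}" and 2: "{q \<in> pre x. g q (x - e *\<^sub>R \<nu> p) > 0} = {}"
          using elim True by auto
        have "u \<notin> f ` M" if "u \<in> W" "g p u \<noteq> 0" for u
          using that True W(3) chart_image_iff[OF ch, of u] by (metis singletonD subsetD)
        then have "x + e *\<^sub>R \<nu> p \<notin> f ` M" "x - e *\<^sub>R \<nu> p \<notin> f ` M"
          using elim by simp_all
        then show ?case using orth[of "x + e *\<^sub>R \<nu> p"] orth[of "x - e *\<^sub>R \<nu> p"] elim 1 2 T0 by simp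
      qed
      then show ?thesis using eventually_happens'[OF trivial_limit_at_right_real] by blast
    next
      case False
      obtain C where C: "connected C" "C \<subseteq> W" "z T \<in> C" "z (insert p T) \<in> C"
        and zero: "\<And>y. y \<in> C \<Longrightarrow> {q \<in> pre x. g q y = 0} \<subseteq> {p}"
        using flip[OF T] by blast
      show ?thesis
      proof (rule steady_connected_eq[OF C(1) _ C(3,4)])
        fix y assume y: "y \<in> C"
        have "card {q \<in> pre x. g q y = 0} \<le> card {p}" using zero[OF y] by (intro card_mono) auto
        then have le: "card (pre y) \<le> 1" using chart_card_pre[OF ch, of y] y C(2) W(3) by auto
        have "{p} \<subset> pre x" using False T by blast
        then have "card (pre y) < card (pre x)" using le psubset_card_mono[OF finite_pre, of "{p}" x] by simp
        then show "steady (f ` M) \<phi> y" using st y C(2) W(3) S' by blast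
      qed (use zI T in auto)
    qed
    have "\<phi> (z T) = \<phi> (z {})" if "T \<subseteq> pre x" for T
    proof -
      have "finite T" using that by (rule finite_subset) simp
      then show ?thesis using that
      proof (induction T rule: finite_induct)
        case (insert p T)
        then have T: "T \<subseteq> pre x" "p \<in> pre x - T" by blast+
        show ?case using step[OF T] insert.IH[OF T(1)] by (rule trans[OF sym])
      qed simp
    qed
    then have "\<phi> y = \<phi> (z {})" if "y \<in> W" "y \<notin> f ` M" for y
      using orth[of y] that by (metis (mono_tags, lifting) DiffI mem_Collect_eq subsetI)
    then show ?thesis by (intro steady_of_open[OF W(1,2)])
  qed (use off x in blast)
qed

end

section \<open>Alexander numberings and indices\<close>

text \<open>
  The average over the \<open>2 ^ k\<close> regions at a \<open>k\<close>-fold point, where the region \<open>S\<close> has number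
  \<open>a + card S\<close>.\<close>

lemma mean_card_Pow:
  assumes "finite Q"
  shows "(\<Sum>S\<in>Pow Q. a + real (card S)) / 2 ^ card Q = a + card Q / 2"
proof -
  have "(\<Sum>S\<in>Pow Q. a + real (card S)) = 2 ^ card Q * (a + card Q / 2)" using assms
  proof (induction Q arbitrary: a rule: finite_induct)
    case (insert p Q)
    have inj: "inj_on (insert p) (Pow Q)" using insert.hyps(2) by (auto simp: inj_on_def)
    have "(\<Sum>S\<in>Pow (insert p Q). a + real (card S))
        = (\<Sum>S\<in>Pow Q. a + real (card S)) + (\<Sum>S\<in>insert p ` Pow Q. a + real (card S))"
      unfolding Pow_insert by (rule sum.union_disjoint) (use insert.hyps in auto)
    also have "(\<Sum>S\<in>insert p ` Pow Q. a + real (card S)) = (\<Sum>S\<in>Pow Q. (a + 1) + real (card S))"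
      unfolding sum.reindex[OF inj] comp_def
    proof (rule sum.cong)
      fix S assume "S \<in> Pow Q"
      then have "p \<notin> S" "finite S" using insert.hyps finite_subset by auto
      then show "a + real (card (insert p S)) = (a + 1) + real (card S)" by simp
    qed simp
    also have "(\<Sum>S\<in>Pow Q. a + real (card S)) + (\<Sum>S\<in>Pow Q. (a + 1) + real (card S))
       = 2 ^ card Q * (a + card Q / 2) + 2 ^ card Q * (a + 1 + card Q / 2)"
      by (simp only: insert.IH)
    also have "\<dots> = 2 ^ card (insert p Q) * (a + card (insert p Q) / 2)"
      using insert.hyps by (simp add: field_simps)
    finally show ?case .
  qed simp
  then show ?thesis by simp
qed

context generic_hypersurface
begin

lemma const_if_no_jump:
  assumes "open S" "connected S"
    and "\<And>y. y \<in> S \<Longrightarrow> y \<notin> f ` M \<Longrightarrow> steady (f ` M) \<phi> y"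
    and "\<And>p. p \<in> M \<Longrightarrow> f p \<in> S \<Longrightarrow> pre (f p) = {p} \<Longrightarrow>
      \<forall>\<^sub>F e in at_right 0. \<phi> (f p + e *\<^sub>R \<nu> p) = \<phi> (f p - e *\<^sub>R \<nu> p)"
  obtains c where "\<And>y. y \<in> S \<Longrightarrow> y \<notin> f ` M \<Longrightarrow> \<phi> y = c"
proof -
  have st: "steady (f ` M) \<phi> y" if "y \<in> S" for y
    by (rule steady_if_no_jump[OF assms(1,3,4) that])
  show ?thesis
  proof (cases "\<exists>a. a \<in> S - f ` M")
    case True
    then obtain a where a: "a \<in> S - f ` M" by blast
    have "\<phi> y = \<phi> a" if "y \<in> S" "y \<notin> f ` M" for y
      by (rule steady_connected_eq[OF assms(2) st]) (use that a in auto)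
    then show ?thesis using that by blast
  qed (use that in blast)
qed

lemma chart_sign_steady:
  assumes "sheet_chart M f \<nu> x \<epsilon> N g" "p \<in> pre x" "y \<in> ball x \<epsilon>" "g p y \<noteq> 0"
  shows "steady I (\<lambda>y. of_bool (g p y > 0)) y"
proof (rule steady_of_bool)
  have c: "continuous_on (ball x \<epsilon>) (g p)" using assms(1,2) by (auto simp: sheet_chart_def)
  show "open (ball x \<epsilon> \<inter> g p -` {0<..})" "open (ball x \<epsilon> \<inter> g p -` {..<0})"
    by (auto intro: continuous_open_preimage[OF c])
  show "y \<in> ball x \<epsilon> \<inter> g p -` {0<..} \<union> ball x \<epsilon> \<inter> g p -` {..<0}" using assms(3,4) by auto
qed auto

text \<open>
  At a simple point exactly one of the functions \<open>g p\<close> vanishes; it changes sign in the direction of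
  the coorientation, and the others keep their signs.\<close>

lemma chart_count_jump:
  assumes ch: "sheet_chart M f \<nu> x \<epsilon> N g" and p': "p' \<in> M" "f p' \<in> ball x \<epsilon>" "pre (f p') = {p'}"
  shows "\<forall>\<^sub>F e in at_right 0. (\<Sum>p\<in>pre x. of_bool (g p (f p' + e *\<^sub>R \<nu> p') > 0) :: real)
    = (\<Sum>p\<in>pre x. of_bool (g p (f p' - e *\<^sub>R \<nu> p') > 0)) + 1"
proof -
  obtain p where p: "p \<in> pre x" "p' \<in> N p" using ch p' by (auto simp: sheet_chart_def)
  have other: "g q (f p') \<noteq> 0" if q: "q \<in> pre x - {p}" for q
  proof
    assume "g q (f p') = 0"
    then obtain p'' where p'': "p'' \<in> N q" "f p'' = f p'"
      using ch q p'(2) by (force simp: sheet_chart_def)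
    then have "p'' \<in> pre (f p')" using ch q by (auto simp: sheet_chart_def preimages_def)
    then have "p' \<in> N q" using p'' p'(3) by auto
    moreover have "N q \<inter> N p = {}" using ch p q by (auto simp: sheet_chart_def disjoint_family_on_def)
    ultimately show False using p by blast
  qed
  have "\<forall>\<^sub>F e in at_right 0. g p (f p' + e *\<^sub>R \<nu> p') > 0 \<and> g p (f p' - e *\<^sub>R \<nu> p') < 0"
    using ch p p' by (auto simp: sheet_chart_def)
  moreover have "\<forall>\<^sub>F e in at_right 0. \<forall>q\<in>pre x - {p}.
      (of_bool (g q (f p' + e *\<^sub>R \<nu> p') > 0) :: real) = of_bool (g q (f p' - e *\<^sub>R \<nu> p') > 0)"
    by (intro eventually_ball_finite ballI steady_no_jump chart_sign_steady[OF ch] p' other) auto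
  ultimately show ?thesis
  proof eventually_elim
    case (elim e)
    then have "(\<Sum>q\<in>pre x - {p}. of_bool (g q (f p' + e *\<^sub>R \<nu> p') > 0) :: real)
        = (\<Sum>q\<in>pre x - {p}. of_bool (g q (f p' - e *\<^sub>R \<nu> p') > 0))"
      by (intro sum.cong) auto
    then show ?case using elim
      unfolding sum.remove[OF finite_pre p(1), of "\<lambda>q. of_bool (g q _ > 0) :: real"] by simp
  qed
qed

lemma alexander_steady:
  assumes "alexander_numbering M f \<nu> c \<alpha>" "x \<notin> f ` M"
  shows "steady I \<alpha> x"
proof -
  obtain \<epsilon> where e: "0 < \<epsilon>" "ball x \<epsilon> \<subseteq> - f ` M"
    using closed_image assms(2) unfolding closed_def open_contains_ball by blast
  have "\<alpha> y = \<alpha> x" if "y \<in> ball x \<epsilon>" for y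
  proof -
    have "connected_component (- f ` M) x y"
      unfolding connected_component_def using e that by (intro exI[of _ "ball x \<epsilon>"]) auto
    then show ?thesis using assms(1) unfolding alexander_numbering_def by metis
  qed
  then show ?thesis using e(1) unfolding steady_def by blast
qed

lemma alexander_jump:
  assumes "alexander_numbering M f \<nu> c \<alpha>" "p \<in> M" "pre (f p) = {p}"
  shows "\<forall>\<^sub>F e in at_right 0. \<alpha> (f p + e *\<^sub>R \<nu> p) = \<alpha> (f p - e *\<^sub>R \<nu> p) + 1"
  using assms by (auto simp: alexander_numbering_def)

text \<open>
  Up to a constant, the number of positive functions \<open>g p\<close> is the only locally constant function that increases
  by 1 across the sheets.\<close>

lemma chart_count_unique:
  assumes ch: "sheet_chart M f \<nu> x \<epsilon> N g"
    and off: "\<And>y. y \<in> ball x \<epsilon> \<Longrightarrow> y \<notin> f ` M \<Longrightarrow> steady (f ` M) \<phi> y"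
    and jump: "\<And>p. p \<in> M \<Longrightarrow> f p \<in> ball x \<epsilon> \<Longrightarrow> pre (f p) = {p} \<Longrightarrow>
      \<forall>\<^sub>F e in at_right 0. \<phi> (f p + e *\<^sub>R \<nu> p) = \<phi> (f p - e *\<^sub>R \<nu> p) + 1"
  obtains a where "\<And>y. y \<in> ball x \<epsilon> \<Longrightarrow> y \<notin> f ` M \<Longrightarrow> \<phi> y = a + (\<Sum>p\<in>pre x. of_bool (g p y > 0))"
proof -
  let ?n = "\<lambda>y. (\<Sum>p\<in>pre x. of_bool (g p y > 0) :: real)"
  obtain a where a: "\<And>y. y \<in> ball x \<epsilon> \<Longrightarrow> y \<notin> f ` M \<Longrightarrow> \<phi> y - ?n y = a"
  proof (rule const_if_no_jump[OF open_ball connected_ball, of x \<epsilon> "\<lambda>y. \<phi> y - ?n y"])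
    fix y assume y: "y \<in> ball x \<epsilon>" "y \<notin> f ` M"
    show "steady (f ` M) (\<lambda>y. \<phi> y - ?n y) y"
      using chart_image_iff[OF ch y(1)] y
      by (intro steady_diff off steady_sum chart_sign_steady[OF ch]) auto
  next
    fix p assume p: "p \<in> M" "f p \<in> ball x \<epsilon>" "pre (f p) = {p}"
    show "\<forall>\<^sub>F e in at_right 0. \<phi> (f p + e *\<^sub>R \<nu> p) - ?n (f p + e *\<^sub>R \<nu> p) = \<phi> (f p - e *\<^sub>R \<nu> p) - ?n (f p - e *\<^sub>R \<nu> p)"
      using jump[OF p] chart_count_jump[OF ch p] by eventually_elim simp
  qed blast
  show ?thesis by (rule that[of a]) (use a in force)
qed

lemma index_eq:
  assumes ch: "sheet_chart M f \<nu> x \<epsilon> N g"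
    and \<alpha>: "\<And>y. y \<in> ball x \<epsilon> \<Longrightarrow> y \<notin> f ` M \<Longrightarrow> \<alpha> y = a + (\<Sum>p\<in>pre x. of_bool (g p y > 0))"
  shows "index M f \<nu> \<alpha> x = a + card (pre x) / 2"
proof -
  have s: "strict_derivative_at (g p) (\<lambda>w. w \<bullet> \<nu> p) x" "g p x = 0" if "p \<in> pre x" for p
    using ch that by (auto simp: sheet_chart_def)
  have e: "0 < \<epsilon>" using ch by (simp add: sheet_chart_def)
  have ray: "\<forall>\<^sub>F e in at_right 0. \<alpha> (x + e *\<^sub>R w) = a + card S"
    if S: "S \<subseteq> pre x" and w: "\<forall>p\<in>S. w \<bullet> \<nu> p > 0" "\<forall>p\<in>pre x - S. w \<bullet> \<nu> p < 0" for S w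
  proof -
    have "\<forall>\<^sub>F e in at_right 0. \<forall>p\<in>pre x. (g p (x + e *\<^sub>R w) > 0) = (p \<in> S)"
    proof (intro eventually_ball_finite finite_pre ballI)
      fix p assume p: "p \<in> pre x"
      show "\<forall>\<^sub>F e in at_right 0. (g p (x + e *\<^sub>R w) > 0) = (p \<in> S)"
      proof (cases "p \<in> S")
        case True
        then have "w \<bullet> \<nu> p > 0" using w by blast
        from strict_derivative_ray_sign(1)[OF s[OF p] this] True show ?thesis by simp
      next
        case False
        then have "w \<bullet> \<nu> p < 0" using w p by blast
        from strict_derivative_ray_sign(2)[OF s[OF p] this] show ?thesis
          by eventually_elim (use False in auto)
      qed
    qed
    moreover have "\<forall>\<^sub>F e in at_right 0. x + e *\<^sub>R w \<in> ball x \<epsilon>"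
      by (rule eventually_ray_in_open) (use e in auto)
    moreover have "\<forall>\<^sub>F e in at_right 0. x + e *\<^sub>R w \<notin> f ` M"
      by (rule eventually_ray_off_image) (use w in force)
    ultimately show ?thesis
    proof eventually_elim
      case (elim e)
      have "(\<Sum>p\<in>pre x. of_bool (g p (x + e *\<^sub>R w) > 0)) = (\<Sum>p\<in>pre x. of_bool (p \<in> S) :: real)"
        using elim by (intro sum.cong) auto
      also have "\<dots> = card S" using S by (simp add: Int_absorb1 flip: Int_def)
      finally show ?case using \<alpha>[of "x + e *\<^sub>R w"] elim by simp
    qed
  qed
  have "local_region_number M f \<nu> \<alpha> x S = a + card S" if S: "S \<in> Pow (pre x)" for S
    unfolding local_region_number_def
  proof (rule the_equality)
    show "\<forall>w. (\<forall>p\<in>S. 0 < w \<bullet> \<nu> p) \<and> (\<forall>p\<in>pre x - S. w \<bullet> \<nu> p < 0) \<longrightarrow>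
        (\<forall>\<^sub>F e in at_right 0. \<alpha> (x + e *\<^sub>R w) = a + card S)"
      using ray S by blast
  next
    fix b assume b: "\<forall>w. (\<forall>p\<in>S. 0 < w \<bullet> \<nu> p) \<and> (\<forall>p\<in>pre x - S. w \<bullet> \<nu> p < 0) \<longrightarrow>
        (\<forall>\<^sub>F e in at_right 0. \<alpha> (x + e *\<^sub>R w) = b)"
    obtain w where w: "\<And>p. p \<in> pre x \<Longrightarrow> w \<bullet> \<nu> p = (if p \<in> S then 1 else - 1)"
      by (rule direction_exists[of x "\<lambda>p. if p \<in> S then 1 else - 1"]) blast
    then have w': "\<forall>p\<in>S. w \<bullet> \<nu> p > 0" "\<forall>p\<in>pre x - S. w \<bullet> \<nu> p < 0" using S by auto
    have "\<forall>\<^sub>F e in at_right 0. \<alpha> (x + e *\<^sub>R w) = b" using b w' by blast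
    moreover have "\<forall>\<^sub>F e in at_right 0. \<alpha> (x + e *\<^sub>R w) = a + card S" using ray S w' by blast
    ultimately have "\<forall>\<^sub>F e in at_right (0::real). b = a + card S" by eventually_elim simp
    then show "b = a + card S" using eventually_happens'[OF trivial_limit_at_right_real] by blast
  qed
  then have "index M f \<nu> \<alpha> x = (\<Sum>S\<in>Pow (pre x). a + real (card S)) / 2 ^ card (pre x)"
    by (simp add: index_def)
  then show ?thesis using mean_card_Pow[OF finite_pre] by (rule trans)
qed

text \<open>
  The region on the positive side of all sheets has the largest number, \<open>k / 2\<close> above the
  average.  This describes the index without reference to a chart, which allows the comparison
  of two hypersurfaces that coincide near \<open>x\<close>.\<close>

lemma index_along_ray:
  assumes \<alpha>: "alexander_numbering M f \<nu> c \<alpha>" and w: "\<And>p. p \<in> pre x \<Longrightarrow> w \<bullet> \<nu> p > 0"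
  shows "\<forall>\<^sub>F e in at_right 0. \<alpha> (x + e *\<^sub>R w) = index M f \<nu> \<alpha> x + card (pre x) / 2"
proof -
  obtain \<epsilon> N g where ch: "sheet_chart M f \<nu> x \<epsilon> N g" using charts by blast
  obtain a where a: "\<And>y. y \<in> ball x \<epsilon> \<Longrightarrow> y \<notin> f ` M \<Longrightarrow> \<alpha> y = a + (\<Sum>p\<in>pre x. of_bool (g p y > 0))"
    by (rule chart_count_unique[OF ch alexander_steady[OF \<alpha>] alexander_jump[OF \<alpha>]]) blast+
  have "\<forall>\<^sub>F e in at_right 0. \<forall>p\<in>pre x. g p (x + e *\<^sub>R w) > 0"
    by (intro eventually_ball_finite finite_pre ballI strict_derivative_ray_sign(1))
      (use ch in \<open>auto simp: sheet_chart_def intro: w\<close>)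
  moreover have "\<forall>\<^sub>F e in at_right 0. x + e *\<^sub>R w \<in> ball x \<epsilon>"
    by (rule eventually_ray_in_open) (use ch in \<open>auto simp: sheet_chart_def\<close>)
  moreover have "\<forall>\<^sub>F e in at_right 0. x + e *\<^sub>R w \<notin> f ` M"
    by (rule eventually_ray_off_image) (use w in force)
  ultimately show ?thesis
  proof eventually_elim
    case (elim e)
    have "(\<Sum>p\<in>pre x. of_bool (g p (x + e *\<^sub>R w) > 0) :: real) = (\<Sum>p\<in>pre x. 1)"
      using elim(1) by (intro sum.cong) auto
    then show ?case using a[OF elim(2,3)] index_eq[OF ch a] by simp
  qed
qed

text \<open>
  Points of maximal multiplicity are isolated, since their normals form a basis, and they lie in the
  compact set \<open>f ` M\<close>.  Without finiteness the sum in \<open>St\<close> would have the default value 0.\<close>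

lemma finite_multiple_points: "finite (multiple_points M f DIM('e))"
proof (rule ccontr)
  let ?T = "multiple_points M f DIM('e)"
  assume inf: "infinite ?T"
  have "x \<in> f ` M" if "x \<in> ?T" for x
    using that pre_empty_iff[of x] by (auto simp: multiple_points_def)
  moreover have "compact (f ` M)" using bounded_image closed_image by (simp add: compact_eq_bounded_closed)
  ultimately obtain x where x: "x islimpt ?T"
    using inf unfolding compact_eq_Bolzano_Weierstrass by (meson subsetI)
  obtain \<epsilon> N g where ch: "sheet_chart M f \<nu> x \<epsilon> N g" using charts by blast
  obtain W z where W: "open W" "x \<in> W" "W \<subseteq> ball x \<epsilon>"
    and iso: "\<And>y. y \<in> W \<Longrightarrow> span (\<nu> ` pre x) = UNIV \<Longrightarrow> \<forall>p\<in>pre x. g p y = 0 \<Longrightarrow> y = x"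
    by (rule chart_orthants[OF ch]) blast
  obtain y where y: "y \<in> ?T" "y \<in> W" "y \<noteq> x" using x W(1,2) by (meson islimptE)
  have c: "card {p \<in> pre x. g p y = 0} = DIM('e)"
    using chart_card_pre[OF ch, of y] y W(3) by (auto simp: multiple_points_def)
  have "card {p \<in> pre x. g p y = 0} \<le> card (pre x)" by (intro card_mono) auto
  then have cx: "card (pre x) = DIM('e)" using c card_pre_le[of x] by simp
  then have all: "{p \<in> pre x. g p y = 0} = pre x" using c by (intro card_subset_eq) auto
  have "independent (\<nu> ` pre x)" "card (\<nu> ` pre x) = DIM('e)"
    using general_pre[of x] cx by (auto simp: general_position_def card_image)
  then have "span (\<nu> ` pre x) = UNIV"
    using card_ge_dim_independent[of "\<nu> ` pre x" UNIV] by (auto simp: top.extremum_unique)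
  then show False using iso[OF y(2)] all y(3) by blast
qed

end

text \<open>
  Outside the ball both numberings jump in the same way, so their difference is constant there by
  the extension principle, the complement of a ball being connected.  The value at infinity is \<open>c\<close>
  for both.\<close>

lemma alexander_agree_outside:
  fixes f f' \<nu> \<nu>' :: "'m \<Rightarrow> 'e::euclidean_space"
  assumes g1: "generic_hypersurface M f \<nu>" and g2: "generic_hypersurface M f' \<nu>'"
    and \<alpha>: "alexander_numbering M f \<nu> c \<alpha>" and \<alpha>': "alexander_numbering M f' \<nu>' c \<alpha>'"
    and agree: "\<And>p. p \<in> M \<Longrightarrow> f p \<in> cball q r \<and> f' p \<in> cball q r \<or> f p = f' p \<and> \<nu> p = \<nu>' p"
    and x: "x \<notin> cball q r" "x \<notin> f ` M"
  shows "\<alpha> x = \<alpha>' x"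
proof -
  interpret S: generic_hypersurface M f \<nu> by fact
  interpret S': generic_hypersurface M f' \<nu>' by fact
  have im: "y \<in> f ` M \<longleftrightarrow> y \<in> f' ` M" if "y \<notin> cball q r" for y
  proof -
    have "f p = f' p" if "p \<in> M" "f p = y \<or> f' p = y" for p
      using agree[OF that(1)] that(2) \<open>y \<notin> cball q r\<close> by blast
    then show ?thesis unfolding image_iff by metis
  qed
  obtain d where d: "\<And>y. y \<in> - cball q r \<Longrightarrow> y \<notin> f ` M \<Longrightarrow> \<alpha> y - \<alpha>' y = d"
  proof (rule S.const_if_no_jump[of "- cball q r" "\<lambda>y. \<alpha> y - \<alpha>' y"])
    show "connected (- cball q r)"
      using S.dim_ge_2 by (intro connected_complement_bounded_convex) auto
    show "steady (f ` M) (\<lambda>y. \<alpha> y - \<alpha>' y) y" if "y \<in> - cball q r" "y \<notin> f ` M" for y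
      using that im by (intro steady_diff S.alexander_steady[OF \<alpha>] S'.alexander_steady[OF \<alpha>']) auto
    fix p assume p: "p \<in> M" "f p \<in> - cball q r" "preimages M f (f p) = {p}"
    have eq: "f' p = f p" "\<nu>' p = \<nu> p" using agree[OF p(1)] p(2) by auto
    have "preimages M f' (f' p) = {p}"
    proof -
      have "p' = p" if "p' \<in> M" "f' p' = f' p" for p'
      proof -
        have "f p' = f p" using agree[OF that(1)] that(2) eq p(2) by auto
        then show ?thesis using p(3) that(1) by (auto simp: preimages_def)
      qed
      then show ?thesis using p(1) by (auto simp: preimages_def)
    qed
    from S.alexander_jump[OF \<alpha> p(1,3)] S'.alexander_jump[OF \<alpha>' p(1) this]
    show "\<forall>\<^sub>F e in at_right 0. \<alpha> (f p + e *\<^sub>R \<nu> p) - \<alpha>' (f p + e *\<^sub>R \<nu> p)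
        = \<alpha> (f p - e *\<^sub>R \<nu> p) - \<alpha>' (f p - e *\<^sub>R \<nu> p)"
      unfolding eq by eventually_elim simp
  qed auto
  have "bounded (f ` M \<union> f' ` M \<union> cball q r)"
    using S.bounded_image S'.bounded_image by simp
  then obtain R where R: "f ` M \<union> f' ` M \<union> cball q r \<subseteq> ball 0 R"
    by (meson bounded_subset_ballD)
  have unb: "\<not> bounded (- ball (0::'e) R)" by (rule cobounded_imp_unbounded) simp
  then obtain y where y: "y \<in> - ball (0::'e) R" by (metis bounded_empty equals0I)
  have conn: "connected (- ball (0::'e) R)"
    using S.dim_ge_2 by (intro connected_complement_bounded_convex) auto
  have far: "\<not> bounded (connected_component_set (- h ` M) y)" if "h ` M \<subseteq> ball 0 R" for h :: "'m \<Rightarrow> 'e"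
  proof -
    have "- ball 0 R \<subseteq> connected_component_set (- h ` M) y"
      using that conn y by (intro connected_component_maximal) auto
    then show ?thesis using unb bounded_subset by blast
  qed
  have off: "y \<notin> f ` M" "y \<notin> f' ` M" "y \<in> - cball q r" using y R by blast+
  have "\<alpha> y = c" using \<alpha> far[of f] off R unfolding alexander_numbering_def by blast
  moreover have "\<alpha>' y = c" using \<alpha>' far[of f'] off R unfolding alexander_numbering_def by blast
  ultimately have "d = 0" using d[of y] off by simp
  then show ?thesis using d[of x] x by simp
qed

section \<open>Arrangements of sheets in a ball\<close>

locale sheet_arrangement = generic_hypersurface M f \<nu>
  for M :: "'m set" and f \<nu> :: "'m \<Rightarrow> 'e::euclidean_space" +
  fixes q :: 'e and r :: real and J :: "'j set" and U :: "'j \<Rightarrow> 'm set" and P :: "'j \<Rightarrow> 'e set"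
  assumes sheets: "sheets_in_ball M f \<nu> (ball q r) J U P"
    and finite_J [simp]: "finite J"
begin

abbreviation opp :: "'j \<Rightarrow> 'e set" where "opp j \<equiv> ball q r - f ` U j - P j"

abbreviation sheets_at :: "'e \<Rightarrow> 'j set" where "sheets_at x \<equiv> {j \<in> J. x \<in> f ` U j}"

lemma sources: "{p \<in> M. f p \<in> ball q r} = (\<Union>j\<in>J. U j)" and disjoint_U: "disjoint_family_on U J"
  using sheets by (auto simp: sheets_in_ball_def)

lemma
  assumes "j \<in> J"
  shows open_side: "open (P j)" and open_opp: "open (opp j)" and inj_U: "inj_on f (U j)"
    and side_sub: "P j \<subseteq> ball q r - f ` U j" and U_sub: "U j \<subseteq> M" and image_U_sub: "f ` U j \<subseteq> ball q r"
    and homeo_U: "\<exists>b\<in>Basis. f ` U j homeomorphic {x \<in> ball (0::'e) 1. x \<bullet> b = 0}"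
  using sheets assms unfolding sheets_in_ball_def by blast+

lemma ray_side:
  assumes "j \<in> J" "p \<in> U j"
  shows "\<forall>\<^sub>F e in at_right 0. f p + e *\<^sub>R \<nu> p \<in> P j \<and> f p - e *\<^sub>R \<nu> p \<in> opp j"
  using sheets assms unfolding sheets_in_ball_def by blast

lemma side_steady:
  assumes "j \<in> J" "y \<in> ball q r" "y \<notin> f ` U j"
  shows "steady I (\<lambda>y. of_bool (y \<in> P j)) y"
  by (rule steady_of_bool[OF open_side[OF assms(1)] open_opp[OF assms(1)]]) (use assms in auto)

lemma simple_point_sheet:
  assumes p: "p \<in> M" "f p \<in> ball q r" "pre (f p) = {p}"
  obtains i where "i \<in> J" "p \<in> U i" "sheets_at (f p) = {i}"
proof -
  obtain i where i: "i \<in> J" "p \<in> U i" using sources p by blast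
  have "j = i" if "j \<in> J" "f p \<in> f ` U j" for j
  proof -
    obtain p' where p': "p' \<in> U j" "f p = f p'" using \<open>f p \<in> f ` U j\<close> by (rule imageE)
    then have "p' \<in> pre (f p)" using U_sub[OF that(1)] by (auto simp: preimages_def)
    then have "p' = p" using p(3) by blast
    then show ?thesis using disjoint_U i p' that by (auto simp: disjoint_family_on_def)
  qed
  then show ?thesis using that[OF i] i by blast
qed

text \<open>
  A simple point lies on one sheet \<open>i\<close> only: the coorientation leads to its positive side,
  and the sides of the other sheets are open.  The sum may be restricted to any set \<open>K\<close> of sheets
  that contains \<open>i\<close>.\<close>

lemma side_count_jump:
  assumes p: "p \<in> M" "f p \<in> ball q r" "pre (f p) = {p}" and K: "sheets_at (f p) \<subseteq> K" "K \<subseteq> J"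
  shows "\<forall>\<^sub>F e in at_right 0. (\<Sum>j\<in>K. of_bool (f p + e *\<^sub>R \<nu> p \<in> P j) :: real)
    = (\<Sum>j\<in>K. of_bool (f p - e *\<^sub>R \<nu> p \<in> P j)) + 1"
proof -
  obtain i where i: "i \<in> J" "p \<in> U i" "sheets_at (f p) = {i}" by (rule simple_point_sheet[OF p])
  have iK: "i \<in> K" and fK: "finite K" using K i finite_subset[OF _ finite_J] by auto
  have "\<forall>\<^sub>F e in at_right 0. \<forall>j\<in>K - {i}.
      (of_bool (f p + e *\<^sub>R \<nu> p \<in> P j) :: real) = of_bool (f p - e *\<^sub>R \<nu> p \<in> P j)"
    using K i fK p(2) by (intro eventually_ball_finite ballI steady_no_jump side_steady) auto
  with ray_side[OF i(1,2)] show ?thesis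
  proof eventually_elim
    case (elim e)
    then have "(\<Sum>j\<in>K - {i}. of_bool (f p + e *\<^sub>R \<nu> p \<in> P j) :: real)
        = (\<Sum>j\<in>K - {i}. of_bool (f p - e *\<^sub>R \<nu> p \<in> P j))"
      by (intro sum.cong) auto
    then show ?case using elim
      unfolding sum.remove[OF fK iK, of "\<lambda>j. of_bool (_ \<in> P j) :: real"] by simp
  qed
qed

text \<open>
  Both the numbering and the number of positive sides increase by 1 across every simple point, so their difference
  extends to a constant on the ball.\<close>

lemma alexander_in_ball:
  assumes "alexander_numbering M f \<nu> c \<alpha>"
  obtains a where "\<And>y. y \<in> ball q r \<Longrightarrow> y \<notin> f ` M \<Longrightarrow> \<alpha> y = a + (\<Sum>j\<in>J. of_bool (y \<in> P j))"
proof -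
  let ?n = "\<lambda>y. (\<Sum>j\<in>J. of_bool (y \<in> P j) :: real)"
  obtain a where a: "\<And>y. y \<in> ball q r \<Longrightarrow> y \<notin> f ` M \<Longrightarrow> \<alpha> y - ?n y = a"
  proof (rule const_if_no_jump[OF open_ball connected_ball, of q r "\<lambda>y. \<alpha> y - ?n y"])
    fix y assume y: "y \<in> ball q r" "y \<notin> f ` M"
    then have "y \<notin> f ` U j" if "j \<in> J" for j using U_sub[OF that] by blast
    then show "steady (f ` M) (\<lambda>y. \<alpha> y - ?n y) y"
      using y by (intro steady_diff alexander_steady[OF assms] steady_sum side_steady) auto
  next
    fix p assume p: "p \<in> M" "f p \<in> ball q r" "pre (f p) = {p}"
    show "\<forall>\<^sub>F e in at_right 0. \<alpha> (f p + e *\<^sub>R \<nu> p) - ?n (f p + e *\<^sub>R \<nu> p) = \<alpha> (f p - e *\<^sub>R \<nu> p) - ?n (f p - e *\<^sub>R \<nu> p)"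
      using alexander_jump[OF assms p(1,3)] side_count_jump[OF p Collect_restrict order_refl]
      by eventually_elim simp
  qed blast
  show ?thesis by (rule that[of a]) (use a in force)
qed

lemma card_sheets_at:
  assumes "x \<in> ball q r" shows "card (sheets_at x) = card (pre x)"
proof -
  have "\<forall>p\<in>pre x. \<exists>j\<in>J. p \<in> U j" using sources assms by (auto simp: preimages_def)
  then obtain b where b: "\<And>p. p \<in> pre x \<Longrightarrow> b p \<in> J \<and> p \<in> U (b p)" by metis
  have fx: "f p = x" if "p \<in> pre x" for p using that by (simp add: preimages_def)
  have "inj_on b (pre x)"
    using b fx inj_U by (intro inj_onI) (metis inj_onD)
  moreover have "b ` pre x = sheets_at x"
  proof (intro equalityI subsetI)
    fix j assume "j \<in> b ` pre x"
    then show "j \<in> sheets_at x" using b fx by force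
  next
    fix j assume "j \<in> sheets_at x"
    then obtain p where p: "j \<in> J" "p \<in> U j" "f p = x" by blast
    then have px: "p \<in> pre x" using U_sub by (auto simp: preimages_def)
    have "b p = j" using disjoint_U b[OF px] p by (auto simp: disjoint_family_on_def)
    then show "j \<in> b ` pre x" using px by blast
  qed
  ultimately show ?thesis using card_image by metis
qed

text \<open>
  Near \<open>x\<close> the number of sheets through \<open>x\<close> with the given point on their positive side equals the number of positive
  functions \<open>g p\<close>.  The difference of the two numbers is a constant \<open>a\<close> since they jump alike.
  Both range between 0 and the multiplicity of \<open>x\<close>, and the second one attains both bounds, which forces
  \<open>a = 0\<close>.  The single sides \<open>P j\<close> need not be given by the signs of single functions, since sheets may
  exchange their halves along a double curve.\<close>

lemma local_sides:
  assumes x: "x \<in> ball q r"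
  obtains \<epsilon> N g where "sheet_chart M f \<nu> x \<epsilon> N g" "ball x \<epsilon> \<subseteq> ball q r"
    "\<And>j y. j \<in> J \<Longrightarrow> x \<notin> f ` U j \<Longrightarrow> y \<in> ball x \<epsilon> \<Longrightarrow> y \<in> P j \<longleftrightarrow> x \<in> P j"
    "\<And>y. y \<in> ball x \<epsilon> \<Longrightarrow> y \<notin> f ` M \<Longrightarrow>
      (\<Sum>j\<in>sheets_at x. of_bool (y \<in> P j) :: real) = (\<Sum>p\<in>pre x. of_bool (g p y > 0))"
proof -
  define S where "S = ball q r \<inter> (\<Inter>j\<in>J - sheets_at x. if x \<in> P j then P j else opp j)"
  have "open S" unfolding S_def using open_side open_opp
    by (intro open_Int open_INT finite_Diff) auto
  moreover have "x \<in> S" using x by (auto simp: S_def)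
  ultimately obtain \<epsilon> N g where ch: "sheet_chart M f \<nu> x \<epsilon> N g" and S: "ball x \<epsilon> \<subseteq> S"
    by (rule chart_within)
  have B: "ball x \<epsilon> \<subseteq> ball q r" using S by (auto simp: S_def)
  have other: "(y \<in> P j \<longleftrightarrow> x \<in> P j) \<and> y \<notin> f ` U j"
    if "j \<in> J" "x \<notin> f ` U j" "y \<in> ball x \<epsilon>" for j y
  proof -
    have "y \<in> S" "j \<in> J - sheets_at x" using S that by auto
    then have "y \<in> (if x \<in> P j then P j else opp j)" unfolding S_def by blast
    then show ?thesis using side_sub[OF that(1)] by (auto split: if_splits)
  qed
  let ?n = "\<lambda>y. (\<Sum>j\<in>sheets_at x. of_bool (y \<in> P j) :: real)"
  obtain a where a: "\<And>y. y \<in> ball x \<epsilon> \<Longrightarrow> y \<notin> f ` M \<Longrightarrow> ?n y = a + (\<Sum>p\<in>pre x. of_bool (g p y > 0))"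
  proof (rule chart_count_unique[OF ch, of ?n])
    fix y assume y: "y \<in> ball x \<epsilon>" "y \<notin> f ` M"
    then have "y \<notin> f ` U j" if "j \<in> J" for j using U_sub[OF that] by blast
    then show "steady (f ` M) ?n y"
      using y B by (intro steady_sum side_steady) auto
  next
    fix p assume p: "p \<in> M" "f p \<in> ball x \<epsilon>" "pre (f p) = {p}"
    then have pB: "f p \<in> ball q r" using B by blast
    show "\<forall>\<^sub>F e in at_right 0. ?n (f p + e *\<^sub>R \<nu> p) = ?n (f p - e *\<^sub>R \<nu> p) + 1"
      by (rule side_count_jump[OF p(1) pB p(3)]) (use other p in blast)+
  qed blast
  obtain W z where W: "W \<subseteq> ball x \<epsilon>"
    and zpos: "\<And>T p. T \<subseteq> pre x \<Longrightarrow> p \<in> T \<Longrightarrow> g p (z T) > 0"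
    and zneg: "\<And>T p. T \<subseteq> pre x \<Longrightarrow> p \<in> pre x - T \<Longrightarrow> g p (z T) < 0"
    and zW: "\<And>T. T \<subseteq> pre x \<Longrightarrow> z T \<in> W"
    by (rule chart_orthants[OF ch]) blast
  have z: "z T \<in> ball x \<epsilon>" "z T \<notin> f ` M" if "T \<subseteq> pre x" for T
  proof -
    show 1: "z T \<in> ball x \<epsilon>" using zW[OF that] W by blast
    have "g p (z T) \<noteq> 0" if p: "p \<in> pre x" for p
      using zpos[OF \<open>T \<subseteq> pre x\<close>, of p] zneg[OF \<open>T \<subseteq> pre x\<close>, of p] p by (cases "p \<in> T") auto
    then show "z T \<notin> f ` M" using chart_image_iff[OF ch 1] by blast
  qed
  have "(\<Sum>p\<in>pre x. of_bool (g p (z (pre x)) > 0) :: real) = (\<Sum>p\<in>pre x. 1)"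
    using zpos[of "pre x"] by (intro sum.cong) auto
  moreover have "?n (z (pre x)) \<le> (\<Sum>j\<in>sheets_at x. 1)" by (rule sum_mono) simp
  ultimately have "a \<le> 0" using a[OF z, of "pre x"] card_sheets_at[OF x] by simp
  moreover have "(\<Sum>p\<in>pre x. of_bool (g p (z {}) > 0) :: real) = 0"
    using zneg[of "{}"] by (intro sum.neutral) force
  then have "0 \<le> a" using a[OF z, of "{}"] sum_nonneg[of "sheets_at x" "\<lambda>j. of_bool (z {} \<in> P j) :: real"] by simp
  ultimately have "a = 0" by simp
  show ?thesis
    by (rule that[OF ch B]) (use other a \<open>a = 0\<close> in auto)
qed

text \<open>
  Near \<open>x\<close> the sheets that avoid \<open>x\<close> contribute a constant; those through \<open>x\<close> are counted
  by \<open>local_sides\<close> and contribute half their number on average.\<close>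

lemma index_in_ball:
  assumes a: "\<And>y. y \<in> ball q r \<Longrightarrow> y \<notin> f ` M \<Longrightarrow> \<alpha> y = a + (\<Sum>j\<in>J. of_bool (y \<in> P j))"
    and x: "x \<in> ball q r"
  shows "index M f \<nu> \<alpha> x = a + (\<Sum>j\<in>J - sheets_at x. of_bool (x \<in> P j)) + card (pre x) / 2"
proof -
  obtain \<epsilon> N g where ch: "sheet_chart M f \<nu> x \<epsilon> N g" and B: "ball x \<epsilon> \<subseteq> ball q r"
    and other: "\<And>j y. j \<in> J \<Longrightarrow> x \<notin> f ` U j \<Longrightarrow> y \<in> ball x \<epsilon> \<Longrightarrow> y \<in> P j \<longleftrightarrow> x \<in> P j"
    and n: "\<And>y. y \<in> ball x \<epsilon> \<Longrightarrow> y \<notin> f ` M \<Longrightarrow>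
      (\<Sum>j\<in>sheets_at x. of_bool (y \<in> P j) :: real) = (\<Sum>p\<in>pre x. of_bool (g p y > 0))"
    by (rule local_sides[OF x]) blast
  show ?thesis
  proof (rule index_eq[OF ch])
    fix y assume y: "y \<in> ball x \<epsilon>" "y \<notin> f ` M"
    have "(\<Sum>j\<in>J. of_bool (y \<in> P j) :: real)
        = (\<Sum>j\<in>J - sheets_at x. of_bool (y \<in> P j)) + (\<Sum>j\<in>sheets_at x. of_bool (y \<in> P j))"
      by (rule sum.subset_diff) auto
    also have "(\<Sum>j\<in>J - sheets_at x. of_bool (y \<in> P j) :: real) = (\<Sum>j\<in>J - sheets_at x. of_bool (x \<in> P j))"
      using other y(1) by (intro sum.cong) auto
    finally show "\<alpha> y = a + (\<Sum>j\<in>J - sheets_at x. of_bool (x \<in> P j)) + (\<Sum>p\<in>pre x. of_bool (g p y > 0))"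
      using a[of y] y B n[OF y] by auto
  qed
qed

text \<open>
  A sheet is closed in the ball.  If it stayed in a smaller closed ball, it would be compact, but it
  is homeomorphic to an open disc of positive dimension.\<close>

lemma sheet_leaves_smaller_ball:
  assumes "r' < r" "j \<in> J"
  obtains p where "p \<in> U j" "f p \<notin> cball q r'"
proof -
  have False if sub: "f ` U j \<subseteq> cball q r'"
  proof -
    have "cball q r' \<subseteq> ball q r" using assms(1) by auto
    then have eq: "f ` U j = cball q r' - (P j \<union> opp j)"
      using sub side_sub[OF assms(2)] by blast
    have "compact (cball q r' - (P j \<union> opp j))"
      by (intro compact_diff compact_cball open_Un open_side open_opp assms)
    then have "compact (f ` U j)" by (simp only: eq[symmetric])
    moreover obtain b where b: "b \<in> Basis" "f ` U j homeomorphic {x \<in> ball (0::'e) 1. x \<bullet> b = 0}"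
      using homeo_U[OF assms(2)] by blast
    ultimately have "compact {x \<in> ball (0::'e) 1. x \<bullet> b = 0}" using homeomorphic_compactness[OF b(2)] by simp
    then have cl: "closed {x \<in> ball (0::'e) 1. x \<bullet> b = 0}" by (rule compact_imp_closed)
    have "(Basis :: 'e set) \<noteq> {b}"
    proof
      assume "Basis = {b}"
      then have "DIM('e) = card {b}" by (rule arg_cong)
      then show False using dim_ge_2 by simp
    qed
    then obtain b' where b': "b' \<in> Basis" "b' \<noteq> b" using b(1) by blast
    have "(\<lambda>n. (1 - inverse (real (Suc n))) *\<^sub>R b') \<longlonglongrightarrow> (1 - 0) *\<^sub>R b'"
      by (intro tendsto_intros LIMSEQ_inverse_real_of_nat)
    moreover have "(1 - inverse (real (Suc n))) *\<^sub>R b' \<in> {x \<in> ball (0::'e) 1. x \<bullet> b = 0}" for n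
      using b b' by (simp add: inner_Basis field_simps)
    ultimately have "(1 - 0) *\<^sub>R b' \<in> {x \<in> ball (0::'e) 1. x \<bullet> b = 0}"
      using closed_sequentially[OF cl, of "\<lambda>n. (1 - inverse (real (Suc n))) *\<^sub>R b'"] by blast
    then show False using b'(1) by simp
  qed
  then show ?thesis using that by blast
qed

lemma
  assumes v: "sheets_bound_simplex f J U v" and J: "card J = DIM('e) + 1"
  shows multiple_points_in_ball: "multiple_points M f DIM('e) \<inter> ball q r = v ` J"
    and inj_vertices: "inj_on v J"
    and sheets_at_vertex: "\<And>l. l \<in> J \<Longrightarrow> sheets_at (v l) = J - {l}"
proof -
  have v1: "(\<Inter>j\<in>J - {l}. f ` U j) = {v l}" and v2: "v l \<notin> f ` U l" if "l \<in> J" for l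
    using v that by (auto simp: sheets_bound_simplex_def)
  show sa: "sheets_at (v l) = J - {l}" if "l \<in> J" for l
    using v1[OF that] v2[OF that] by blast
  show "inj_on v J"
  proof (rule inj_onI)
    fix l l' assume l: "l \<in> J" "l' \<in> J" "v l = v l'"
    then have "J - {l} = J - {l'}" using sa[OF l(1)] sa[OF l(2)] by simp
    then show "l = l'" using l(1) by blast
  qed
  have vB: "v l \<in> ball q r" if l: "l \<in> J" for l
  proof -
    have "card (J - {l}) > 0" using J l by (simp add: card_Diff_singleton)
    then obtain j where "j \<in> J - {l}" by (metis card_gt_0_iff ex_in_conv)
    then show ?thesis using v1[OF l] image_U_sub by blast
  qed
  show "multiple_points M f DIM('e) \<inter> ball q r = v ` J"
  proof (intro equalityI subsetI)
    fix x assume x: "x \<in> multiple_points M f DIM('e) \<inter> ball q r"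
    then have c: "card (sheets_at x) = DIM('e)" using card_sheets_at by (simp add: multiple_points_def)
    then have "card (J - sheets_at x) = 1" using J by (subst card_Diff_subset) auto
    then obtain l where l: "J - sheets_at x = {l}" by (auto simp: card_1_singleton_iff)
    then have "l \<in> J" "x \<in> (\<Inter>j\<in>J - {l}. f ` U j)" by auto
    then show "x \<in> v ` J" using v1[of l] by auto
  next
    fix x assume "x \<in> v ` J"
    then obtain l where l: "l \<in> J" "x = v l" by blast
    have "card (pre x) = card (J - {l})" using card_sheets_at[OF vB[OF l(1)]] sa[OF l(1)] l(2) by simp
    then show "x \<in> multiple_points M f DIM('e) \<inter> ball q r"
      using vB[OF l(1)] l J by (simp add: multiple_points_def)
  qed
qed

lemma sum_index_vertices:
  assumes v: "sheets_bound_simplex f J U v" and J: "card J = DIM('e) + 1"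
    and a: "\<And>y. y \<in> ball q r \<Longrightarrow> y \<notin> f ` M \<Longrightarrow> \<alpha> y = a + (\<Sum>j\<in>J. of_bool (y \<in> P j))"
  shows "(\<Sum>x\<in>multiple_points M f DIM('e) \<inter> ball q r. index M f \<nu> \<alpha> x)
    = card J * (a + DIM('e) / 2) + card {l \<in> J. v l \<in> P l}"
proof -
  note mp = multiple_points_in_ball[OF v J]
  have "index M f \<nu> \<alpha> (v l) = (a + DIM('e) / 2) + of_bool (v l \<in> P l)" if l: "l \<in> J" for l
  proof -
    have x: "v l \<in> multiple_points M f DIM('e) \<inter> ball q r" using mp l by blast
    moreover have "J - sheets_at (v l) = {l}" using sheets_at_vertex[OF v J l] l by auto
    ultimately show ?thesis using index_in_ball[OF a, of "v l"] by (simp add: multiple_points_def)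
  qed
  then have "(\<Sum>l\<in>J. index M f \<nu> \<alpha> (v l)) = (\<Sum>l\<in>J. (a + DIM('e) / 2) + of_bool (v l \<in> P l))"
    by (rule sum.cong[OF refl])
  also have "\<dots> = card J * (a + DIM('e) / 2) + card {l \<in> J. v l \<in> P l}"
    by (simp add: sum.distrib Int_def)
  finally show ?thesis by (simp add: mp sum.reindex[OF inj_vertices[OF v J]])
qed

end

text \<open>
  The index is read off from the numbering along a ray, and there the two numberings agree.\<close>

lemma indices_agree_outside:
  fixes f f' \<nu> \<nu>' :: "'m \<Rightarrow> 'e::euclidean_space"
  assumes g1: "generic_hypersurface M f \<nu>" and g2: "generic_hypersurface M f' \<nu>'"
    and \<alpha>: "alexander_numbering M f \<nu> c \<alpha>" and \<alpha>': "alexander_numbering M f' \<nu>' c \<alpha>'"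
    and agree: "\<And>p. p \<in> M \<Longrightarrow> f p \<in> cball q r \<and> f' p \<in> cball q r \<or> f p = f' p \<and> \<nu> p = \<nu>' p"
    and x: "x \<notin> cball q r"
  shows "preimages M f x = preimages M f' x" "index M f \<nu> \<alpha> x = index M f' \<nu>' \<alpha>' x"
proof -
  interpret S: generic_hypersurface M f \<nu> by fact
  interpret S': generic_hypersurface M f' \<nu>' by fact
  show pre: "preimages M f x = preimages M f' x"
  proof -
    have "f p = f' p" if "p \<in> M" "f p = x \<or> f' p = x" for p
      using agree[OF that(1)] that(2) x by blast
    then show ?thesis unfolding preimages_def by (intro Collect_cong) metis
  qed
  have nu: "\<nu>' p = \<nu> p" if "p \<in> preimages M f x" for p
    using agree[of p] that x by (auto simp: preimages_def)
  obtain w where w: "\<And>p. p \<in> preimages M f x \<Longrightarrow> w \<bullet> \<nu> p = 1"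
    by (rule S.direction_exists[of x "\<lambda>_. 1"]) blast
  have "\<forall>\<^sub>F e in at_right 0. \<alpha> (x + e *\<^sub>R w) = index M f \<nu> \<alpha> x + card (preimages M f x) / 2"
    by (rule S.index_along_ray[OF \<alpha>]) (simp add: w)
  moreover have "\<forall>\<^sub>F e in at_right 0. \<alpha>' (x + e *\<^sub>R w) = index M f' \<nu>' \<alpha>' x + card (preimages M f' x) / 2"
    by (rule S'.index_along_ray[OF \<alpha>']) (use w nu pre in simp)
  moreover have "\<forall>\<^sub>F e in at_right 0. x + e *\<^sub>R w \<notin> f ` M"
    by (rule S.eventually_ray_off_image) (simp add: w)
  moreover have "\<forall>\<^sub>F e in at_right 0. x + e *\<^sub>R w \<in> - cball q r"
    by (rule eventually_ray_in_open) (use x in auto)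
  ultimately have "\<forall>\<^sub>F e in at_right (0::real). index M f \<nu> \<alpha> x = index M f' \<nu>' \<alpha>' x"
  proof eventually_elim
    case (elim e)
    have "\<alpha> (x + e *\<^sub>R w) = \<alpha>' (x + e *\<^sub>R w)"
      by (rule alexander_agree_outside[OF g1 g2 \<alpha> \<alpha>' agree]) (use elim in blast)+
    then show ?case using elim pre by simp
  qed
  then show "index M f \<nu> \<alpha> x = index M f' \<nu>' \<alpha>' x"
    using eventually_happens'[OF trivial_limit_at_right_real] by blast
qed

text \<open>
  The constants \<open>a\<close> and \<open>a'\<close> of the two arrangements agree because they can be compared at a point
  of the shell between the two balls, where the numberings agree and the sides of each sheet are the same before and
  after.  The latter holds because a sheet reaches the shell: there it is the same sheet with the same
  coorientation, so that the sides cannot be interchanged.\<close>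

lemma St_simplex_inversion:
  fixes f f' \<nu> \<nu>' :: "'m \<Rightarrow> 'e::euclidean_space"
  assumes A1: "sheet_arrangement M f \<nu> q r J U P" and A2: "sheet_arrangement M f' \<nu>' q r J U P'"
    and \<alpha>: "alexander_numbering M f \<nu> c \<alpha>" and \<alpha>': "alexander_numbering M f' \<nu>' c \<alpha>'"
    and r': "r' < r"
    and agree: "\<And>p. p \<in> M \<Longrightarrow> f p \<in> cball q r' \<and> f' p \<in> cball q r' \<or> f p = f' p \<and> \<nu> p = \<nu>' p"
    and v: "sheets_bound_simplex f J U v" and v': "sheets_bound_simplex f' J U v'"
    and inv: "inverted_simplices J P v P' v'" and J: "card J = DIM('e) + 1"
  shows "St DIM('e) M f' \<nu>' \<alpha>' - St DIM('e) M f \<nu> \<alpha> = real (card J) - 2 * card {l \<in> J. v l \<in> P l}"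
proof -
  interpret A: sheet_arrangement M f \<nu> q r J U P by fact
  interpret A': sheet_arrangement M f' \<nu>' q r J U P' by fact
  have g1: "generic_hypersurface M f \<nu>" and g2: "generic_hypersurface M f' \<nu>'" by unfold_locales
  let ?k = "DIM('e)" and ?B = "ball q r" and ?C = "cball q r'"
  define T where "T = multiple_points M f ?k"
  define T' where "T' = multiple_points M f' ?k"
  note out = indices_agree_outside[OF g1 g2 \<alpha> \<alpha>' agree]
  have CB: "?C \<subseteq> ?B" using r' by auto
  have TB: "T - ?B = T' - ?B"
    using out(1) CB unfolding T_def T'_def multiple_points_def by fastforce
  have fT: "finite T" "finite T'"
    unfolding T_def T'_def by (rule A.finite_multiple_points A'.finite_multiple_points)+
  have far: "(\<Sum>x\<in>T - ?B. index M f \<nu> \<alpha> x) = (\<Sum>x\<in>T' - ?B. index M f' \<nu>' \<alpha>' x)"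
    unfolding TB[symmetric] by (intro sum.cong refl out(2)) (use r' in auto)
  obtain a where a: "\<And>y. y \<in> ?B \<Longrightarrow> y \<notin> f ` M \<Longrightarrow> \<alpha> y = a + (\<Sum>j\<in>J. of_bool (y \<in> P j))"
    by (rule A.alexander_in_ball[OF \<alpha>]) blast
  obtain a' where a': "\<And>y. y \<in> ?B \<Longrightarrow> y \<notin> f' ` M \<Longrightarrow> \<alpha>' y = a' + (\<Sum>j\<in>J. of_bool (y \<in> P' j))"
    by (rule A'.alexander_in_ball[OF \<alpha>']) blast
  define Sh where "Sh = ?B - ?C"
  have oSh: "open Sh" unfolding Sh_def by (intro open_Diff) auto
  have "Sh = {x. r' < norm (x - q) \<and> norm (x - q) < r}"
    by (auto simp: Sh_def dist_norm norm_minus_commute)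
  then have cSh: "connected Sh" using A.dim_ge_2 by (simp add: connected_annulus)
  have same: "f' p = f p" "\<nu>' p = \<nu> p" if "p \<in> M" "f p \<in> Sh \<or> f' p \<in> Sh" for p
    using agree[OF that(1)] that(2) by (auto simp: Sh_def)
  have imSh: "y \<in> f ` U j \<longleftrightarrow> y \<in> f' ` U j" if "y \<in> Sh" "j \<in> J" for y j
  proof -
    have "f p = f' p" if "p \<in> U j" "f p = y \<or> f' p = y" for p
    proof -
      have "p \<in> M" using A.U_sub[OF \<open>j \<in> J\<close>] that(1) by (rule subsetD)
      moreover have "f p \<in> Sh \<or> f' p \<in> Sh" using that(2) \<open>y \<in> Sh\<close> by auto
      ultimately show ?thesis by (rule same(1)[symmetric])
    qed
    then show ?thesis unfolding image_iff by metis
  qed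
  have sides: "y \<in> P j \<longleftrightarrow> y \<in> P' j" if j: "j \<in> J" and y: "y \<in> Sh" "y \<notin> f ` M" for j y
  proof -
    let ?d = "\<lambda>y. of_bool (y \<in> P j) - of_bool (y \<in> P' j) :: real"
    have st: "steady I ?d y" if "y \<in> Sh" "y \<notin> f ` U j" for y I
      using that imSh[OF that(1) j]
      by (intro steady_diff A.side_steady[OF j] A'.side_steady[OF j]) (auto simp: Sh_def)
    obtain d where d: "\<And>y. y \<in> Sh \<Longrightarrow> y \<notin> f ` M \<Longrightarrow> ?d y = d"
    proof (rule A.const_if_no_jump[OF oSh cSh, of ?d])
      show "steady (f ` M) ?d y" if "y \<in> Sh" "y \<notin> f ` M" for y
        by (rule st) (use that A.U_sub[OF j] in auto)
      fix p assume p: "p \<in> M" "f p \<in> Sh" "preimages M f (f p) = {p}"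
      show "\<forall>\<^sub>F e in at_right 0. ?d (f p + e *\<^sub>R \<nu> p) = ?d (f p - e *\<^sub>R \<nu> p)"
      proof (cases "p \<in> U j")
        case True
        have eq: "f' p = f p" "\<nu>' p = \<nu> p" using same p by auto
        from A.ray_side[OF j True] A'.ray_side[OF j True] show ?thesis
          unfolding eq by eventually_elim simp
      next
        case False
        have "f p \<notin> f ` U j"
        proof
          assume "f p \<in> f ` U j"
          then obtain p' where p': "p' \<in> U j" "f p = f p'" by (rule imageE)
          then have "p' \<in> preimages M f (f p)" using A.U_sub[OF j] by (auto simp: preimages_def)
          then show False using p(3) p'(1) False by auto
        qed
        then show ?thesis using p(2) by (intro steady_no_jump st)
      qed
    qed blast
    obtain p where p: "p \<in> U j" "f p \<notin> ?C" by (rule A.sheet_leaves_smaller_ball[OF r' j])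
    have pM: "p \<in> M" and pSh: "f p \<in> Sh"
      using p A.U_sub[OF j] A.image_U_sub[OF j] by (auto simp: Sh_def)
    have eq: "f' p = f p" "\<nu>' p = \<nu> p" using same pM pSh by auto
    have "\<forall>\<^sub>F e in at_right 0. f p + e *\<^sub>R \<nu> p \<in> Sh \<inter> P j \<inter> P' j"
      using A.ray_side[OF j p(1)] A'.ray_side[OF j p(1)] eventually_ray_in_open[OF oSh pSh, of "\<nu> p"]
      unfolding eq by eventually_elim simp
    then obtain e where "f p + e *\<^sub>R \<nu> p \<in> Sh \<inter> P j \<inter> P' j"
      using eventually_happens'[OF trivial_limit_at_right_real] by blast
    moreover have "open (Sh \<inter> P j \<inter> P' j)" by (intro open_Int oSh A.open_side[OF j] A'.open_side[OF j])
    ultimately obtain u where "u \<in> Sh \<inter> P j \<inter> P' j" "u \<notin> f ` M" using A.image_nowhere_dense by blast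
    then have "d = 0" using d[of u] by simp
    then show ?thesis using d[OF y] by (auto simp: of_bool_def split: if_splits)
  qed
  have "\<exists>j. j \<in> J" using J by (metis card.empty ex_in_conv add_is_0 one_neq_zero)
  then obtain j p where "j \<in> J" "p \<in> U j" "f p \<notin> ?C" using A.sheet_leaves_smaller_ball[OF r'] by metis
  then have "f p \<in> Sh" using A.image_U_sub[of j] by (auto simp: Sh_def)
  then obtain y where y: "y \<in> Sh" "y \<notin> f ` M" using A.image_nowhere_dense[OF oSh] by blast
  have "y \<notin> f' ` M"
  proof
    assume "y \<in> f' ` M"
    then obtain p where p: "p \<in> M" "f' p = y" by blast
    then have "f p = y" using same(1)[of p] y(1) by simp
    then show False using p(1) y(2) by blast
  qed
  moreover have "\<alpha> y = \<alpha>' y" by (rule alexander_agree_outside[OF g1 g2 \<alpha> \<alpha>' agree]) (use y in \<open>auto simp: Sh_def\<close>)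
  moreover have "(\<Sum>j\<in>J. of_bool (y \<in> P j) :: real) = (\<Sum>j\<in>J. of_bool (y \<in> P' j))"
    using sides y by (intro sum.cong) auto
  ultimately have aa: "a' = a" using a[of y] a'[of y] y by (simp add: Sh_def)
  have "{l \<in> J. v' l \<in> P' l} = J - {l \<in> J. v l \<in> P l}"
    using inv by (auto simp: inverted_simplices_def)
  then have cc: "real (card {l \<in> J. v' l \<in> P' l}) = card J - real (card {l \<in> J. v l \<in> P l})"
    by (simp add: card_Diff_subset of_nat_diff card_mono)
  have "St ?k M f \<nu> \<alpha> = (\<Sum>x\<in>T \<inter> ?B. index M f \<nu> \<alpha> x) + (\<Sum>x\<in>T - ?B. index M f \<nu> \<alpha> x)"
    unfolding St_def T_def[symmetric] by (rule sum.Int_Diff[OF fT(1)])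
  moreover have "St ?k M f' \<nu>' \<alpha>' = (\<Sum>x\<in>T' \<inter> ?B. index M f' \<nu>' \<alpha>' x) + (\<Sum>x\<in>T' - ?B. index M f' \<nu>' \<alpha>' x)"
    unfolding St_def T'_def[symmetric] by (rule sum.Int_Diff[OF fT(2)])
  ultimately show ?thesis
    using far cc A.sum_index_vertices[OF v J a] A'.sum_index_vertices[OF v' J a'] aa
    by (simp add: T_def T'_def)
qed

section \<open>Closed surfaces and closed curves as immersed hypersurfaces\<close>

lemma finite_positive_lower_bound:
  fixes e :: "'m \<Rightarrow> real"
  assumes "finite Q" "\<And>p. p \<in> Q \<Longrightarrow> 0 < e p"
  obtains \<epsilon> where "0 < \<epsilon>" "\<And>p. p \<in> Q \<Longrightarrow> \<epsilon> \<le> e p"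
proof (rule that[of "Min (insert 1 (e ` Q))"])
  show "0 < Min (insert 1 (e ` Q))" using assms by auto
  show "Min (insert 1 (e ` Q)) \<le> e p" if "p \<in> Q" for p using assms(1) that by simp
qed

text \<open>
  Parametrizations \<open>\<theta> p\<close> of the source near the preimages of \<open>x\<close> yield a chart.  The assumption on
  \<open>W'\<close> is properness: points whose image is close to \<open>x\<close> are close to a preimage of \<open>x\<close>.  The pieces
  \<open>N p\<close> are so small that their normals are close to \<open>\<nu> p\<close>; this makes them disjoint, because the normals at
  the preimages are distinct, and it gives the signs of \<open>g p\<close> along the coorientation.\<close>

lemma sheet_chart_exists:
  fixes f \<nu> :: "'m \<Rightarrow> 'e::euclidean_space" and \<theta> :: "'m \<Rightarrow> 'u::euclidean_space \<Rightarrow> 'm"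
  assumes Q: "finite (preimages M f x)" "inj_on \<nu> (preimages M f x)"
    and dim: "DIM('e) = DIM('u) + 1"
    and par: "\<And>p. p \<in> preimages M f x \<Longrightarrow> open (W p) \<and> u p \<in> W p \<and> \<theta> p (u p) = p \<and> \<theta> p ` W p \<subseteq> M"
    and strict: "\<And>p. p \<in> preimages M f x \<Longrightarrow> strict_derivative_at (f \<circ> \<theta> p) (D p) (u p) \<and> inj (D p)"
    and normal: "\<And>p. p \<in> preimages M f x \<Longrightarrow> norm (\<nu> p) = 1 \<and> (\<forall>w. D p w \<bullet> \<nu> p = 0) \<and> isCont (\<nu> \<circ> \<theta> p) (u p)"
    and proper: "\<And>W'. (\<And>p. p \<in> preimages M f x \<Longrightarrow> open (W' p) \<and> u p \<in> W' p \<and> W' p \<subseteq> W p) \<Longrightarrow>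
       \<exists>\<epsilon>>0. \<forall>p'\<in>M. f p' \<in> ball x \<epsilon> \<longrightarrow> (\<exists>p\<in>preimages M f x. p' \<in> \<theta> p ` W' p)"
  shows "\<exists>\<epsilon> N g. sheet_chart M f \<nu> x \<epsilon> N g"
proof -
  let ?Q = "preimages M f x"
  have fx: "f p = x" if "p \<in> ?Q" for p using that by (simp add: preimages_def)
  obtain \<eta> where eta: "0 < \<eta>" "\<eta> \<le> 1" "\<And>p p'. p \<in> ?Q \<Longrightarrow> p' \<in> ?Q \<Longrightarrow> p \<noteq> p' \<Longrightarrow> \<eta> \<le> dist (\<nu> p) (\<nu> p')"
  proof -
    obtain \<epsilon> where e: "0 < \<epsilon>"
      "\<And>c. c \<in> {c \<in> ?Q \<times> ?Q. fst c \<noteq> snd c} \<Longrightarrow> \<epsilon> \<le> dist (\<nu> (fst c)) (\<nu> (snd c))"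
      by (rule finite_positive_lower_bound[of "{c \<in> ?Q \<times> ?Q. fst c \<noteq> snd c}" "\<lambda>c. dist (\<nu> (fst c)) (\<nu> (snd c))"])
        (use Q in \<open>auto simp: inj_on_eq_iff\<close>)
    have "min \<epsilon> 1 \<le> dist (\<nu> p) (\<nu> p')" if "p \<in> ?Q" "p' \<in> ?Q" "p \<noteq> p'" for p p'
      using e(2)[of "(p, p')"] that by simp
    then show ?thesis by (intro that[of "min \<epsilon> 1"]) (use e(1) in simp_all)
  qed
  define sheet where "sheet p N' \<epsilon> g \<longleftrightarrow> open N' \<and> u p \<in> N' \<and> N' \<subseteq> W p \<and> inj_on (f \<circ> \<theta> p) N' \<and> 0 < \<epsilon> \<and>
      strict_derivative_at g (\<lambda>w. w \<bullet> \<nu> p) x \<and> g x = 0 \<and> (\<forall>y\<in>ball x \<epsilon>. g y = 0 \<longleftrightarrow> y \<in> (f \<circ> \<theta> p) ` N') \<and>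
      (\<forall>w\<in>N'. dist (\<nu> (\<theta> p w)) (\<nu> p) < \<eta> / 2) \<and> continuous_on (ball x \<epsilon>) g \<and>
      (\<forall>y\<in>ball x \<epsilon>. \<forall>z\<in>ball x \<epsilon>. norm (g y - g z - (y - z) \<bullet> \<nu> p) \<le> 1 / 4 * norm (y - z))"
    for p N' \<epsilon> g
  have "\<exists>N' \<epsilon> g. sheet p N' \<epsilon> g"
    if p: "p \<in> ?Q" for p
  proof -
    have x: "(f \<circ> \<theta> p) (u p) = x" using par[OF p] fx[OF p] by simp
    have half: "0 < \<eta> / 2" using eta(1) by simp
    obtain d where d: "0 < d" "\<And>w. dist w (u p) < d \<Longrightarrow> dist (\<nu> (\<theta> p w)) (\<nu> p) < \<eta> / 2"
    proof -
      have c: "isCont (\<nu> \<circ> \<theta> p) (u p)" and e: "(\<nu> \<circ> \<theta> p) (u p) = \<nu> p"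
        using normal[OF p] par[OF p] by auto
      obtain d where "0 < d" "\<forall>w. dist w (u p) < d \<longrightarrow> dist ((\<nu> \<circ> \<theta> p) w) ((\<nu> \<circ> \<theta> p) (u p)) < \<eta> / 2"
        using c half unfolding continuous_at_eps_delta by blast
      then show ?thesis unfolding e by (intro that[of d]) simp_all
    qed
    define V where "V = W p \<inter> ball (u p) d"
    have V: "open V" "u p \<in> V" using par[OF p] d(1) by (auto simp: V_def)
    obtain N' \<epsilon> g where N': "open N'" "u p \<in> N'" "N' \<subseteq> V" "inj_on (f \<circ> \<theta> p) N'" "0 < \<epsilon>"
      "strict_derivative_at g (\<lambda>w. w \<bullet> \<nu> p) x" "g x = 0"
      "\<And>y. y \<in> ball x \<epsilon> \<Longrightarrow> g y = 0 \<longleftrightarrow> y \<in> (f \<circ> \<theta> p) ` N'"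
      by (rule sheet_defining_function[of "f \<circ> \<theta> p" "D p" "u p" "\<nu> p" V])
        (use strict[OF p] normal[OF p] dim V x in auto)
    obtain \<epsilon>1 where e1: "0 < \<epsilon>1" "\<epsilon>1 \<le> \<epsilon>" "continuous_on (ball x \<epsilon>1) g"
      by (rule strict_derivative_at_continuous_on[OF N'(6,5)])
    have q: "0 < (1/4::real)" by simp
    obtain \<epsilon>2 where e2: "0 < \<epsilon>2" "\<epsilon>2 \<le> \<epsilon>1"
      "\<And>y z. y \<in> ball x \<epsilon>2 \<Longrightarrow> z \<in> ball x \<epsilon>2 \<Longrightarrow> norm (g y - g z - (y - z) \<bullet> \<nu> p) \<le> 1 / 4 * norm (y - z)"
      by (rule strict_derivative_atE[OF N'(6) q e1(1)]) blast
    have b1: "ball x \<epsilon>2 \<subseteq> ball x \<epsilon>1" and b: "ball x \<epsilon>2 \<subseteq> ball x \<epsilon>" using e1(2) e2(2) by auto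
    show ?thesis
      unfolding sheet_def
    proof (intro exI[of _ N'] exI[of _ \<epsilon>2] exI[of _ g] conjI)
      show "N' \<subseteq> W p" using N'(3) by (auto simp: V_def)
      show "\<forall>w\<in>N'. dist (\<nu> (\<theta> p w)) (\<nu> p) < \<eta> / 2" proof
        fix w assume "w \<in> N'"
        then have "dist w (u p) < d" using N'(3) by (auto simp: V_def dist_commute)
        then show "dist (\<nu> (\<theta> p w)) (\<nu> p) < \<eta> / 2" by (rule d(2))
      qed
      show "continuous_on (ball x \<epsilon>2) g" by (rule continuous_on_subset[OF e1(3) b1])
      show "\<forall>y\<in>ball x \<epsilon>2. g y = 0 \<longleftrightarrow> y \<in> (f \<circ> \<theta> p) ` N'" by (intro ballI N'(8) subsetD[OF b])
      show "\<forall>y\<in>ball x \<epsilon>2. \<forall>z\<in>ball x \<epsilon>2. norm (g y - g z - (y - z) \<bullet> \<nu> p) \<le> 1 / 4 * norm (y - z)"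
        by (intro ballI e2(3))
    qed (rule N'(1,2,4,6,7) e2(1))+
  qed
  then obtain N' e g where sheet: "\<And>p. p \<in> ?Q \<Longrightarrow> sheet p (N' p) (e p) (g p)" by metis
  have N': "open (N' p)" "u p \<in> N' p" "N' p \<subseteq> W p" "inj_on (f \<circ> \<theta> p) (N' p)" "0 < e p"
      "strict_derivative_at (g p) (\<lambda>w. w \<bullet> \<nu> p) x" "g p x = 0"
    and gz: "\<And>y. y \<in> ball x (e p) \<Longrightarrow> g p y = 0 \<longleftrightarrow> y \<in> (f \<circ> \<theta> p) ` N' p"
    and near: "\<And>w. w \<in> N' p \<Longrightarrow> dist (\<nu> (\<theta> p w)) (\<nu> p) < \<eta> / 2"
    and cont: "continuous_on (ball x (e p)) (g p)"
    and lip: "\<And>y z. y \<in> ball x (e p) \<Longrightarrow> z \<in> ball x (e p) \<Longrightarrow> norm (g p y - g p z - (y - z) \<bullet> \<nu> p) \<le> 1 / 4 * norm (y - z)"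
    if "p \<in> ?Q" for p using sheet[OF that] unfolding sheet_def by blast+
  obtain \<epsilon>0 where e0: "0 < \<epsilon>0" "\<forall>p'\<in>M. f p' \<in> ball x \<epsilon>0 \<longrightarrow> (\<exists>p\<in>?Q. p' \<in> \<theta> p ` N' p)"
    using proper[of N'] N'(1-3) by blast
  obtain \<epsilon>1 where e1: "0 < \<epsilon>1" "\<And>p. p \<in> ?Q \<Longrightarrow> \<epsilon>1 \<le> e p"
    by (rule finite_positive_lower_bound[OF Q(1), of e]) (use N'(5) in blast)+
  define \<epsilon> where "\<epsilon> = min \<epsilon>0 \<epsilon>1"
  have e: "0 < \<epsilon>" "ball x \<epsilon> \<subseteq> ball x \<epsilon>0" using e0 e1 by (auto simp: \<epsilon>_def)
  have be: "ball x \<epsilon> \<subseteq> ball x (e p)" if "p \<in> ?Q" for p using e1(2)[OF that] by (auto simp: \<epsilon>_def)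
  define N where "N p = \<theta> p ` N' p" for p
  have nearN: "dist (\<nu> p') (\<nu> p) < \<eta> / 2" if "p \<in> ?Q" "p' \<in> N p" for p p'
    using near[OF that(1)] that(2) by (auto simp: N_def)
  have "sheet_chart M f \<nu> x \<epsilon> N g"
    unfolding sheet_chart_def
  proof (intro conjI ballI impI)
    show "0 < \<epsilon>" by fact
    show "disjoint_family_on N ?Q"
      unfolding disjoint_family_on_def
    proof (intro ballI impI, rule ccontr)
      fix p q assume pq: "p \<in> ?Q" "q \<in> ?Q" "p \<noteq> q" "N p \<inter> N q \<noteq> {}"
      then obtain p' where "p' \<in> N p" "p' \<in> N q" by blast
      then have "dist (\<nu> p') (\<nu> p) < \<eta> / 2" "dist (\<nu> p') (\<nu> q) < \<eta> / 2" using nearN pq by auto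
      then have "dist (\<nu> p) (\<nu> q) < \<eta>" by (rule dist_triangle_half_r)
      then show False using eta(3)[OF pq(1-3)] by simp
    qed
    fix p assume p: "p \<in> ?Q"
    show "strict_derivative_at (g p) (\<lambda>w. w \<bullet> \<nu> p) x" "g p x = 0" using N' p by auto
    show "continuous_on (ball x \<epsilon>) (g p)" by (rule continuous_on_subset[OF cont[OF p] be[OF p]])
    show "N p \<subseteq> M" using par[OF p] N'(3)[OF p] by (auto simp: N_def)
    show "inj_on f (N p)" unfolding N_def using N'(4)[OF p] by (rule inj_on_imageI)
    show "g p y = 0 \<longleftrightarrow> y \<in> f ` N p" if "y \<in> ball x \<epsilon>" for y
      using gz[OF p, of y] be[OF p] that by (auto simp: N_def image_comp)
    fix p' assume p': "p' \<in> N p" "f p' \<in> ball x \<epsilon>"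
    define n n' where "n = \<nu> p" and "n' = \<nu> p'"
    have n1: "norm n = 1" using normal[OF p] by (simp add: n_def)
    have dn: "norm (n' - n) < 1 / 2"
      using nearN[OF p p'(1)] eta(2) by (simp add: n_def n'_def dist_norm)
    have "\<bar>(n' - n) \<bullet> n\<bar> \<le> norm (n' - n) * norm n" by (rule Cauchy_Schwarz_ineq2)
    then have nn: "n' \<bullet> n > 1 / 2" using dn n1 by (simp add: inner_diff_left norm_eq_1)
    have n': "norm n' < 3 / 2" using dn n1 norm_triangle_ineq2[of n' n] by linarith
    have g0: "g p (f p') = 0" using p' gz[OF p, of "f p'"] be[OF p] by (auto simp: N_def)
    have est: "\<bar>g p (f p' + a *\<^sub>R n') - a * (n' \<bullet> n)\<bar> \<le> 1 / 4 * (\<bar>a\<bar> * norm n')"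
      if "f p' + a *\<^sub>R n' \<in> ball x \<epsilon>" for a
    proof -
      have "norm (g p (f p' + a *\<^sub>R n') - g p (f p') - (f p' + a *\<^sub>R n' - f p') \<bullet> n)
          \<le> 1 / 4 * norm (f p' + a *\<^sub>R n' - f p')"
        unfolding n_def using lip[OF p] be[OF p] that p'(2) by blast
      then show ?thesis using g0 by simp
    qed
    have "\<forall>\<^sub>F a in at_right 0. f p' + a *\<^sub>R n' \<in> ball x \<epsilon>" "\<forall>\<^sub>F a in at_right 0. f p' - a *\<^sub>R n' \<in> ball x \<epsilon>"
      using p'(2) by (auto intro!: eventually_ray_in_open eventually_ray_in_open' simp del: mem_ball)
    moreover have "\<forall>\<^sub>F a::real in at_right 0. a > 0" by (simp add: eventually_at_right_less)
    ultimately show "\<forall>\<^sub>F a in at_right 0. g p (f p' + a *\<^sub>R \<nu> p') > 0 \<and> g p (f p' - a *\<^sub>R \<nu> p') < 0"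
    proof eventually_elim
      case (elim a)
      have "a * norm n' \<le> a * (3 / 2)" "a * (1 / 2) \<le> a * (n' \<bullet> n)"
        using elim(3) n' nn by (auto intro!: mult_left_mono)
      moreover have "\<bar>g p (f p' + a *\<^sub>R n') - a * (n' \<bullet> n)\<bar> \<le> 1 / 4 * (a * norm n')"
        "\<bar>g p (f p' - a *\<^sub>R n') + a * (n' \<bullet> n)\<bar> \<le> 1 / 4 * (a * norm n')"
        using est[of a] est[of "- a"] elim by simp_all
      ultimately show ?case using elim(3) unfolding n'_def[symmetric] by linarith
    qed
  next
    fix p' assume "p' \<in> M" "f p' \<in> ball x \<epsilon>"
    then show "\<exists>p\<in>?Q. p' \<in> N p" using e0(2) e(2) by (auto simp: N_def)
  qed
  then show ?thesis by blast
qed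

lemma vec2_expand: "(w :: real^2) = w $ 1 *\<^sub>R axis 1 1 + w $ 2 *\<^sub>R axis 2 1"
  by (simp add: vec_eq_iff forall_2 axis_def)

lemma cross3_linear_image:
  fixes D :: "real^2 \<Rightarrow> real^3"
  assumes "linear D"
  shows "cross3 (D a) (D b) = (a $ 1 * b $ 2 - a $ 2 * b $ 1) *\<^sub>R cross3 (D (axis 1 1)) (D (axis 2 1))"
proof -
  have e: "D w = w $ 1 *\<^sub>R D (axis 1 1) + w $ 2 *\<^sub>R D (axis 2 1)" for w
    by (subst vec2_expand[of w]) (simp add: linear_add[OF assms] linear_scale[OF assms])
  show ?thesis
    unfolding e[of a] e[of b] cross3_def
    by (simp add: vec_eq_iff forall_3 algebra_simps)
qed

lemma cross3_basis_nonzero: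
  fixes D :: "real^2 \<Rightarrow> real^3"
  assumes "linear D" "inj D"
  shows "cross3 (D (axis 1 1)) (D (axis 2 1)) \<noteq> 0"
proof
  assume "cross3 (D (axis 1 1)) (D (axis 2 1)) = 0"
  then have "collinear {0, D (axis 1 1), D (axis 2 1)}" by (simp add: cross_eq_0)
  then consider "D (axis 1 1) = 0" | "D (axis 2 1) = 0" | c where "D (axis 2 1) = c *\<^sub>R D (axis 1 1)"
    by (auto simp: collinear_lemma)
  then show False
  proof cases
    case 1
    then have "axis 1 1 = (0 :: real^2)" using assms by (metis injD linear_0)
    then show False by simp
  next
    case 2
    then have "axis 2 1 = (0 :: real^2)" using assms by (metis injD linear_0)
    then show False by simp
  next
    case (3 c)
    then have "D (axis 2 1) = D (c *\<^sub>R axis 1 1)" by (simp add: linear_scale[OF assms(1)])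
    then have "axis 2 1 = c *\<^sub>R (axis 1 1 :: real^2)" using assms(2) by (rule injD[rotated])
    then have "(axis 2 1 :: real^2) $ 2 = (c *\<^sub>R (axis 1 1 :: real^2)) $ 2" by simp
    then show False by (simp add: axis_def)
  qed
qed

locale immersed_surface =
  fixes X :: "'a topology" and A :: "'a atlas" and f :: "'a \<Rightarrow> real^3"
  assumes surface: "closed_oriented_surface X A" and immersion: "surface_immersion A f"
begin

abbreviation (input) local_map :: "'a set \<Rightarrow> ('a \<Rightarrow> real^2) \<Rightarrow> real^2 \<Rightarrow> real^3" where
  "local_map V \<phi> \<equiv> f \<circ> inv_into V \<phi>"

lemma charts_cover: "p \<in> topspace X \<Longrightarrow> \<exists>c. c \<in> A \<and> p \<in> fst c"
  using surface by (force simp: closed_oriented_surface_def)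

context
  fixes V \<phi> assumes chart: "(V, \<phi>) \<in> A"
begin

lemma chart_open: "openin X V" "open (\<phi> ` V)"
  and chart_homeo: "homeomorphic_map (subtopology X V) (top_of_set (\<phi> ` V)) \<phi>"
  using surface chart by (auto simp: closed_oriented_surface_def)

lemma chart_sub: "V \<subseteq> topspace X"
  using chart_open(1) by (rule openin_subset)

lemma chart_inj: "inj_on \<phi> V"
  using homeomorphic_imp_injective_map[OF chart_homeo] chart_sub by (simp add: Int_absorb1)

lemma chart_inv: "p \<in> V \<Longrightarrow> inv_into V \<phi> (\<phi> p) = p"
  by (rule inv_into_f_f[OF chart_inj])

lemma openin_chart_preimage:
  assumes "open S" shows "openin X {p \<in> V. \<phi> p \<in> S}"
proof -
  have "continuous_map (subtopology X V) (top_of_set (\<phi> ` V)) \<phi>"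
    by (rule homeomorphic_imp_continuous_map[OF chart_homeo])
  then have "openin (subtopology X V) {p \<in> topspace (subtopology X V). \<phi> p \<in> \<phi> ` V \<inter> S}"
    by (rule openin_continuous_map_preimage) (use assms in \<open>auto simp: openin_open\<close>)
  moreover have "{p \<in> topspace (subtopology X V). \<phi> p \<in> \<phi> ` V \<inter> S} = {p \<in> V. \<phi> p \<in> S}"
    using chart_sub by auto
  ultimately show ?thesis using chart_open(1) by (simp add: openin_trans_full)
qed

lemma open_chart_image:
  assumes "openin X W" shows "open (\<phi> ` (V \<inter> W))"
proof -
  have "openin (subtopology X V) (V \<inter> W)" using assms by (auto simp: openin_subtopology)
  then have "openin (top_of_set (\<phi> ` V)) (\<phi> ` (V \<inter> W))"
    using homeomorphic_imp_open_map[OF chart_homeo] by (auto simp: open_map_def)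
  then show ?thesis using chart_open(2) by (rule openin_open_trans)
qed

lemma local_map_C1: "C_k_on 1 (\<phi> ` V) (local_map V \<phi>)"
  and local_map_inj: "w \<in> \<phi> ` V \<Longrightarrow> inj (frechet_derivative (local_map V \<phi>) (at w))"
proof -
  have *: "smooth_on (\<phi> ` V) (local_map V \<phi>) \<and> (\<forall>u\<in>\<phi> ` V. inj (frechet_derivative (local_map V \<phi>) (at u)))"
    using immersion chart unfolding surface_immersion_def by fast
  show "C_k_on 1 (\<phi> ` V) (local_map V \<phi>)"
    using * unfolding smooth_on_def by blast
  show "w \<in> \<phi> ` V \<Longrightarrow> inj (frechet_derivative (local_map V \<phi>) (at w))" using * by blast
qed

lemma local_map_has_derivative:
  "w \<in> \<phi> ` V \<Longrightarrow> (local_map V \<phi> has_derivative frechet_derivative (local_map V \<phi>) (at w)) (at w)"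
  using local_map_C1 by (auto simp: frechet_derivative_works)

lemma continuous_on_local_map: "continuous_on (\<phi> ` V) (local_map V \<phi>)"
  using local_map_has_derivative has_derivative_continuous
  by (intro continuous_at_imp_continuous_on) blast

lemma local_map_linear: "w \<in> \<phi> ` V \<Longrightarrow> linear (frechet_derivative (local_map V \<phi>) (at w))"
  using local_map_has_derivative has_derivative_linear by blast

end

text \<open>
  A change of charts multiplies the cross product of the images of the basis vectors by the Jacobian
  determinant of the transition map, which is positive.\<close>

lemma surface_normal_in_chart:
  assumes c: "(V, \<phi>) \<in> A" and p: "p \<in> V"
  defines "D \<equiv> frechet_derivative (local_map V \<phi>) (at (\<phi> p))"
  shows "surface_normal A f p = sgn (cross3 (D (axis 1 1)) (D (axis 2 1)))"
proof -
  obtain W \<psi> where W: "(SOME c. c \<in> A \<and> p \<in> fst c) = (W, \<psi>)" 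
    by (cases "SOME c. c \<in> A \<and> p \<in> fst c")
  have "(W, \<psi>) \<in> A \<and> p \<in> W"
  proof -
    have "(V, \<phi>) \<in> A \<and> p \<in> fst (V, \<phi>)" using c p by simp
    from someI[of "\<lambda>c. c \<in> A \<and> p \<in> fst c", OF this] show ?thesis unfolding W by simp
  qed
  then have c': "(W, \<psi>) \<in> A" and p': "p \<in> W" by auto
  define E where "E = frechet_derivative (local_map W \<psi>) (at (\<psi> p))"
  have n: "surface_normal A f p = sgn (cross3 (E (axis 1 1)) (E (axis 2 1)))"
    by (simp add: surface_normal_def W E_def Let_def)
  define T where "T = \<psi> \<circ> inv_into V \<phi>"
  define B where "B = frechet_derivative T (at (\<phi> p))"
  have "smooth_on (\<phi> ` (V \<inter> W)) T \<and> (\<forall>u\<in>\<phi> ` (V \<inter> W). det (matrix (frechet_derivative T (at u))) > 0)"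
    using surface c c' unfolding closed_oriented_surface_def T_def by fast
  moreover have pVW: "\<phi> p \<in> \<phi> ` (V \<inter> W)" using p p' by blast
  ultimately have sm: "C_k_on 1 (\<phi> ` (V \<inter> W)) T" and det: "det (matrix B) > 0"
    by (auto simp: smooth_on_def B_def)
  have Tder: "(T has_derivative B) (at (\<phi> p))"
    using sm pVW unfolding B_def frechet_derivative_works[symmetric] by auto
  have Tp: "T (\<phi> p) = \<psi> p" by (simp add: T_def chart_inv[OF c p])
  have Eder: "(local_map W \<psi> has_derivative E) (at (T (\<phi> p)))"
    unfolding Tp E_def by (rule local_map_has_derivative[OF c']) (use p' in blast)
  have "((local_map W \<psi> \<circ> T) has_derivative (E \<circ> B)) (at (\<phi> p))"
    by (rule diff_chain_at[OF Tder Eder])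
  then have "(local_map V \<phi> has_derivative (E \<circ> B)) (at (\<phi> p))"
  proof (rule has_derivative_transform_within_open)
    show "open (\<phi> ` (V \<inter> W))" by (rule open_chart_image[OF c chart_open(1)[OF c']])
    show "\<phi> p \<in> \<phi> ` (V \<inter> W)" by (rule pVW)
    fix u assume "u \<in> \<phi> ` (V \<inter> W)"
    then obtain a where a: "a \<in> V" "a \<in> W" "u = \<phi> a" by blast
    then show "(local_map W \<psi> \<circ> T) u = local_map V \<phi> u"
      by (simp add: T_def chart_inv[OF c] chart_inv[OF c'])
  qed
  then have DE: "D = E \<circ> B" unfolding D_def by (rule frechet_derivative_at[symmetric])
  have linE: "linear E" using Eder by (rule has_derivative_linear)
  have "det (matrix B) = B (axis 1 1) $ 1 * B (axis 2 1) $ 2 - B (axis 1 1) $ 2 * B (axis 2 1) $ 1"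
    by (simp add: det_2 matrix_def)
  then have "cross3 (D (axis 1 1)) (D (axis 2 1)) = det (matrix B) *\<^sub>R cross3 (E (axis 1 1)) (E (axis 2 1))"
    using cross3_linear_image[OF linE, of "B (axis 1 1)" "B (axis 2 1)"] by (simp add: DE)
  then show ?thesis using det by (simp add: n sgn_scaleR)
qed

lemma
  assumes c: "(V, \<phi>) \<in> A" and p: "p \<in> V"
  shows norm_surface_normal: "norm (surface_normal A f p) = 1"
    and surface_normal_orthogonal: "frechet_derivative (local_map V \<phi>) (at (\<phi> p)) w \<bullet> surface_normal A f p = 0"
proof -
  define D where "D = frechet_derivative (local_map V \<phi>) (at (\<phi> p))"
  have D: "linear D" "inj D"
    unfolding D_def by (rule local_map_linear[OF c] local_map_inj[OF c], use p in blast)+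
  have n: "surface_normal A f p = sgn (cross3 (D (axis 1 1)) (D (axis 2 1)))"
    unfolding D_def by (rule surface_normal_in_chart[OF c p])
  show "norm (surface_normal A f p) = 1"
    using cross3_basis_nonzero[OF D] by (simp add: n norm_sgn)
  have "D w = w $ 1 *\<^sub>R D (axis 1 1) + w $ 2 *\<^sub>R D (axis 2 1)"
    by (subst vec2_expand[of w]) (simp add: linear_add[OF D(1)] linear_scale[OF D(1)])
  then show "frechet_derivative (local_map V \<phi>) (at (\<phi> p)) w \<bullet> surface_normal A f p = 0"
    unfolding D_def[symmetric] n by (simp add: sgn_div_norm inner_add_left dot_cross_self)
qed

lemma continuous_on_surface_normal:
  assumes c: "(V, \<phi>) \<in> A"
  shows "continuous_on (\<phi> ` V) (surface_normal A f \<circ> inv_into V \<phi>)"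
proof -
  let ?D = "\<lambda>w. frechet_derivative (local_map V \<phi>) (at w)"
  have "continuous_on (\<phi> ` V) (\<lambda>w. sgn (cross3 (?D w (axis 1 1)) (?D w (axis 2 1))))"
  proof (rule continuous_on_sgn)
    have "continuous_on (\<phi> ` V) (\<lambda>w. ?D w v)" for v
      using local_map_C1[OF c] by simp
    then show "continuous_on (\<phi> ` V) (\<lambda>w. cross3 (?D w (axis 1 1)) (?D w (axis 2 1)))"
      by (intro continuous_on_cross)
    show "\<forall>w\<in>\<phi> ` V. cross3 (?D w (axis 1 1)) (?D w (axis 2 1)) \<noteq> 0"
      using local_map_linear[OF c] local_map_inj[OF c] cross3_basis_nonzero by blast
  qed
  then show ?thesis
    by (rule continuous_on_eq) (auto simp: chart_inv[OF c] surface_normal_in_chart[OF c])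
qed

text \<open>
  Continuity is local, and in a chart the map is differentiable.\<close>

lemma continuous_map_surface: "continuous_map X euclidean f"
  unfolding continuous_map_def
proof (intro conjI allI impI)
  fix S :: "(real^3) set" assume S: "openin euclidean S"
  show "openin X {p \<in> topspace X. f p \<in> S}"
  proof (subst openin_subopen, intro ballI)
    fix p assume "p \<in> {p \<in> topspace X. f p \<in> S}"
    then have "p \<in> topspace X" and fp: "f p \<in> S" by auto
    then obtain V \<phi> where c: "(V, \<phi>) \<in> A" "p \<in> V" using charts_cover[of p] by auto
    have "open (\<phi> ` V \<inter> local_map V \<phi> -` S)"
      using continuous_on_local_map[OF c(1)] chart_open(2)[OF c(1)] S
      by (intro continuous_open_preimage) auto
    from openin_chart_preimage[OF c(1) this]
    have "openin X {p \<in> V. \<phi> p \<in> \<phi> ` V \<inter> local_map V \<phi> -` S}" .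
    also have "{p \<in> V. \<phi> p \<in> \<phi> ` V \<inter> local_map V \<phi> -` S} = {p \<in> V. f p \<in> S}"
      by (auto simp: chart_inv[OF c(1)] dest!: inj_onD[OF chart_inj[OF c(1)]])
    finally show "\<exists>T. openin X T \<and> p \<in> T \<and> T \<subseteq> {p \<in> topspace X. f p \<in> S}"
      using c fp chart_sub[OF c(1)] by (intro exI[of _ "{p \<in> V. f p \<in> S}"]) auto
  qed
qed simp

lemma compact_surface_image: "closedin X K \<Longrightarrow> compact (f ` K)"
  using surface image_compactin[OF closedin_compact_space continuous_map_surface]
  by (auto simp: closed_oriented_surface_def)

text \<open>
  Properness follows from compactness: the part of the surface outside the neighbourhoods has a compact image,
  and this image misses \<open>x\<close>.\<close>

lemma surface_sheet_chart:
  assumes gp: "general_position (surface_normal A f) (preimages (topspace X) f x)"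
  shows "\<exists>\<epsilon> N g. sheet_chart (topspace X) f (surface_normal A f) x \<epsilon> N g"
proof -
  have "\<exists>c. c \<in> A \<and> p \<in> fst c" if "p \<in> preimages (topspace X) f x" for p
    using charts_cover that by (auto simp: preimages_def)
  then obtain ch where ch: "\<And>p. p \<in> preimages (topspace X) f x \<Longrightarrow> ch p \<in> A \<and> p \<in> fst (ch p)" by metis
  define V \<phi> where "V p = fst (ch p)" and "\<phi> p = snd (ch p)" for p
  have c: "(V p, \<phi> p) \<in> A" "p \<in> V p" if "p \<in> preimages (topspace X) f x" for p
    using ch[OF that] by (auto simp: V_def \<phi>_def)
  show ?thesis
  proof (rule sheet_chart_exists[where W = "\<lambda>p. \<phi> p ` V p" and u = "\<lambda>p. \<phi> p p"
        and \<theta> = "\<lambda>p. inv_into (V p) (\<phi> p)" and D = "\<lambda>p. frechet_derivative (local_map (V p) (\<phi> p)) (at (\<phi> p p))"])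
    show "finite (preimages (topspace X) f x)" "inj_on (surface_normal A f) (preimages (topspace X) f x)"
      using gp by (auto simp: general_position_def)
    fix p assume p: "p \<in> preimages (topspace X) f x"
    note cp = c[OF p]
    have "inv_into (V p) (\<phi> p) ` \<phi> p ` V p \<subseteq> topspace X"
      using chart_sub[OF cp(1)] by (auto simp: chart_inv[OF cp(1)])
    then show "open (\<phi> p ` V p) \<and> \<phi> p p \<in> \<phi> p ` V p \<and> inv_into (V p) (\<phi> p) (\<phi> p p) = p \<and>
        inv_into (V p) (\<phi> p) ` \<phi> p ` V p \<subseteq> topspace X"
      using chart_open(2)[OF cp(1)] chart_inv[OF cp] cp(2) by blast
    show "strict_derivative_at (local_map (V p) (\<phi> p)) (frechet_derivative (local_map (V p) (\<phi> p)) (at (\<phi> p p))) (\<phi> p p)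
        \<and> inj (frechet_derivative (local_map (V p) (\<phi> p)) (at (\<phi> p p)))"
      using C1_imp_strict_derivative_at[OF chart_open(2)[OF cp(1)] _ local_map_C1[OF cp(1)]]
        local_map_inj[OF cp(1)] cp(2) by blast
    have "isCont (surface_normal A f \<circ> inv_into (V p) (\<phi> p)) (\<phi> p p)"
      using continuous_on_surface_normal[OF cp(1)] chart_open(2)[OF cp(1)] cp(2)
      by (meson continuous_on_eq_continuous_at image_eqI)
    then show "norm (surface_normal A f p) = 1 \<and>
        (\<forall>w. frechet_derivative (local_map (V p) (\<phi> p)) (at (\<phi> p p)) w \<bullet> surface_normal A f p = 0) \<and>
        isCont (surface_normal A f \<circ> inv_into (V p) (\<phi> p)) (\<phi> p p)"
      using norm_surface_normal[OF cp] surface_normal_orthogonal[OF cp] by blast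
  next
    fix W' :: "'a \<Rightarrow> (real^2) set"
    assume W': "\<And>p. p \<in> preimages (topspace X) f x \<Longrightarrow> open (W' p) \<and> \<phi> p p \<in> W' p \<and> W' p \<subseteq> \<phi> p ` V p"
    let ?O = "\<Union>p\<in>preimages (topspace X) f x. inv_into (V p) (\<phi> p) ` W' p"
    have "openin X (inv_into (V p) (\<phi> p) ` W' p)" if p: "p \<in> preimages (topspace X) f x" for p
    proof -
      note cp = c[OF p]
      have "inv_into (V p) (\<phi> p) ` W' p = {a \<in> V p. \<phi> p a \<in> W' p}"
      proof (intro equalityI subsetI)
        fix a assume "a \<in> inv_into (V p) (\<phi> p) ` W' p"
        then obtain b where b: "b \<in> V p" "\<phi> p b \<in> W' p" "a = inv_into (V p) (\<phi> p) (\<phi> p b)"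
          using W'[OF p] by blast
        then show "a \<in> {a \<in> V p. \<phi> p a \<in> W' p}" by (simp add: chart_inv[OF cp(1)])
      next
        fix a assume "a \<in> {a \<in> V p. \<phi> p a \<in> W' p}"
        then show "a \<in> inv_into (V p) (\<phi> p) ` W' p"
          by (intro image_eqI[of _ _ "\<phi> p a"]) (auto simp: chart_inv[OF cp(1)])
      qed
      then show ?thesis using openin_chart_preimage[OF cp(1)] W'[OF p] by simp
    qed
    then have "closedin X (topspace X - ?O)" by (intro closedin_diff closedin_topspace) blast
    then have "closed (f ` (topspace X - ?O))" using compact_surface_image compact_imp_closed by blast
    moreover have "x \<notin> f ` (topspace X - ?O)"
    proof
      assume "x \<in> f ` (topspace X - ?O)"
      then obtain p where p: "p \<in> topspace X" "f p = x" "p \<notin> ?O" by blast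
      then have px: "p \<in> preimages (topspace X) f x" by (simp add: preimages_def)
      then have "p \<in> inv_into (V p) (\<phi> p) ` W' p"
        using W'[OF px] by (intro image_eqI[of _ _ "\<phi> p p"]) (auto simp: chart_inv[OF c[OF px]])
      then show False using p(3) px by blast
    qed
    ultimately obtain \<epsilon> where "0 < \<epsilon>" "ball x \<epsilon> \<subseteq> - f ` (topspace X - ?O)"
      unfolding closed_def open_contains_ball by blast
    then show "\<exists>\<epsilon>>0. \<forall>p'\<in>topspace X. f p' \<in> ball x \<epsilon> \<longrightarrow>
        (\<exists>p\<in>preimages (topspace X) f x. p' \<in> inv_into (V p) (\<phi> p) ` W' p)"
      by (intro exI[of _ \<epsilon>]) blast
  qed simp
qed

lemma surface_generic_hypersurface:
  assumes "\<And>x. generic_at (topspace X) f (surface_normal A f) 3 x"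
  shows "generic_hypersurface (topspace X) f (surface_normal A f)"
proof
  show "bounded (f ` topspace X)" using compact_surface_image compact_imp_bounded by blast
  show "generic_at (topspace X) f (surface_normal A f) DIM(real^3) x" for x using assms[of x] by simp
  show "\<exists>\<epsilon> N g. sheet_chart (topspace X) f (surface_normal A f) x \<epsilon> N g" for x
    using assms[of x] by (intro surface_sheet_chart) (simp add: generic_at_def)
qed simp

end

lemma periodic_frac:
  fixes \<gamma> :: "real \<Rightarrow> 'b"
  assumes "\<And>u. \<gamma> (u + 1) = \<gamma> u"
  shows "\<gamma> (frac u) = \<gamma> u"
proof -
  have nat: "\<gamma> (u + real n) = \<gamma> u" for u n
  proof (induction n)
    case (Suc n)
    have "\<gamma> (u + real (Suc n)) = \<gamma> ((u + real n) + 1)" by (simp add: algebra_simps)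
    then show ?case using assms Suc by simp
  qed simp
  show ?thesis
  proof (cases "0 \<le> \<lfloor>u\<rfloor>")
    case True
    then have "u = frac u + real (nat \<lfloor>u\<rfloor>)" by (simp add: frac_def)
    then show ?thesis using nat[of "frac u" "nat \<lfloor>u\<rfloor>"] by simp
  next
    case False
    then have "frac u = u + real (nat (- \<lfloor>u\<rfloor>))" by (simp add: frac_def)
    then show ?thesis using nat[of u "nat (- \<lfloor>u\<rfloor>)"] by simp
  qed
qed

text \<open>
  The sheet through \<open>(i, u)\<close> is parametrized by all reals, \<open>s \<mapsto> (i, frac s)\<close>, so that the starting
  point \<open>u = 0\<close> of a circle needs no special treatment.\<close>

lemma curve_generic_hypersurface:
  assumes C: "generic_curve C"
  shows "generic_hypersurface (curve_dom C) (curve_map C) (curve_normal C)"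
proof
  let ?M = "curve_dom C" and ?f = "curve_map C" and ?\<nu> = "curve_normal C"
  have smooth: "smooth_on UNIV (param C i)" and cont_n: "continuous_on UNIV (conormal C i)"
    and per: "param C i (u + 1) = param C i u" "conormal C i (u + 1) = conormal C i u"
    and reg: "vector_derivative (param C i) (at u) \<noteq> 0" "norm (conormal C i u) = 1"
       "orthogonal (conormal C i u) (vector_derivative (param C i) (at u))"
    if "i < circles C" for i u
    using C that by (auto simp: generic_curve_def)
  have param_frac: "param C i (frac u) = param C i u" "conormal C i (frac u) = conormal C i u"
    if "i < circles C" for i u
    using that by (auto intro: periodic_frac per)
  have C1: "C_k_on 1 UNIV (param C i)" if "i < circles C" for i
    using smooth[OF that] unfolding smooth_on_def by blast
  have diff: "param C i differentiable at u" if "i < circles C" for i u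
    using C1[OF that] by simp
  have cont: "continuous_on UNIV (param C i)" if "i < circles C" for i
    using diff[OF that] by (simp add: continuous_at_imp_continuous_on differentiable_imp_continuous_within)
  have der: "frechet_derivative (param C i) (at u) = (\<lambda>w. w *\<^sub>R vector_derivative (param C i) (at u))"
    if "i < circles C" for i u
    using diff[OF that, of u] vector_derivative_works[of "param C i" "at u"]
    by (intro frechet_derivative_at[symmetric]) (simp add: has_vector_derivative_def)
  have "?f ` ?M \<subseteq> (\<Union>i<circles C. param C i ` {0..1})"
    by (auto simp: curve_map_def curve_dom_def)
  moreover have "compact (\<Union>i<circles C. param C i ` {0..1})"
    using cont by (intro compact_UN) (auto intro!: compact_continuous_image intro: continuous_on_subset)
  ultimately show "bounded (?f ` ?M)" using bounded_subset compact_imp_bounded by blast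
  show gen: "generic_at ?M ?f ?\<nu> DIM(real^2) x" for x using C by (simp add: generic_curve_def)
  fix x
  let ?Q = "preimages ?M ?f x"
  define \<theta> :: "nat \<times> real \<Rightarrow> real \<Rightarrow> nat \<times> real" where "\<theta> = (\<lambda>p s. (fst p, frac s))"
  have Q: "fst p < circles C" "snd p \<in> {0..<1}" "param C (fst p) (snd p) = x" if "p \<in> ?Q" for p
    using that by (auto simp: preimages_def curve_dom_def curve_map_def)
  have f\<theta>: "?f \<circ> \<theta> p = param C (fst p)" "?\<nu> \<circ> \<theta> p = conormal C (fst p)" if "p \<in> ?Q" for p
    using param_frac[OF Q(1)[OF that]] by (auto simp: fun_eq_iff \<theta>_def curve_map_def curve_normal_def)
  show "\<exists>\<epsilon> N g. sheet_chart ?M ?f ?\<nu> x \<epsilon> N g"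
  proof (rule sheet_chart_exists[where W = "\<lambda>_. UNIV" and u = snd and \<theta> = \<theta>
        and D = "\<lambda>p. frechet_derivative (param C (fst p)) (at (snd p))"])
    show "finite ?Q" "inj_on ?\<nu> ?Q" using gen[of x] by (auto simp: generic_at_def general_position_def)
    fix p assume p: "p \<in> ?Q"
    note i = Q(1)[OF p]
    show "open (UNIV :: real set) \<and> snd p \<in> UNIV \<and> \<theta> p (snd p) = p \<and> \<theta> p ` UNIV \<subseteq> ?M"
      using Q[OF p] by (auto simp: \<theta>_def curve_dom_def frac_lt_1)
    have "inj (frechet_derivative (param C (fst p)) (at (snd p)))"
      unfolding der[OF i] using reg(1)[OF i] by (auto simp: inj_on_def)
    then show "strict_derivative_at (?f \<circ> \<theta> p) (frechet_derivative (param C (fst p)) (at (snd p))) (snd p) \<and>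
        inj (frechet_derivative (param C (fst p)) (at (snd p)))"
      unfolding f\<theta>[OF p] using C1_imp_strict_derivative_at[OF open_UNIV UNIV_I C1[OF i]] by blast
    have "?\<nu> p = conormal C (fst p) (snd p)" by (simp add: curve_normal_def case_prod_beta)
    then show "norm (?\<nu> p) = 1 \<and> (\<forall>w. frechet_derivative (param C (fst p)) (at (snd p)) w \<bullet> ?\<nu> p = 0) \<and>
        isCont (?\<nu> \<circ> \<theta> p) (snd p)"
      unfolding f\<theta>[OF p] der[OF i] using reg(2,3)[OF i, of "snd p"] cont_n[OF i]
      by (auto simp: orthogonal_def inner_commute continuous_on_eq_continuous_at)
  next
    fix W' :: "nat \<times> real \<Rightarrow> real set"
    assume W': "\<And>p. p \<in> ?Q \<Longrightarrow> open (W' p) \<and> snd p \<in> W' p \<and> W' p \<subseteq> UNIV"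
    define T where "T i = (\<Union>p\<in>{p \<in> ?Q. fst p = i}. \<Union>n::int. (\<lambda>u. u + of_int n) -` W' p)" for i
    have oT: "open (T i)" for i
      unfolding T_def using W' by (intro open_UN ballI open_vimage) (auto intro!: continuous_intros)
    define L where "L = (\<Union>i<circles C. param C i ` ({0..1} - T i))"
    have "compact (param C i ` ({0..1} - T i))" if "i < circles C" for i
      by (intro compact_continuous_image compact_diff oT compact_Icc continuous_on_subset[OF cont[OF that]]) simp
    then have "closed L" unfolding L_def by (intro compact_imp_closed compact_UN) auto
    moreover have "x \<notin> L"
    proof
      assume "x \<in> L"
      then obtain i u where iu: "i < circles C" "u \<notin> T i" "param C i u = x" by (auto simp: L_def)
      have p: "(i, frac u) \<in> ?Q"
        using iu param_frac(1)[OF iu(1)] by (auto simp: preimages_def curve_dom_def curve_map_def frac_lt_1)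
      have "u + of_int (- \<lfloor>u\<rfloor>) = frac u" by (simp add: frac_def)
      then have "u + of_int (- \<lfloor>u\<rfloor>) \<in> W' (i, frac u)" using W'[OF p] by simp
      then have "u \<in> T i" unfolding T_def using p by (intro UN_I[of "(i, frac u)"] UN_I[of "- \<lfloor>u\<rfloor>"]) auto
      then show False using iu(2) by blast
    qed
    ultimately obtain \<epsilon> where e: "0 < \<epsilon>" "ball x \<epsilon> \<subseteq> - L"
      unfolding closed_def open_contains_ball by blast
    have "\<exists>p\<in>?Q. p' \<in> \<theta> p ` W' p" if p': "p' \<in> ?M" "?f p' \<in> ball x \<epsilon>" for p'
    proof -
      obtain i u where iu: "p' = (i, u)" "i < circles C" "u \<in> {0..<1}" using p'(1) by (auto simp: curve_dom_def)
      have "param C i u \<notin> L" using p'(2) e(2) iu(1) by (auto simp: curve_map_def)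
      then have "param C i u \<notin> param C i ` ({0..1} - T i)" using iu(2) unfolding L_def by blast
      then have "u \<notin> {0..1} - T i" by blast
      then have "u \<in> T i" using iu(3) by auto
      then obtain p n where p: "p \<in> ?Q" "fst p = i" "u + of_int n \<in> W' p" by (auto simp: T_def)
      have "p' = \<theta> p (u + of_int n)" using iu p(2) by (simp add: \<theta>_def)
      then show ?thesis using p by blast
    qed
    then show "\<exists>\<epsilon>>0. \<forall>p'\<in>?M. ?f p' \<in> ball x \<epsilon> \<longrightarrow> (\<exists>p\<in>?Q. p' \<in> \<theta> p ` W' p)" using e(1) by blast
  qed simp
qed simp

context immersed_surface
begin

lemma surface_normal_local:
  assumes f': "immersed_surface X A f'" and S: "openin X S" "p \<in> S" and eq: "\<And>p'. p' \<in> S \<Longrightarrow> f p' = f' p'"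
  shows "surface_normal A f p = surface_normal A f' p"
proof -
  interpret f': immersed_surface X A f' by fact
  have "p \<in> topspace X" using S openin_subset by blast
  then obtain V \<phi> where c: "(V, \<phi>) \<in> A" and p: "p \<in> V" using charts_cover[of p] by auto
  have "frechet_derivative (f \<circ> inv_into V \<phi>) (at (\<phi> p)) = frechet_derivative (f' \<circ> inv_into V \<phi>) (at (\<phi> p))"
  proof (rule frechet_derivative_transform_within_open)
    show "f \<circ> inv_into V \<phi> differentiable at (\<phi> p)"
      using local_map_has_derivative[OF c] p by (auto simp: frechet_derivative_works)
    show "open (\<phi> ` (V \<inter> S))" by (rule open_chart_image[OF c S(1)])
    show "\<phi> p \<in> \<phi> ` (V \<inter> S)" using p S(2) by blast
    fix u assume "u \<in> \<phi> ` (V \<inter> S)"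
    then obtain a where "a \<in> V" "a \<in> S" "u = \<phi> a" by blast
    then show "(f \<circ> inv_into V \<phi>) u = (f' \<circ> inv_into V \<phi>) u" by (simp add: chart_inv[OF c] eq)
  qed
  then show ?thesis by (simp add: surface_normal_in_chart[OF c p] f'.surface_normal_in_chart[OF c p])
qed

text \<open>
  Outside the closed ball the two maps coincide on an open subset of the surface, hence so do their derivatives
  and normals.\<close>

lemma surfaces_agree:
  assumes f': "immersed_surface X A f'" and p: "p \<in> topspace X"
    and eq: "\<And>p. p \<in> topspace X \<Longrightarrow> f p \<noteq> f' p \<Longrightarrow> f p \<in> cball q r \<and> f' p \<in> cball q r"
  shows "f p \<in> cball q r \<and> f' p \<in> cball q r \<or> f p = f' p \<and> surface_normal A f p = surface_normal A f' p"
proof (cases "f p \<in> cball q r")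
  case True
  then show ?thesis using eq[OF p] by (cases "f p = f' p") auto
next
  case False
  let ?S = "{p \<in> topspace X. f p \<in> - cball q r}"
  have "openin X ?S" by (rule openin_continuous_map_preimage[OF continuous_map_surface]) auto
  moreover have "p \<in> ?S" using p False by simp
  moreover have "f p' = f' p'" if "p' \<in> ?S" for p' using eq[of p'] that by auto
  ultimately show ?thesis using surface_normal_local[OF f'] by blast
qed

end

section \<open>The sides of the sheets on the slice plane\<close>

lemma lift_to_height_nth [simp]:
  "lift_to_height z y $ 1 = y $ 1" "lift_to_height z y $ 2 = y $ 2" "lift_to_height z y $ 3 = z"
  by (simp_all add: lift_to_height_def)

lemma plane_proj_nth [simp]: "plane_proj x $ 1 = x $ 1" "plane_proj x $ 2 = x $ 2"
  by (simp_all add: plane_proj_def)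

lemma plane_proj_lift [simp]: "plane_proj (lift_to_height z y) = y"
  by (simp add: vec_eq_iff forall_2)

lemma lift_plane_proj: "x $ 3 = z \<Longrightarrow> lift_to_height z (plane_proj x) = x"
  by (simp add: vec_eq_iff forall_3)

lemma lift_to_height_add_scaleR:
  "lift_to_height z (y + e *\<^sub>R n) = lift_to_height z y + e *\<^sub>R lift_to_height 0 n"
  by (simp add: vec_eq_iff forall_3)

lemma inner_lift_to_height_0: "lift_to_height 0 n \<bullet> x = n \<bullet> plane_proj x"
  by (simp add: inner_vec_def sum_3 sum_2)

lemma linear_plane_proj: "linear plane_proj"
  by (rule linearI) (simp_all add: vec_eq_iff forall_2)

lemma convex_above: "convex {x :: real^3. x $ 3 > b}" and convex_below: "convex {x :: real^3. x $ 3 < b}"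
  using convex_halfspace_gt[of b "axis 3 1 :: real^3"] convex_halfspace_lt[of "axis 3 1 :: real^3" b]
  by (simp_all add: inner_axis')

lemma continuous_on_plane_proj: "continuous_on S plane_proj"
  by (rule linear_continuous_on) (simp add: linear_plane_proj linear_conv_bounded_linear[symmetric])

lemma continuous_on_lift_to_height: "continuous_on S (lift_to_height z)"
proof -
  have eq: "lift_to_height z = (\<lambda>y. lift_to_height z 0 + lift_to_height 0 y)"
    by (auto simp: fun_eq_iff vec_eq_iff forall_3)
  have "linear (lift_to_height 0)" by (rule linearI) (simp_all add: vec_eq_iff forall_3)
  then have "continuous_on S (lift_to_height 0)"
    by (intro linear_continuous_on) (simp add: linear_conv_bounded_linear[symmetric])
  then show ?thesis by (subst eq) (intro continuous_on_add continuous_on_const)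
qed

text \<open>
  The region over which the moving sheet is a horizontal plane.\<close>

definition cylinder :: "real^3 \<Rightarrow> real \<Rightarrow> real \<Rightarrow> (real^3) set" where
  "cylinder q \<rho> \<eta> = {x. plane_proj x \<in> ball (plane_proj q) \<rho> \<and> \<bar>x $ 3 - q $ 3\<bar> < \<eta>}"

locale horizontal_sheet = sheet_arrangement M f \<nu> q r J U P
  for M :: "'m set" and f \<nu> :: "'m \<Rightarrow> real^3" and q r and J :: "'j set" and U P +
  fixes m :: 'j and z \<rho> \<eta> :: real
  assumes m_in: "m \<in> J"
    and W_sub: "cylinder q \<rho> \<eta> \<subseteq> ball q r" and height: "\<bar>z - q $ 3\<bar> < \<eta>" and \<rho>: "0 < \<rho>"
    and plane: "f ` U m \<inter> cylinder q \<rho> \<eta> = {x \<in> cylinder q \<rho> \<eta>. x $ 3 = z}"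
    and plane_normal: "\<And>p. p \<in> U m \<Longrightarrow> f p \<in> cylinder q \<rho> \<eta> \<Longrightarrow> \<nu> p = axis 3 1"
begin

abbreviation W :: "(real^3) set" where "W \<equiv> cylinder q \<rho> \<eta>"

lemma open_W: "open W"
proof -
  have "W = plane_proj -` ball (plane_proj q) \<rho> \<inter> {x. x $ 3 > q $ 3 - \<eta>} \<inter> {x. x $ 3 < q $ 3 + \<eta>}"
    by (auto simp: cylinder_def)
  then show ?thesis
    using open_vimage[OF open_ball continuous_on_plane_proj, of "plane_proj q" \<rho>]
    by (simp add: open_Int open_halfspace_component_gt_cart open_halfspace_component_lt_cart)
qed

lemma convex_W: "convex W"
proof -
  have "W = plane_proj -` ball (plane_proj q) \<rho> \<inter> {x. x $ 3 > q $ 3 - \<eta>} \<inter> {x. x $ 3 < q $ 3 + \<eta>}"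
    by (auto simp: cylinder_def)
  then show ?thesis
    by (simp add: convex_Int convex_linear_vimage[OF linear_plane_proj] convex_above convex_below)
qed

lemma lift_in_W: "y \<in> ball (plane_proj q) \<rho> \<Longrightarrow> lift_to_height z y \<in> W"
  using height by (simp add: cylinder_def )

text \<open>
  The plane cuts the convex cylinder into two connected halves, each on one side of the sheet; the
  upward normal tells which.\<close>

lemma moving_side:
  assumes "x \<in> W" "x $ 3 \<noteq> z"
  shows "x \<in> P m \<longleftrightarrow> x $ 3 > z"
proof -
  let ?x0 = "lift_to_height z (plane_proj q)"
  have x0: "?x0 \<in> W" using \<rho> by (intro lift_in_W) simp
  then have "?x0 \<in> f ` U m \<inter> W" unfolding plane by simp
  then obtain p where p: "p \<in> U m" "f p = ?x0" by auto
  have n: "\<nu> p = axis 3 1" using plane_normal[OF p(1)] p(2) x0 by simp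
  have ev: "\<forall>\<^sub>F e in at_right 0. ?x0 + e *\<^sub>R axis 3 1 \<in> P m \<and> ?x0 - e *\<^sub>R axis 3 1 \<in> opp m"
    using ray_side[OF m_in p(1)] unfolding n p(2) .
  have pos: "\<forall>\<^sub>F e::real in at_right 0. e > 0" by (simp add: eventually_at_right_less)
  have cover: "A \<subseteq> P m \<union> opp m" if "A \<subseteq> W" "\<forall>x\<in>A. x $ 3 \<noteq> z" for A
  proof
    fix x assume x: "x \<in> A"
    then have "x \<notin> f ` U m" using plane that by blast
    then show "x \<in> P m \<union> opp m" using x that(1) W_sub by blast
  qed
  have one: "A \<subseteq> P m \<or> A \<subseteq> opp m" if "A \<subseteq> W" "\<forall>x\<in>A. x $ 3 \<noteq> z" "convex A" for A
    using connectedD[OF convex_connected[OF that(3)] open_side[OF m_in] open_opp[OF m_in]]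
      cover[OF that(1,2)] by blast
  define A B where "A = {x \<in> W. x $ 3 > z}" and "B = {x \<in> W. x $ 3 < z}"
  have "convex A" "convex B"
    using convex_Int[OF convex_W convex_above[of z]] convex_Int[OF convex_W convex_below[of z]]
    by (simp_all add: A_def B_def Int_def)
  then have AB: "A \<subseteq> P m \<or> A \<subseteq> opp m" "B \<subseteq> P m \<or> B \<subseteq> opp m"
    using one[of A] one[of B] by (auto simp: A_def B_def)
  have "\<forall>\<^sub>F e in at_right 0. ?x0 + e *\<^sub>R axis 3 1 \<in> A \<inter> P m"
    using ev pos eventually_ray_in_open[OF open_W x0, of "axis 3 1"]
    by eventually_elim (auto simp: A_def)
  then obtain e where e: "?x0 + e *\<^sub>R axis 3 1 \<in> A \<inter> P m"
    using eventually_happens'[OF trivial_limit_at_right_real] by blast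
  have "\<forall>\<^sub>F e in at_right 0. ?x0 - e *\<^sub>R axis 3 1 \<in> B \<inter> opp m"
    using ev pos eventually_ray_in_open'[OF open_W x0, of "axis 3 1"]
    by eventually_elim (auto simp: B_def)
  then obtain e' where e': "?x0 - e' *\<^sub>R axis 3 1 \<in> B \<inter> opp m"
    using eventually_happens'[OF trivial_limit_at_right_real] by blast
  have "A \<subseteq> P m" using AB(1) e by blast
  moreover have "B \<subseteq> opp m" using AB(2) e' by blast
  ultimately show ?thesis using assms by (cases "x $ 3 > z") (auto simp: A_def B_def)
qed

end

text \<open>
  An arrangement of sheets together with the curve arrangement that it induces on the sheet \<open>m\<close>, which
  is horizontal in the cylinder.\<close>

locale sliced_arrangement =
  S: horizontal_sheet M f \<nu> q r "UNIV :: 'j::finite set" U P m z \<rho> \<eta> +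
  K: sheet_arrangement L \<gamma> \<kappa> c R "- {m}" V Pc
  for M :: "'m set" and f \<nu> :: "'m \<Rightarrow> real^3" and q r and U :: "'j::finite \<Rightarrow> 'm set" and P
    and m :: 'j and z \<rho> \<eta> :: real
    and L :: "'l set" and \<gamma> \<kappa> :: "'l \<Rightarrow> real^2" and c R and V Pc +
  assumes D_sub: "ball (plane_proj q) \<rho> \<subseteq> ball c R"
    and strand: "\<And>j. j \<noteq> m \<Longrightarrow>
       \<gamma> ` V j \<inter> ball (plane_proj q) \<rho> = {y \<in> ball (plane_proj q) \<rho>. lift_to_height z y \<in> f ` U j}"
    and strand_normal: "\<And>j a p. j \<noteq> m \<Longrightarrow> a \<in> V j \<Longrightarrow> p \<in> U j \<Longrightarrow> \<gamma> a \<in> ball (plane_proj q) \<rho> \<Longrightarrow>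
       f p = lift_to_height z (\<gamma> a) \<Longrightarrow> \<kappa> a = sgn (plane_proj (\<nu> p))"
    and unit_conormal: "\<And>a. a \<in> L \<Longrightarrow> norm (\<kappa> a) = 1"
begin

abbreviation lift :: "real^2 \<Rightarrow> real^3" where "lift \<equiv> lift_to_height z"

abbreviation W :: "(real^3) set" where "W \<equiv> cylinder q \<rho> \<eta>"

abbreviation D :: "(real^2) set" where "D \<equiv> ball (plane_proj q) \<rho>"

lemma strand_iff:
  assumes "j \<noteq> m" "y \<in> D"
  shows "y \<in> \<gamma> ` V j \<longleftrightarrow> lift y \<in> f ` U j"
proof -
  have "y \<in> \<gamma> ` V j \<inter> D \<longleftrightarrow> y \<in> {y \<in> D. lift y \<in> f ` U j}" by (simp only: strand[OF assms(1)])
  then show ?thesis using assms(2) by simp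
qed

text \<open>
  The point \<open>x\<close> of the strand is a double point of the surface, on the sheets \<open>l\<close> and \<open>m\<close>.  By
  \<open>local_sides\<close> the numbers of positive sides and of positive functions agree near \<open>x\<close>, where the side of \<open>m\<close> is
  known from the height.  Suppose that the point reached along the conormal, where \<open>g p > 0\<close>, were on the
  negative side of \<open>l\<close>.  Slightly below it, on the negative side of \<open>m\<close>, no side would be positive although \<open>g p\<close>
  is.  The opposite direction is symmetric, with a point slightly above.\<close>

lemma strand_side:
  assumes l: "l \<noteq> m" and a: "a \<in> V l" "\<gamma> a \<in> D" and simple: "preimages L \<gamma> (\<gamma> a) = {a}"
  shows "\<forall>\<^sub>F e in at_right 0. lift (\<gamma> a + e *\<^sub>R \<kappa> a) \<in> P l \<and> lift (\<gamma> a - e *\<^sub>R \<kappa> a) \<notin> P l"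
proof -
  define x w where "x = lift (\<gamma> a)" and "w = lift_to_height 0 (\<kappa> a)"
  have aL: "a \<in> L" using K.U_sub l a(1) by blast
  have xW: "x \<in> W" and xB: "x \<in> ball q r" using S.lift_in_W[OF a(2)] S.W_sub by (auto simp: x_def)
  have "x \<in> f ` U l" using strand_iff[OF l a(2)] a(1) by (simp add: x_def)
  then obtain p where p: "p \<in> U l" "f p = x" by blast
  have "x \<in> f ` U m \<inter> W" unfolding S.plane using xW by (simp add: x_def)
  then obtain pm where pm: "pm \<in> U m" "f pm = x" by blast
  have sheets: "S.sheets_at x = {l, m}"
  proof -
    have "j = l" if j: "j \<noteq> m" "x \<in> f ` U j" for j
    proof -
      have "\<gamma> a \<in> \<gamma> ` V j" using strand_iff[OF j(1) a(2)] j(2) by (simp add: x_def)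
      then obtain a' where a': "a' \<in> V j" "\<gamma> a = \<gamma> a'" by blast
      then have "a' \<in> preimages L \<gamma> (\<gamma> a)" using K.U_sub[of j] j(1) by (auto simp: preimages_def)
      then have "a' = a" using simple by simp
      then show ?thesis using K.disjoint_U a' a(1) j(1) l by (auto simp: disjoint_family_on_def)
    qed
    moreover have "x \<in> f ` U m" using pm by blast
    ultimately show ?thesis using \<open>x \<in> f ` U l\<close> by blast
  qed
  have ppm: "p \<noteq> pm" using S.disjoint_U p pm l by (auto simp: disjoint_family_on_def)
  have pre: "preimages M f x = {p, pm}"
  proof (rule card_subset_eq[symmetric])
    show "finite (preimages M f x)" by simp
    show "{p, pm} \<subseteq> preimages M f x" using p pm S.U_sub by (auto simp: preimages_def)
    show "card {p, pm} = card (preimages M f x)"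
      using S.card_sheets_at[OF xB] ppm l unfolding sheets by simp
  qed
  obtain \<epsilon> N g where ch: "sheet_chart M f \<nu> x \<epsilon> N g" and B: "ball x \<epsilon> \<subseteq> ball q r"
    and cnt: "\<And>u. u \<in> ball x \<epsilon> \<Longrightarrow> u \<notin> f ` M \<Longrightarrow>
      (\<Sum>j\<in>S.sheets_at x. of_bool (u \<in> P j) :: real) = (\<Sum>p\<in>preimages M f x. of_bool (g p u > 0))"
    by (rule S.local_sides[OF xB]) blast
  have count: "of_bool (u \<in> P l) + of_bool (u \<in> P m) = (of_bool (g p u > 0) + of_bool (g pm u > 0) :: real)"
    if "u \<in> ball x \<epsilon>" "u \<notin> f ` M" for u
    using cnt[OF that] l ppm unfolding sheets pre by (simp del: sum_of_bool_eq)
  have gp: "strict_derivative_at (g p) (\<lambda>w. w \<bullet> \<nu> p) x" "g p x = 0" "continuous_on (ball x \<epsilon>) (g p)" "0 < \<epsilon>"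
    using ch pre by (auto simp: sheet_chart_def)
  have conormal: "\<kappa> a = sgn (plane_proj (\<nu> p))"
    using strand_normal[OF l a(1) p(1) a(2)] p(2) by (simp add: x_def)
  have n0: "plane_proj (\<nu> p) \<noteq> 0"
  proof
    assume "plane_proj (\<nu> p) = 0"
    then show False using unit_conormal[OF aL] unfolding conormal by simp
  qed
  have "w \<bullet> \<nu> p = norm (plane_proj (\<nu> p))"
    unfolding w_def inner_lift_to_height_0 conormal using n0
    by (simp add: sgn_div_norm dot_square_norm power2_eq_square)
  then have w: "w \<bullet> \<nu> p > 0" using n0 by simp
  have off: "u \<in> P l \<union> S.opp l" if y: "y \<in> D" "u = lift y" "y \<notin> \<gamma> ` V l" for u y
  proof -
    have "u \<notin> f ` U l" using strand_iff[OF l y(1)] y(2,3) by simp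
    moreover have "u \<in> ball q r" using S.lift_in_W[OF y(1)] S.W_sub y(2) by blast
    ultimately show ?thesis by blast
  qed
  have l': "l \<in> - {m}" using l by simp
  have evK: "\<forall>\<^sub>F e in at_right 0. \<gamma> a + e *\<^sub>R \<kappa> a \<notin> \<gamma> ` V l \<and> \<gamma> a - e *\<^sub>R \<kappa> a \<notin> \<gamma> ` V l"
    using K.ray_side[OF l' a(1)] by eventually_elim (use K.side_sub[OF l'] in blast)
  have evD: "\<forall>\<^sub>F e in at_right 0. \<gamma> a + e *\<^sub>R \<kappa> a \<in> D" "\<forall>\<^sub>F e in at_right 0. \<gamma> a - e *\<^sub>R \<kappa> a \<in> D"
    using eventually_ray_in_open[OF open_ball a(2)] eventually_ray_in_open'[OF open_ball a(2)] by blast+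
  have xe: "x \<in> ball x \<epsilon>" using gp(4) by simp
  have evB: "\<forall>\<^sub>F e in at_right 0. x + e *\<^sub>R w \<in> ball x \<epsilon>" "\<forall>\<^sub>F e in at_right 0. x - e *\<^sub>R w \<in> ball x \<epsilon>"
    using eventually_ray_in_open[OF open_ball xe] eventually_ray_in_open'[OF open_ball xe] by blast+
  have evg: "\<forall>\<^sub>F e in at_right 0. g p (x + e *\<^sub>R w) > 0" "\<forall>\<^sub>F e in at_right 0. g p (x - e *\<^sub>R w) < 0"
    using strict_derivative_ray_sign(1)[OF gp(1,2) w] strict_derivative_ray_sign(2)[OF gp(1,2), of "- w"] w
    by simp_all
  \<comment> \<open>a vertical displacement leaves the slice plane without leaving the open set \<open>G\<close>\<close>
  have leave: "\<exists>u\<in>G. u \<notin> f ` M \<and> s * (u $ 3 - z) > 0"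
    if G: "open G" "u0 \<in> G" "u0 $ 3 = z" and s: "s \<noteq> 0" for G u0 and s :: real
  proof -
    have "\<forall>\<^sub>F e in at_right 0. u0 + e *\<^sub>R axis 3 s \<in> G" by (rule eventually_ray_in_open[OF G(1,2)])
    moreover have "\<forall>\<^sub>F e::real in at_right 0. e > 0" by (simp add: eventually_at_right_less)
    ultimately have "\<forall>\<^sub>F e in at_right 0. u0 + e *\<^sub>R axis 3 s \<in> G \<inter> {u. axis 3 s \<bullet> u > s * z}"
    proof eventually_elim
      case (elim e)
      have "s * (e * s) > 0" using elim(2) s by (metis mult.left_commute mult_pos_pos not_real_square_gt_zero)
      then show ?case using elim G(3) by (simp add: inner_axis' algebra_simps)
    qed
    then obtain e where "u0 + e *\<^sub>R axis 3 s \<in> G \<inter> {u. axis 3 s \<bullet> u > s * z}"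
      using eventually_happens'[OF trivial_limit_at_right_real] by blast
    moreover have "open (G \<inter> {u. axis 3 s \<bullet> u > s * z})" using G(1) by (intro open_Int open_halfspace_gt)
    ultimately obtain u where "u \<in> G \<inter> {u. axis 3 s \<bullet> u > s * z}" "u \<notin> f ` M"
      using S.image_nowhere_dense by blast
    then show ?thesis by (intro bexI[of _ u]) (auto simp: inner_axis' algebra_simps)
  qed
  have oP: "open (P l)" "open (S.opp l)" using S.open_side S.open_opp by blast+
  have og: "open (ball x \<epsilon> \<inter> g p -` {0<..})" "open (ball x \<epsilon> \<inter> g p -` {..<0})"
    by (auto intro: continuous_open_preimage[OF gp(3)])
  show ?thesis
    using evK evD evB evg
  proof eventually_elim
    case (elim e)
    have lift: "lift (\<gamma> a + e *\<^sub>R \<kappa> a) = x + e *\<^sub>R w" "lift (\<gamma> a - e *\<^sub>R \<kappa> a) = x - e *\<^sub>R w"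
      using lift_to_height_add_scaleR[of z "\<gamma> a" e "\<kappa> a"] lift_to_height_add_scaleR[of z "\<gamma> a" "- e" "\<kappa> a"]
      by (simp_all add: x_def w_def)
    have inW: "x + e *\<^sub>R w \<in> W" "x - e *\<^sub>R w \<in> W"
      using S.lift_in_W[OF elim(2)] S.lift_in_W[OF elim(3)] unfolding lift by blast+
    have h: "(x + e *\<^sub>R w) $ 3 = z" "(x - e *\<^sub>R w) $ 3 = z" by (simp_all add: x_def w_def)
    have "x + e *\<^sub>R w \<in> P l"
    proof (rule ccontr)
      assume "x + e *\<^sub>R w \<notin> P l"
      moreover have "x + e *\<^sub>R w \<in> P l \<union> S.opp l"
        using off[OF elim(2) refl conjunct1[OF elim(1)]] unfolding lift .
      ultimately have opp: "x + e *\<^sub>R w \<in> S.opp l" by simp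
      let ?G = "S.opp l \<inter> W \<inter> (ball x \<epsilon> \<inter> g p -` {0<..})"
      have "\<exists>u\<in>?G. u \<notin> f ` M \<and> (- 1) * (u $ 3 - z) > 0"
        by (rule leave[of _ "x + e *\<^sub>R w"]) (use opp inW(1) elim h oP(2) S.open_W og(1) in \<open>auto intro!: open_Int simp del: mem_ball\<close>)
      then obtain u where u: "u \<in> ?G" "u \<notin> f ` M" "u $ 3 < z" by auto
      then have "u \<notin> P m" using S.moving_side[of u] by auto
      then show False using count[of u] u by (auto simp: of_bool_def split: if_splits)
    qed
    moreover have "x - e *\<^sub>R w \<notin> P l"
    proof
      assume "x - e *\<^sub>R w \<in> P l"
      let ?G = "P l \<inter> W \<inter> (ball x \<epsilon> \<inter> g p -` {..<0})"
      have "\<exists>u\<in>?G. u \<notin> f ` M \<and> 1 * (u $ 3 - z) > 0"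
        by (rule leave[of _ "x - e *\<^sub>R w"])
          (use \<open>x - e *\<^sub>R w \<in> P l\<close> inW(2) elim h oP(1) S.open_W og(2) in \<open>auto intro!: open_Int simp del: mem_ball\<close>)
      then obtain u where u: "u \<in> ?G" "u \<notin> f ` M" "u $ 3 > z" by auto
      then have "u \<in> P m" using S.moving_side[of u] by auto
      then show False using count[of u] u by (auto simp: of_bool_def split: if_splits)
    qed
    ultimately show ?case unfolding lift by blast
  qed
qed

text \<open>
  The difference \<open>?E\<close> of the two truth values does not jump across simple points of the curve, so it is
  a constant \<open>d\<close> on the disc.  Next to a point of the strand there are points with \<open>y \<in> Pc l\<close>, where
  \<open>?E \<ge> 0\<close>, and points on the other side, where \<open>?E \<le> 0\<close>; hence \<open>d = 0\<close>.\<close>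

lemma slice_side:
  assumes l: "l \<noteq> m" and meets: "\<gamma> ` V l \<inter> D \<noteq> {}" and y: "y \<in> D" "y \<notin> \<gamma> ` V l"
  shows "y \<in> Pc l \<longleftrightarrow> lift y \<in> P l"
proof -
  have l': "l \<in> - {m}" using l by simp
  let ?E = "\<lambda>y. of_bool (y \<in> Pc l) - of_bool (lift y \<in> P l) :: real"
  have st: "steady I ?E y" if y: "y \<in> D" "y \<notin> \<gamma> ` V l" for y I
  proof (rule steady_diff)
    show "steady I (\<lambda>y. of_bool (y \<in> Pc l)) y"
      by (rule K.side_steady[OF l']) (use y D_sub in auto)
    have "lift y \<notin> f ` U l" using strand_iff[OF l y(1)] y(2) by simp
    moreover have "lift y \<in> ball q r" using S.lift_in_W[OF y(1)] S.W_sub by blast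
    ultimately show "steady I (\<lambda>y. of_bool (lift y \<in> P l)) y"
      by (intro steady_of_bool[of "lift -` P l" "lift -` S.opp l"] open_vimage[OF S.open_side] open_vimage[OF S.open_opp]
          continuous_on_lift_to_height) auto
  qed
  obtain d where d: "\<And>y. y \<in> D \<Longrightarrow> y \<notin> \<gamma> ` L \<Longrightarrow> ?E y = d"
  proof (rule K.const_if_no_jump[OF open_ball connected_ball, where \<phi> = ?E])
    show "steady (\<gamma> ` L) ?E y" if "y \<in> D" "y \<notin> \<gamma> ` L" for y
      by (rule st) (use that K.U_sub[OF l'] in auto)
    fix a assume a: "a \<in> L" "\<gamma> a \<in> D" "preimages L \<gamma> (\<gamma> a) = {a}"
    show "\<forall>\<^sub>F e in at_right 0. ?E (\<gamma> a + e *\<^sub>R \<kappa> a) = ?E (\<gamma> a - e *\<^sub>R \<kappa> a)"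
    proof (cases "a \<in> V l")
      case True
      from K.ray_side[OF l' True] strand_side[OF l True a(2,3)] show ?thesis
        by eventually_elim simp
    next
      case False
      have "\<gamma> a \<notin> \<gamma> ` V l"
      proof
        assume "\<gamma> a \<in> \<gamma> ` V l"
        then obtain a' where a': "a' \<in> V l" "\<gamma> a = \<gamma> a'" by (rule imageE)
        then have "a' \<in> preimages L \<gamma> (\<gamma> a)" using K.U_sub[OF l'] by (auto simp: preimages_def)
        then show False using a(3) a'(1) False by auto
      qed
      then show ?thesis by (intro steady_no_jump st a)
    qed
  qed blast
  obtain a where a: "a \<in> V l" "\<gamma> a \<in> D" using meets by blast
  have "\<forall>\<^sub>F e in at_right 0. \<gamma> a + e *\<^sub>R \<kappa> a \<in> D \<inter> Pc l"
    using K.ray_side[OF l' a(1)] eventually_ray_in_open[OF open_ball a(2)] by eventually_elim blast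
  then obtain e where "\<gamma> a + e *\<^sub>R \<kappa> a \<in> D \<inter> Pc l"
    using eventually_happens'[OF trivial_limit_at_right_real] by blast
  then obtain u where "u \<in> D \<inter> Pc l" "u \<notin> \<gamma> ` L"
    using K.image_nowhere_dense open_Int[OF open_ball K.open_side[OF l']] by blast
  then have "d \<ge> 0" using d[of u] by auto
  have "\<forall>\<^sub>F e in at_right 0. \<gamma> a - e *\<^sub>R \<kappa> a \<in> D \<inter> K.opp l"
    using K.ray_side[OF l' a(1)] eventually_ray_in_open'[OF open_ball a(2)] by eventually_elim blast
  then obtain e' where "\<gamma> a - e' *\<^sub>R \<kappa> a \<in> D \<inter> K.opp l"
    using eventually_happens'[OF trivial_limit_at_right_real] by blast
  then obtain u' where "u' \<in> D \<inter> K.opp l" "u' \<notin> \<gamma> ` L"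
    using K.image_nowhere_dense open_Int[OF open_ball K.open_opp[OF l']] by blast
  then have "d \<le> 0" using d[of u'] by auto
  obtain \<epsilon> b where e: "0 < \<epsilon>" "\<forall>y'\<in>ball y \<epsilon> - {}. ?E y' = b"
    using st[OF y, of "{}"] unfolding steady_def by blast
  have "y \<in> ball y \<epsilon> \<inter> D" using e(1) y(1) by simp
  then obtain y' where y': "y' \<in> ball y \<epsilon> \<inter> D" "y' \<notin> \<gamma> ` L"
    by (rule K.image_nowhere_dense[OF open_Int[OF open_ball open_ball]])
  then have "?E y' = d" "?E y' = b" "?E y = b" using d[of y'] e y' by auto
  then have "?E y = 0" using \<open>d \<ge> 0\<close> \<open>d \<le> 0\<close> by linarith
  then show ?thesis by (auto simp: of_bool_def split: if_splits)
qed

text \<open>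
  The vertices \<open>v l\<close>, \<open>l \<noteq> m\<close>, of the simplex lie on the sheet \<open>m\<close> and project to the vertices \<open>w l\<close> of the
  triangle.\<close>

lemma card_positive_vertices:
  assumes v: "sheets_bound_simplex f UNIV U v" and w: "sheets_bound_simplex \<gamma> (- {m}) V w"
    and vW: "\<And>l. v l \<in> W" and J: "card (UNIV :: 'j set) = 4"
  shows "card {l. v l \<in> P l} = card {l \<in> - {m}. w l \<in> Pc l} + of_bool (v m $ 3 > z)"
proof -
  have v1: "(\<Inter>j\<in>- {l}. f ` U j) = {v l}" and v2: "v l \<notin> f ` U l" for l
    using v by (auto simp: sheets_bound_simplex_def Compl_eq_Diff_UNIV)
  have w1: "(\<Inter>j\<in>- {m} - {l}. \<gamma> ` V j) = {w l}" and w2: "w l \<notin> \<gamma> ` V l" if "l \<noteq> m" for l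
    using w that by (auto simp: sheets_bound_simplex_def)
  have vj: "v l \<in> f ` U j" if "j \<noteq> l" for j l using v1[of l] that by blast
  have vw: "w l \<in> D" "lift (w l) = v l" if l: "l \<noteq> m" for l
  proof -
    have "v l \<in> f ` U m \<inter> W" using vj[of m l] vW l by blast
    then have h: "v l $ 3 = z" unfolding S.plane by simp
    have D: "plane_proj (v l) \<in> D" using vW[of l] by (simp add: cylinder_def )
    have "plane_proj (v l) \<in> \<gamma> ` V j" if "j \<noteq> m" "j \<noteq> l" for j
      using strand_iff[OF that(1) D] vj[OF that(2)] lift_plane_proj[OF h] by simp
    then have "plane_proj (v l) = w l" using w1[OF l] by blast
    then show "w l \<in> D" "lift (w l) = v l" using D lift_plane_proj[OF h] by auto
  qed
  have side: "w l \<in> Pc l \<longleftrightarrow> v l \<in> P l" if l: "l \<noteq> m" for l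
  proof -
    have "card (- {l, m} :: 'j set) = 2"
      using J l by (simp add: card_Diff_subset Compl_eq_Diff_UNIV)
    then have "- {l, m} \<noteq> {}" by fastforce
    then obtain k where k: "k \<noteq> l" "k \<noteq> m" by blast
    have "w k \<in> \<gamma> ` V l \<inter> D" using w1[OF k(2)] vw(1)[OF k(2)] k(1) l by blast
    then have "\<gamma> ` V l \<inter> D \<noteq> {}" by blast
    from slice_side[OF l this vw(1)[OF l] w2[OF l]] show ?thesis unfolding vw(2)[OF l] .
  qed
  have "v m \<notin> f ` U m \<inter> W" using v2 by blast
  then have "v m $ 3 \<noteq> z" unfolding S.plane using vW by blast
  then have m: "v m \<in> P m \<longleftrightarrow> v m $ 3 > z" using S.moving_side[OF vW] by blast
  have "{l. v l \<in> P l} = {l \<in> - {m}. w l \<in> Pc l} \<union> (if v m \<in> P m then {m} else {})"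
  proof (rule set_eqI)
    fix l
    show "l \<in> {l. v l \<in> P l} \<longleftrightarrow> l \<in> {l \<in> - {m}. w l \<in> Pc l} \<union> (if v m \<in> P m then {m} else {})"
      by (cases "l = m") (use side[of l] in auto)
  qed
  then show ?thesis using m by (auto simp: card_insert_if)
qed

end

section \<open>The change of the invariant under the event\<close>

text \<open>
  Comparing all times before the event with one time after it, and conversely, shows that \<open>v t m\<close> keeps
  its side before and after the event; so the side at the single time \<open>s\<close> decides the direction of the
  transition.\<close>

lemma slice_sgn_eq:
  fixes s t :: real
  assumes inv: "\<forall>s\<in>{-1<..<0}. \<forall>t\<in>{0<..<1}. inverted_simplices UNIV (P s) (v s) (P t) (v t)"
    and side: "\<And>t. t \<in> {-1<..<1} - {0} \<Longrightarrow> v t m $ 3 \<noteq> h t \<and> (v t m \<in> P t m \<longleftrightarrow> v t m $ 3 > h t)"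
    and s: "s \<in> {-1<..<0}" and t: "t \<in> {0<..<1}"
  shows "slice_sgn v m h = (if v s m $ 3 > h s then - 1 else 1)"
proof -
  have flip: "v s' m \<in> P s' m \<longleftrightarrow> v t' m \<notin> P t' m" if "s' \<in> {-1<..<0}" "t' \<in> {0<..<1}" for s' t'
    using inv that by (auto simp: inverted_simplices_def)
  have before: "v s' m $ 3 \<noteq> h s' \<and> (v s' m $ 3 > h s' \<longleftrightarrow> v s m $ 3 > h s)" if "s' \<in> {-1<..<0}" for s'
    using flip[OF that t] flip[OF s t] side[of s'] side[of s] that s by auto
  have after: "v t' m $ 3 \<noteq> h t' \<and> (v t' m $ 3 > h t' \<longleftrightarrow> \<not> v s m $ 3 > h s)" if "t' \<in> {0<..<1}" for t'
    using flip[OF s that] side[of t'] side[of s] that s by auto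
  show ?thesis
  proof (cases "v s m $ 3 > h s")
    case True
    have "upward_transition v m h"
      unfolding upward_transition_def using before after True by (meson not_less_iff_gr_or_eq)
    then show ?thesis using True by (simp add: slice_sgn_def)
  next
    case False
    have "downward_transition v m h"
      unfolding downward_transition_def using before after False by (meson not_less_iff_gr_or_eq)
    moreover have "\<not> upward_transition v m h"
      using False s unfolding upward_transition_def by auto
    ultimately show ?thesis using False by (simp add: slice_sgn_def)
  qed
qed

theorem theorem3p2:
  fixes X :: "'a topology" and A :: "'a atlas" and F :: "real \<Rightarrow> 'a \<Rightarrow> real^3"
    and q :: "real^3" and r :: real and U :: "4 \<Rightarrow> 'a set"
    and P :: "real \<Rightarrow> 4 \<Rightarrow> (real^3) set" and v :: "real \<Rightarrow> 4 \<Rightarrow> real^3"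
    and m :: 4 and \<rho> :: real and h :: "real \<Rightarrow> real" and s t :: real
    and C C' :: plane_curve and c :: real
    and \<alpha> \<alpha>' :: "real^3 \<Rightarrow> real" and \<beta> \<beta>' :: "real^2 \<Rightarrow> real"
  assumes "closed_oriented_surface X A"
    and "quadruple_event X A F q r U P v"
    and "slice_plane A F q r U v m \<rho> h"
    and "s \<in> {-1<..<0}" and "t \<in> {0<..<1}"
    and "induced_reidemeister3 A F q U m \<rho> h s t C C'"
    and "surface_alexander X A (F s) \<alpha>" and "surface_alexander X A (F t) \<alpha>'"
    and "curve_alexander C c \<beta>" and "curve_alexander C' c \<beta>'"
  shows "St_surface X A (F t) \<alpha>' - St_surface X A (F s) \<alpha> =
         (St_curve C' \<beta>' - St_curve C \<beta>) + slice_sgn v m h"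
proof -
  note event = assms(2)[unfolded quadruple_event_def, THEN conjunct2]
  obtain r' where r': "r' < r" and supp: "\<forall>s\<in>{-1<..<1}. \<forall>t\<in>{-1<..<1}. \<forall>p\<in>topspace X.
      F s p \<noteq> F t p \<longrightarrow> F s p \<in> cball q r'"
    using event[THEN conjunct1] by (elim exE conjE)
  have sheets: "sheets_in_ball (topspace X) (F t) (surface_normal A (F t)) (ball q r) UNIV U (P t)"
    if "t \<in> {-1<..<1}" for t
    using bspec[OF event[THEN conjunct2, THEN conjunct1] that] by (rule conjunct1)
  have gen: "generic_surface X A (F t)" and simplex: "sheets_bound_simplex (F t) UNIV U (v t)"
    if "t \<in> {-1<..<1} - {0}" for t
    using bspec[OF event[THEN conjunct2, THEN conjunct2, THEN conjunct1] that] by (rule conjunct1 conjunct2)+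
  have inv: "\<forall>s\<in>{-1<..<0}. \<forall>t\<in>{0<..<1}. inverted_simplices UNIV (P s) (v s) (P t) (v t)"
    using event by (elim conjE)
  have st: "s \<in> {-1<..<1} - {0}" "t \<in> {-1<..<1} - {0}" using assms(4,5) by auto
  have surf: "immersed_surface X A (F t)" if "t \<in> {-1<..<1} - {0}" for t
    using gen[OF that] assms(1) by (simp add: immersed_surface_def generic_surface_def)
  have arr: "sheet_arrangement (topspace X) (F t) (surface_normal A (F t)) q r UNIV U (P t)"
    if t: "t \<in> {-1<..<1} - {0}" for t
  proof -
    have "generic_hypersurface (topspace X) (F t) (surface_normal A (F t))"
      by (rule immersed_surface.surface_generic_hypersurface[OF surf[OF t]])
        (use gen[OF t] in \<open>simp add: generic_surface_def\<close>)
    moreover have "sheet_arrangement_axioms (topspace X) (F t) (surface_normal A (F t)) q r UNIV U (P t)"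
      by unfold_locales (use sheets t in auto)
    ultimately show ?thesis by (simp add: sheet_arrangement_def)
  qed
  let ?D = "ball (plane_proj q) \<rho>"
  obtain \<eta> where W: "cylinder q \<rho> \<eta> \<subseteq> ball q r"
    and moving: "\<forall>t\<in>{-1<..<1}. \<bar>h t - q $ 3\<bar> < \<eta> \<and>
      F t ` U m \<inter> cylinder q \<rho> \<eta> = {x \<in> cylinder q \<rho> \<eta>. x $ 3 = h t} \<and>
      (\<forall>p\<in>U m. F t p \<in> cylinder q \<rho> \<eta> \<longrightarrow> surface_normal A (F t) p = axis 3 1)"
    and vertices: "\<forall>t\<in>{-1<..<1} - {0}. \<forall>l. v t l \<in> cylinder q \<rho> \<eta>"
    using assms(3) unfolding slice_plane_def Let_def cylinder_def[symmetric] by (elim exE conjE)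
  have height: "\<bar>h t - q $ 3\<bar> < \<eta>"
    and plane: "F t ` U m \<inter> cylinder q \<rho> \<eta> = {x \<in> cylinder q \<rho> \<eta>. x $ 3 = h t}"
    and plane_normal: "\<And>p. p \<in> U m \<Longrightarrow> F t p \<in> cylinder q \<rho> \<eta> \<Longrightarrow> surface_normal A (F t) p = axis 3 1"
    if "t \<in> {-1<..<1}" for t
    using bspec[OF moving that] by blast+
  have vertex: "v t l \<in> cylinder q \<rho> \<eta>" if "t \<in> {-1<..<1} - {0}" for t l
    using bspec[OF vertices that] by (rule spec)
  obtain b R V where D_sub: "?D \<subseteq> ball b R" and reid: "reidemeister3 C C' b R (- {m}) V"
    and strand: "\<And>j. j \<in> - {m} \<Longrightarrow> strand_is_slice A (F s) (U j) (h s) ?D C (V j)"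
    using assms(6) unfolding induced_reidemeister3_def Let_def by blast
  have gC: "generic_curve C" "generic_curve C'" and cJ: "card (- {m}) = 3" and circ: "circles C = circles C'"
    using reid by (auto simp: reidemeister3_def)
  have dom: "curve_dom C' = curve_dom C" using circ by (simp add: curve_dom_def)
  obtain R' where R': "R' < R" and agree: "\<And>a. a \<in> curve_dom C \<Longrightarrow>
      curve_map C a \<in> cball b R' \<and> curve_map C' a \<in> cball b R' \<or>
      curve_map C a = curve_map C' a \<and> curve_normal C a = curve_normal C' a"
    using reid unfolding reidemeister3_def by blast
  obtain Pc Pc' w w' where
    sC: "sheets_in_ball (curve_dom C) (curve_map C) (curve_normal C) (ball b R) (- {m}) V Pc"
    and sC': "sheets_in_ball (curve_dom C') (curve_map C') (curve_normal C') (ball b R) (- {m}) V Pc'"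
    and w: "sheets_bound_simplex (curve_map C) (- {m}) V w" "sheets_bound_simplex (curve_map C') (- {m}) V w'"
    and winv: "inverted_simplices (- {m}) Pc w Pc' w'"
    using reid unfolding reidemeister3_def by blast
  have arrC: "sheet_arrangement (curve_dom C) (curve_map C) (curve_normal C) b R (- {m}) V Pc"
    unfolding sheet_arrangement_def sheet_arrangement_axioms_def
    using curve_generic_hypersurface[OF gC(1)] sC by simp
  have arrC': "sheet_arrangement (curve_dom C) (curve_map C') (curve_normal C') b R (- {m}) V Pc'"
    unfolding sheet_arrangement_def sheet_arrangement_axioms_def
    using curve_generic_hypersurface[OF gC(2)] sC' by (simp add: dom)
  have unit: "norm (curve_normal C a) = 1" if "a \<in> curve_dom C" for a
    using gC(1) that by (auto simp: generic_curve_def curve_dom_def curve_normal_def)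
  have rho: "0 < \<rho>"
  proof -
    have "plane_proj (v s m) \<in> ?D" using vertex[OF st(1)] by (simp add: cylinder_def)
    then show ?thesis by (metis ball_eq_empty empty_iff not_less)
  qed
  have horiz: "horizontal_sheet (topspace X) (F t) (surface_normal A (F t)) q r UNIV U (P t) m (h t) \<rho> \<eta>"
    if t: "t \<in> {-1<..<1} - {0}" for t
  proof -
    have t1: "t \<in> {-1<..<1}" using t by simp
    show ?thesis
      unfolding horizontal_sheet_def horizontal_sheet_axioms_def
      using arr[OF t] W height[OF t1] plane[OF t1] plane_normal[OF t1] rho by blast
  qed
  have sliced: "sliced_arrangement (topspace X) (F s) (surface_normal A (F s)) q r U (P s)
      m (h s) \<rho> \<eta> (curve_dom C) (curve_map C) (curve_normal C) b R V Pc"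
    unfolding sliced_arrangement_def
  proof (intro conjI horiz[OF st(1)] arrC)
    have "curve_map C ` V j \<inter> ?D = {y \<in> ?D. lift_to_height (h s) y \<in> F s ` U j}"
      and "\<And>a p. a \<in> V j \<Longrightarrow> p \<in> U j \<Longrightarrow> curve_map C a \<in> ?D \<Longrightarrow> F s p = lift_to_height (h s) (curve_map C a) \<Longrightarrow>
        curve_normal C a = sgn (plane_proj (surface_normal A (F s) p))" if "j \<noteq> m" for j
      using strand[of j] that unfolding strand_is_slice_def by auto
    then show "sliced_arrangement_axioms (F s) (surface_normal A (F s)) q U m (h s) \<rho> (curve_dom C) (curve_map C)
        (curve_normal C) b R V"
      using D_sub unit unfolding sliced_arrangement_axioms_def by blast
  qed
  have count: "card {l. v s l \<in> P s l} = card {l \<in> - {m}. w l \<in> Pc l} + of_bool (v s m $ 3 > h s)"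
    by (rule sliced_arrangement.card_positive_vertices[OF sliced simplex[OF st(1)] w(1) vertex[OF st(1)]]) simp
  have side: "v t m $ 3 \<noteq> h t \<and> (v t m \<in> P t m \<longleftrightarrow> v t m $ 3 > h t)" if t: "t \<in> {-1<..<1} - {0}" for t
  proof -
    have "v t m \<notin> F t ` U m" using simplex[OF t] by (simp add: sheets_bound_simplex_def)
    then have "v t m \<notin> {x \<in> cylinder q \<rho> \<eta>. x $ 3 = h t}" using plane[of t] t by blast
    then have "v t m $ 3 \<noteq> h t" using vertex[OF t] by blast
    then show ?thesis using horizontal_sheet.moving_side[OF horiz[OF t] vertex[OF t]] by blast
  qed
  have sgn: "slice_sgn v m h = (if v s m $ 3 > h s then - 1 else 1)"
    by (rule slice_sgn_eq[OF inv side assms(4,5)])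
  have "St 3 (topspace X) (F t) (surface_normal A (F t)) \<alpha>' - St 3 (topspace X) (F s) (surface_normal A (F s)) \<alpha>
      = 4 - 2 * real (card {l. v s l \<in> P s l})"
  proof -
    have "inverted_simplices UNIV (P s) (v s) (P t) (v t)" using inv assms(4,5) by blast
    moreover have "F s p \<in> cball q r' \<and> F t p \<in> cball q r' \<or>
        F s p = F t p \<and> surface_normal A (F s) p = surface_normal A (F t) p" if "p \<in> topspace X" for p
    proof (rule immersed_surface.surfaces_agree[OF surf[OF st(1)] surf[OF st(2)] that])
      fix p assume "p \<in> topspace X" "F s p \<noteq> F t p"
      then show "F s p \<in> cball q r' \<and> F t p \<in> cball q r'"
        using supp[rule_format, of s t p] supp[rule_format, of t s p] st by simp
    qed
    ultimately show ?thesis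
      using St_simplex_inversion[OF arr[OF st(1)] arr[OF st(2)] _ _ r' _ simplex[OF st(1)] simplex[OF st(2)]]
        assms(7,8) unfolding surface_alexander_def by simp
  qed
  moreover have "St 2 (curve_dom C) (curve_map C') (curve_normal C') \<beta>' - St 2 (curve_dom C) (curve_map C) (curve_normal C) \<beta>
      = 3 - 2 * real (card {l \<in> - {m}. w l \<in> Pc l})"
    using St_simplex_inversion[OF arrC arrC' _ _ R' agree w winv] assms(9,10) cJ
    unfolding curve_alexander_def dom by simp
  ultimately show ?thesis
    using count sgn unfolding St_surface_def St_curve_def dom by (simp split: if_splits)
qed

end
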